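(* Let $\mathbb{T}$ be a dependent type theory with strong sums and propositional identity types. Then the classifying category of $\mathbb{T}$, with its class of fibrations, carries the structure of a path category; that is, there is a class of morphisms, called weak equivalences, which together with the class of fibrations of the classifying category satisfies all the axioms of a path category.
   Context: **Type theory.** A dependent type theory is a formal system deriving statements $\mathcal{J}\,[\Gamma]$, where $\Gamma=[x_0\in A_0, x_1\in A_1(x_0),\ldots,x_n\in A_n(x_0,\ldots,x_{n-1})]$ is a (possibly empty) well-formed context of distinct typed variables and $\mathcal{J}$ is a judgement of one of the forms $A\in\mathrm{Type}$, $a\in A$, $A=B\in\mathrm{Type}$, $a=b\in A$ (the last two being definitional equality). All rules are stated relative to an arbitrary shared ambient context, which is left implicit. The basic rules are: the variable axiom $x\in A\,[x\in A]$; weakening (from $\mathcal{J}\,[\Gamma]$ and $A\in\mathrm{Type}$ infer $\mathcal{J}\,[x\in A,\Gamma]$, $x$ fresh); substitution (from $\mathcal{J}\,[x\in A,\Gamma]$ and $a\in A$ infer $\mathcal{J}[a/x]\,[\Gamma[a/x]]$); reflexivity, symmetry and transitivity of definitional equality of types and of terms; and compatibility (from $a\in A$ and $A=B$ infer $a\in B$; from $a=b\in A$ and $A=B$ infer $a=b\in B$). The theory may have further type and term constructors and rules; all type and term constructors satisfy the usual congruence rules with respect to definitional equality. **Strong sums.** The type theory has strong sums if it has a type $1$ with a term $*\in 1$ and the definitional equality $a=*\in 1$ for every $a\in 1$, and a constructor $\Sigma$ with rules: from $A\in\mathrm{Type}$ and $B\in\mathrm{Type}\,[x\in A]$ infer $\Sigma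 x\in A.B\in\mathrm{Type}$; from $a\in A$, $b\in B[a/x]$ infer $\mathbf{p}ab\in\Sigma x\in A.B$; from $c\in\Sigma x\in A.B$ infer $\mathbf{p}_0c\in A$ and $\mathbf{p}_1c\in B[\mathbf{p}_0c/x]$; with definitional equalities $\mathbf{p}_0(\mathbf{p}ab)=a$, $\mathbf{p}_1(\mathbf{p}ab)=b$, $\mathbf{p}(\mathbf{p}_0c)(\mathbf{p}_1c)=c$. **Propositional identity types.** The type theory has propositional identity types if it has constructors $\mathrm{Id},\mathbf{r},\mathbf{J},\mathbf{H}$ (with congruence rules) and the following rules. Formation: from $a\in A$, $b\in A$ infer $\mathrm{Id}_A(a,b)\in\mathrm{Type}$. Introduction: from $a\in A$ infer $\mathbf{r}(a)\in\mathrm{Id}_A(a,a)$. Elimination: from $C(x,y,u)\in\mathrm{Type}\,[x\in A,y\in A,u\in\mathrm{Id}_A(x,y),\Delta(x,y,u)]$, $p\in\mathrm{Id}_A(a,b)$ and $d(x)\in C(x,x,\mathbf{r}(x))\,[x\in A,\Delta(x,x,\mathbf{r}(x))]$ infer $\mathbf{J}(a,b,p,d)\in C(a,b,p)\,[\Delta(a,b,p)]$. Computation: from $C(x,y,u)\in\mathrm{Type}\,[x\in A,y\in A,u\in\mathrm{Id}_A(x,y),\Delta(x,y,u)]$, $a\in A$ and $d(x)\in C(x,x,\mathbf{r}(x))\,[x\in A,\Delta(x,x,\mathbf{r}(x))]$ infer $\mathbf{H}(a,d)\in\mathrm{Id}_{C(a,a,\mathbf{r}(a))}(\mathbf{J}(a,a,\mathbf{r}(a),d),d(a))\,[\Delta(a,a,\mathbf{r}(a))]$.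 Here $\Delta$ is an arbitrary contextual parameter, and $C$, $d$ may depend on its variables (suppressed in the notation). **Classifying (syntactic) category.** Its objects are contexts, two contexts of the same length being identified if their corresponding types are derivably definitionally equal. For $\Gamma=[x_0\in A_0,\ldots,x_n\in A_n]$, a morphism $\Delta\to\Gamma$ is an equivalence class of sequences of terms $(t_0,\ldots,t_n)$ with $t_0\in A_0\,[\Delta]$, $t_1\in A_1(t_0)\,[\Delta]$, ..., $t_n\in A_n(t_0,\ldots,t_{n-1})\,[\Delta]$ derivable, two such sequences being identified if corresponding terms are derivably definitionally equal. Composition is by substitution. A dependent projection is a morphism $[\Gamma,\Delta]\to\Gamma$ dropping a final segment of a context. The fibrations are the morphisms isomorphic to dependent projections. **Path category.** A path category is a category $\mathcal{C}$ with two classes of maps, weak equivalences and fibrations (maps in both classes are called acyclic fibrations), such that: (1) isomorphisms are fibrations and fibrations are closed under composition; (2) the pullback of a fibration along any other map exists and is again a fibration; (3) $\mathcal{C}$ has a terminal object $1$ and every map $X\to 1$ is a fibration; (4) isomorphisms are weak equivalences; (5) weak equivalences satisfy 2-out-of-6: if $f,g,h$ are composable and $gf$ and $hg$ are weak equivalences, then so are $f,g,h,hgf$; (6) for every object $B$ the diagonal $B\to B\times B$ factors as a weak equivalence $r:B\to PB$ followed by a fibration $(s,t):PB\to B\times B$; (7) every acyclic fibration has a section; (8) the pullback of an acyclic fibration along any other map exists and is again an acyclic fibration. *)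

theory Defs
  imports Main
begin

section \<open>Raw syntax\<close>

text \<open>
  De Bruijn syntax over a type \<open>'k\<close> of type and term constructors. An argument \<open>(n, e)\<close> of a
  constructor is an expression \<open>e\<close> in which the \<open>n\<close> innermost variables are bound. Types and
  terms share one syntactic category, so that universes are not excluded.
\<close>

datatype 'k expr = Var nat | Con 'k "(nat \<times> 'k expr) list"

fun rename :: "(nat \<Rightarrow> nat) \<Rightarrow> 'k expr \<Rightarrow> 'k expr" where
  "rename f (Var i) = Var (f i)"
| "rename f (Con c as) =
     Con c (map (\<lambda>(n, e). (n, rename (\<lambda>i. if i < n then i else f (i - n) + n) e)) as)"

definition lift :: "nat \<Rightarrow> (nat \<Rightarrow> 'k expr) \<Rightarrow> nat \<Rightarrow> 'k expr" where
  "lift n \<sigma> i = (if i < n then Var i else rename (\<lambda>j. j + n) (\<sigma> (i - n)))"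

fun subst :: "(nat \<Rightarrow> 'k expr) \<Rightarrow> 'k expr \<Rightarrow> 'k expr" where
  "subst \<sigma> (Var i) = \<sigma> i"
| "subst \<sigma> (Con c as) = Con c (map (\<lambda>(n, e). (n, subst (lift n \<sigma>) e)) as)"

definition wk :: "nat \<Rightarrow> 'k expr" where
  "wk i = Var (Suc i)"

text \<open>Replaces the \<open>length ts\<close> innermost variables by \<open>ts\<close> and renumbers the others.\<close>

definition inst :: "'k expr list \<Rightarrow> nat \<Rightarrow> 'k expr" where
  "inst ts i = (if i < length ts then ts ! i else Var (i - length ts))"

fun scoped :: "nat \<Rightarrow> 'k expr \<Rightarrow> bool" where
  "scoped n (Var i) \<longleftrightarrow> i < n"
| "scoped n (Con c as) \<longleftrightarrow> (\<forall>(k, e) \<in> set as. scoped (n + k) e)"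

text \<open>
  Contexts, and context extensions, list the types of their variables with the most recent one
  first: \<open>[x\<^sub>0 \<in> A\<^sub>0, \<dots>, x\<^sub>n \<in> A\<^sub>n]\<close> is \<open>[A\<^sub>n, \<dots>, A\<^sub>0]\<close>, and \<open>[\<Gamma>, \<Delta>]\<close> is \<open>\<Delta> @ \<Gamma>\<close>.
\<close>

type_synonym 'k ctx = "'k expr list"

fun ctx_subst :: "(nat \<Rightarrow> 'k expr) \<Rightarrow> 'k ctx \<Rightarrow> 'k ctx" where
  "ctx_subst \<sigma> [] = []"
| "ctx_subst \<sigma> (A # \<Delta>) = subst (lift (length \<Delta>) \<sigma>) A # ctx_subst \<sigma> \<Delta>"

datatype 'k judgement =
    IsType "'k expr"
  | HasType "'k expr" "'k expr"
  | EqType "'k expr" "'k expr"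
  | EqTerm "'k expr" "'k expr" "'k expr"

fun judg_subst :: "(nat \<Rightarrow> 'k expr) \<Rightarrow> 'k judgement \<Rightarrow> 'k judgement" where
  "judg_subst \<sigma> (IsType A) = IsType (subst \<sigma> A)"
| "judg_subst \<sigma> (HasType a A) = HasType (subst \<sigma> a) (subst \<sigma> A)"
| "judg_subst \<sigma> (EqType A B) = EqType (subst \<sigma> A) (subst \<sigma> B)"
| "judg_subst \<sigma> (EqTerm a b A) = EqTerm (subst \<sigma> a) (subst \<sigma> b) (subst \<sigma> A)"

fun judg_scoped :: "nat \<Rightarrow> 'k judgement \<Rightarrow> bool" where
  "judg_scoped n (IsType A) \<longleftrightarrow> scoped n A"
| "judg_scoped n (HasType a A) \<longleftrightarrow> scoped n a \<and> scoped n A"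
| "judg_scoped n (EqType A B) \<longleftrightarrow> scoped n A \<and> scoped n B"
| "judg_scoped n (EqTerm a b A) \<longleftrightarrow> scoped n a \<and> scoped n b \<and> scoped n A"


section \<open>Type theories\<close>

text \<open>
  A rule is the set of its instances; an instance consists of a list of premises and a conclusion.
  The ambient context is left implicit: each premise \<open>(\<Delta>, J)\<close> only records the context extension
  \<open>\<Delta>\<close> by which it goes beyond the ambient context, which is also the context of the conclusion.
  A type theory is given by the set of the rules that it has in addition to the basic rules and
  to the congruence rules, and these rules have to be stable under substitution for the variables
  of the ambient context.
\<close>

type_synonym 'k premise = "'k ctx \<times> 'k judgement"
type_synonym 'k rule = "('k premise list \<times> 'k judgement) set"
type_synonym 'k type_theory = "'k rule set"

definition prem_subst :: "(nat \<Rightarrow> 'k expr) \<Rightarrow> 'k premise \<Rightarrow> 'k premise" where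
  "prem_subst \<sigma> = (\<lambda>(\<Delta>, J). (ctx_subst \<sigma> \<Delta>, judg_subst (lift (length \<Delta>) \<sigma>) J))"

definition dependent_type_theory :: "'k type_theory \<Rightarrow> bool" where
  "dependent_type_theory T \<longleftrightarrow>
     (\<forall>\<rho> \<in> T. \<forall>(ps, J) \<in> \<rho>. \<forall>\<sigma>. (map (prem_subst \<sigma>) ps, judg_subst \<sigma> J) \<in> \<rho>)"

text \<open>What has to be derivable for a statement \<open>J [\<Gamma>]\<close> to make sense.\<close>

fun judg_presup :: "'k judgement \<Rightarrow> 'k judgement list" where
  "judg_presup (IsType A) = []"
| "judg_presup (HasType a A) = [IsType A]"
| "judg_presup (EqType A B) = [IsType A, IsType B]"
| "judg_presup (EqTerm a b A) = [HasType a A, HasType b A]"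

definition presup :: "'k ctx \<Rightarrow> 'k judgement \<Rightarrow> ('k ctx \<times> 'k judgement) list" where
  "presup \<Gamma> J = map (\<lambda>i. (drop (Suc i) \<Gamma>, IsType (\<Gamma> ! i))) [0..<length \<Gamma>]
     @ map (Pair \<Gamma>) (judg_presup J)"

text \<open>
  The statement that two corresponding parts of two instances of a rule are definitionally
  equal; for equational premises this is no condition.
\<close>

fun equate :: "'k judgement \<Rightarrow> 'k judgement \<Rightarrow> 'k judgement option" where
  "equate (IsType A) (IsType B) = Some (EqType A B)"
| "equate (HasType a A) (HasType b B) = Some (EqTerm a b A)"
| "equate (EqType A B) (EqType A' B') = Some (EqType A B)"
| "equate (EqTerm a b A) (EqTerm a' b' A') = Some (EqTerm a b A)"
| "equate _ _ = None"

text \<open>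
  The statements \<open>J [\<Gamma>]\<close> derivable in \<open>T\<close>. The rules of \<open>T\<close> may leave those premises implicit
  which are presupposed by their conclusion. The clause \<open>congruence\<close> provides each rule of \<open>T\<close> that
  forms a type or a term with its congruence rule: if two instances of the rule are applicable and
  have definitionally equal premises, then their conclusions are definitionally equal. Hence
  different constructors are meant to be introduced by different rules.
\<close>

inductive derivable :: "'k type_theory \<Rightarrow> 'k ctx \<Rightarrow> 'k judgement \<Rightarrow> bool" for T where
  variable:
    "derivable T \<Gamma> (IsType A) \<Longrightarrow> derivable T (A # \<Gamma>) (HasType (Var 0) (subst wk A))"
| weakening:
    "\<lbrakk>derivable T (\<Delta> @ \<Gamma>) J; derivable T \<Gamma> (IsType A)\<rbrakk>
     \<Longrightarrow> derivable T (ctx_subst wk \<Delta> @ A # \<Gamma>) (judg_subst (lift (length \<Delta>) wk) J)"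
| substitution:
    "\<lbrakk>derivable T (\<Delta> @ A # \<Gamma>) J; derivable T \<Gamma> (HasType a A)\<rbrakk>
     \<Longrightarrow> derivable T (ctx_subst (inst [a]) \<Delta> @ \<Gamma>) (judg_subst (lift (length \<Delta>) (inst [a])) J)"
| type_refl: "derivable T \<Gamma> (IsType A) \<Longrightarrow> derivable T \<Gamma> (EqType A A)"
| type_sym: "derivable T \<Gamma> (EqType A B) \<Longrightarrow> derivable T \<Gamma> (EqType B A)"
| type_trans:
    "\<lbrakk>derivable T \<Gamma> (EqType A B); derivable T \<Gamma> (EqType B C)\<rbrakk> \<Longrightarrow> derivable T \<Gamma> (EqType A C)"
| term_refl: "derivable T \<Gamma> (HasType a A) \<Longrightarrow> derivable T \<Gamma> (EqTerm a a A)"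
| term_sym: "derivable T \<Gamma> (EqTerm a b A) \<Longrightarrow> derivable T \<Gamma> (EqTerm b a A)"
| term_trans:
    "\<lbrakk>derivable T \<Gamma> (EqTerm a b A); derivable T \<Gamma> (EqTerm b c A)\<rbrakk>
     \<Longrightarrow> derivable T \<Gamma> (EqTerm a c A)"
| conversion:
    "\<lbrakk>derivable T \<Gamma> (HasType a A); derivable T \<Gamma> (EqType A B)\<rbrakk> \<Longrightarrow> derivable T \<Gamma> (HasType a B)"
| conversion_eq:
    "\<lbrakk>derivable T \<Gamma> (EqTerm a b A); derivable T \<Gamma> (EqType A B)\<rbrakk>
     \<Longrightarrow> derivable T \<Gamma> (EqTerm a b B)"
| rule:
    "\<lbrakk>\<rho> \<in> T; (ps, J) \<in> \<rho>;
      \<forall>\<Delta> I. (\<Delta>, I) \<in> set ps \<longrightarrow> derivable T (\<Delta> @ \<Gamma>) I;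
      judg_scoped (length \<Gamma>) J;
      \<forall>\<Gamma>' I. (\<Gamma>', I) \<in> set (presup \<Gamma> J) \<longrightarrow> derivable T \<Gamma>' I\<rbrakk>
     \<Longrightarrow> derivable T \<Gamma> J"
| congruence:
    "\<lbrakk>\<rho> \<in> T; (ps, J) \<in> \<rho>; (qs, K) \<in> \<rho>;
      \<forall>\<Delta> I. (\<Delta>, I) \<in> set ps \<longrightarrow> derivable T (\<Delta> @ \<Gamma>) I;
      \<forall>\<Delta> I. (\<Delta>, I) \<in> set qs \<longrightarrow> derivable T (\<Delta> @ \<Gamma>) I;
      length ps = length qs;
      \<forall>i < length ps. \<exists>E. equate (snd (ps ! i)) (snd (qs ! i)) = Some E
        \<and> derivable T (fst (ps ! i) @ \<Gamma>) E;
      equate J K = Some E;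
      judg_scoped (length \<Gamma>) E;
      \<forall>\<Gamma>' I. (\<Gamma>', I) \<in> set (presup \<Gamma> E) \<longrightarrow> derivable T \<Gamma>' I\<rbrakk>
     \<Longrightarrow> derivable T \<Gamma> E"


subsection \<open>Strong sums\<close>

definition app :: "'k \<Rightarrow> 'k expr list \<Rightarrow> 'k expr" where
  "app c es = Con c (map (Pair 0) es)"

definition sum_type :: "'k \<Rightarrow> 'k expr \<Rightarrow> 'k expr \<Rightarrow> 'k expr" where
  "sum_type \<Sigma> A B = Con \<Sigma> [(0, A), (1, B)]"

definition unit_rules :: "'k \<Rightarrow> 'k \<Rightarrow> 'k rule set" where
  "unit_rules one star =
    {{([], IsType (app one []))},
     {([], HasType (app star []) (app one []))},
     {([([], HasType a (app one []))], EqTerm a (app star []) (app one [])) | a. True}}"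

definition sum_rules :: "'k \<Rightarrow> 'k \<Rightarrow> 'k \<Rightarrow> 'k \<Rightarrow> 'k rule set" where
  "sum_rules \<Sigma> p p\<^sub>0 p\<^sub>1 =
    {{([([], IsType A), ([A], IsType B)], IsType (sum_type \<Sigma> A B)) | A B. True},
     {([([], IsType A), ([A], IsType B), ([], HasType a A), ([], HasType b (subst (inst [a]) B))],
        HasType (app p [a, b]) (sum_type \<Sigma> A B)) | A B a b. True},
     {([([], IsType A), ([A], IsType B), ([], HasType c (sum_type \<Sigma> A B))],
        HasType (app p\<^sub>0 [c]) A) | A B c. True},
     {([([], IsType A), ([A], IsType B), ([], HasType c (sum_type \<Sigma> A B))],
        HasType (app p\<^sub>1 [c]) (subst (inst [app p\<^sub>0 [c]]) B)) | A B c. True},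
     {([([], IsType A), ([A], IsType B), ([], HasType a A), ([], HasType b (subst (inst [a]) B))],
        EqTerm (app p\<^sub>0 [app p [a, b]]) a A) | A B a b. True},
     {([([], IsType A), ([A], IsType B), ([], HasType a A), ([], HasType b (subst (inst [a]) B))],
        EqTerm (app p\<^sub>1 [app p [a, b]]) b (subst (inst [a]) B)) | A B a b. True},
     {([([], IsType A), ([A], IsType B), ([], HasType c (sum_type \<Sigma> A B))],
        EqTerm (app p [app p\<^sub>0 [c], app p\<^sub>1 [c]]) c (sum_type \<Sigma> A B)) | A B c. True}}"

definition strong_sums :: "'k type_theory \<Rightarrow> bool" where
  "strong_sums T \<longleftrightarrow>
    (\<exists>one star \<Sigma> p p\<^sub>0 p\<^sub>1. unit_rules one star \<subseteq> T \<and> sum_rules \<Sigma> p p\<^sub>0 p\<^sub>1 \<subseteq> T)"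


subsection \<open>Propositional identity types\<close>

text \<open>
  In \<open>J(a, b, p, d) [\<Delta>(a, b, p)]\<close> the variables of \<open>\<Delta>\<close> are suppressed. They have type \<open>\<Delta>(x, x, r(x))\<close>
  in \<open>d\<close>, but \<open>\<Delta>(a, b, p)\<close> in the result, so they are bound in \<open>d\<close> together with \<open>x\<close>, and the result
  is applied to terms \<open>ts\<close> of the types \<open>\<Delta>(a, b, p)\<close>. For \<open>ts\<close> the variables of \<open>\<Delta>(a, b, p)\<close>
  themselves, with that context as part of the ambient context, this is the usual rule, of which
  the general case is a substitution instance. The same applies to \<open>H\<close>. There is one elimination
  and one computation rule for each length \<open>n\<close> of \<open>\<Delta>\<close>.
\<close>

definition J_term :: "'k \<Rightarrow> 'k expr \<Rightarrow> 'k expr \<Rightarrow> 'k expr \<Rightarrow> 'k expr \<Rightarrow> 'k expr list \<Rightarrow> 'k expr" where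
  "J_term J a b p d ts =
     Con J ([(0, a), (0, b), (0, p), (Suc (length ts), d)] @ map (Pair 0) ts)"

definition H_term :: "'k \<Rightarrow> 'k expr \<Rightarrow> 'k expr \<Rightarrow> 'k expr list \<Rightarrow> 'k expr" where
  "H_term H a d ts = Con H ([(0, a), (Suc (length ts), d)] @ map (Pair 0) ts)"

text \<open>\<open>[x \<in> A, y \<in> A, u \<in> Idt A x y]\<close>\<close>

definition id_ctx :: "'k \<Rightarrow> 'k expr \<Rightarrow> 'k ctx" where
  "id_ctx Idt A = [app Idt [subst wk (subst wk A), Var 1, Var 0], subst wk A, A]"

text \<open>The substitution \<open>(x, y, u) := (x, x, r(x))\<close> from \<open>[x \<in> A]\<close> to \<open>[x \<in> A, y \<in> A, u \<in> Idt A x y]\<close>.\<close>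

definition diag :: "'k \<Rightarrow> nat \<Rightarrow> 'k expr" where
  "diag r i = (if i = 0 then app r [Var 0] else if i \<le> 2 then Var 0 else Var (i - 2))"

text \<open>
  \<open>ts\<close>, again with the last term first, is a sequence of terms of the types \<open>\<Delta>(es)\<close>, where \<open>es\<close>
  are terms for the variables that directly precede \<open>\<Delta>\<close>.
\<close>

definition sequence_premises :: "'k expr list \<Rightarrow> 'k ctx \<Rightarrow> 'k expr list \<Rightarrow> 'k premise list" where
  "sequence_premises es \<Delta> ts =
     map (\<lambda>i. ([], HasType (ts ! i) (subst (inst (drop (Suc i) ts @ es)) (\<Delta> ! i)))) [0..<length \<Delta>]"

definition elim_premises ::
  "'k \<Rightarrow> 'k \<Rightarrow> 'k expr \<Rightarrow> 'k ctx \<Rightarrow> 'k expr \<Rightarrow> 'k expr \<Rightarrow> 'k premise list" where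
  "elim_premises Idt r A \<Delta> C d =
    [([], IsType A),
     (\<Delta> @ id_ctx Idt A, IsType C),
     (ctx_subst (diag r) \<Delta> @ [A], HasType d (subst (lift (length \<Delta>) (diag r)) C))]"

definition id_rules :: "'k \<Rightarrow> 'k \<Rightarrow> 'k \<Rightarrow> 'k \<Rightarrow> 'k rule set" where
  "id_rules Idt r J H =
    {{([([], IsType A), ([], HasType a A), ([], HasType b A)], IsType (app Idt [A, a, b]))
        | A a b. True},
     {([([], IsType A), ([], HasType a A)], HasType (app r [a]) (app Idt [A, a, a])) | A a. True}}
    \<union> (\<Union>n.
    {{(elim_premises Idt r A \<Delta> C d
         @ [([], HasType a A), ([], HasType b A), ([], HasType p (app Idt [A, a, b]))]
         @ sequence_premises [p, b, a] \<Delta> ts,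
        HasType (J_term J a b p d ts) (subst (inst (ts @ [p, b, a])) C))
        | A \<Delta> C d a b p ts. length \<Delta> = n \<and> length ts = n},
     {(elim_premises Idt r A \<Delta> C d
         @ [([], HasType a A)]
         @ sequence_premises [app r [a], a, a] \<Delta> ts,
        HasType (H_term H a d ts)
          (app Idt [subst (inst (ts @ [app r [a], a, a])) C,
                   J_term J a a (app r [a]) d ts,
                   subst (inst (ts @ [a])) d]))
        | A \<Delta> C d a ts. length \<Delta> = n \<and> length ts = n}})"

definition propositional_identity_types :: "'k type_theory \<Rightarrow> bool" where
  "propositional_identity_types T \<longleftrightarrow> (\<exists>Idt r J H. id_rules Idt r J H \<subseteq> T)"


section \<open>Categories and path categories\<close>

record ('o, 'm) cat =
  Obj :: "'o set"
  Mor :: "'m set"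
  Dom :: "'m \<Rightarrow> 'o"
  Cod :: "'m \<Rightarrow> 'o"
  Ide :: "'o \<Rightarrow> 'm"
  Comp :: "'m \<Rightarrow> 'm \<Rightarrow> 'm"  (infixl "\<cdot>\<index>" 70)

definition hom :: "('o, 'm) cat \<Rightarrow> 'o \<Rightarrow> 'o \<Rightarrow> 'm set" where
  "hom C X Y = {f \<in> Mor C. Dom C f = X \<and> Cod C f = Y}"

locale category =
  fixes C :: "('o, 'm) cat" (structure)
  assumes Dom_in_Obj: "f \<in> Mor C \<Longrightarrow> Dom C f \<in> Obj C"
    and Cod_in_Obj: "f \<in> Mor C \<Longrightarrow> Cod C f \<in> Obj C"
    and Ide_in_hom: "X \<in> Obj C \<Longrightarrow> Ide C X \<in> hom C X X"
    and Comp_in_hom: "\<lbrakk>f \<in> hom C X Y; g \<in> hom C Y Z\<rbrakk> \<Longrightarrow> g \<cdot> f \<in> hom C X Z"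
    and Comp_Ide: "f \<in> hom C X Y \<Longrightarrow> f \<cdot> Ide C X = f"
    and Ide_Comp: "f \<in> hom C X Y \<Longrightarrow> Ide C Y \<cdot> f = f"
    and Comp_assoc: "\<lbrakk>f \<in> hom C X Y; g \<in> hom C Y Z; h \<in> hom C Z U\<rbrakk> \<Longrightarrow> h \<cdot> g \<cdot> f = h \<cdot> (g \<cdot> f)"

definition iso :: "('o, 'm) cat \<Rightarrow> 'm \<Rightarrow> bool" where
  "iso C f \<longleftrightarrow> f \<in> Mor C \<and>
     (\<exists>g \<in> hom C (Cod C f) (Dom C f).
        g \<cdot>\<^bsub>C\<^esub> f = Ide C (Dom C f) \<and> f \<cdot>\<^bsub>C\<^esub> g = Ide C (Cod C f))"

definition terminal :: "('o, 'm) cat \<Rightarrow> 'o \<Rightarrow> bool" where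
  "terminal C Z \<longleftrightarrow> Z \<in> Obj C \<and> (\<forall>X \<in> Obj C. \<exists>!f. f \<in> hom C X Z)"

definition product :: "('o, 'm) cat \<Rightarrow> 'o \<Rightarrow> 'o \<Rightarrow> 'o \<Rightarrow> 'm \<Rightarrow> 'm \<Rightarrow> bool" where
  "product C X Y P p q \<longleftrightarrow> p \<in> hom C P X \<and> q \<in> hom C P Y \<and>
     (\<forall>Z. \<forall>a \<in> hom C Z X. \<forall>b \<in> hom C Z Y.
        \<exists>!h. h \<in> hom C Z P \<and> p \<cdot>\<^bsub>C\<^esub> h = a \<and> q \<cdot>\<^bsub>C\<^esub> h = b)"

text \<open>\<open>q\<close> is a pullback of \<open>f\<close> along \<open>g\<close>.\<close>

definition pullback :: "('o, 'm) cat \<Rightarrow> 'm \<Rightarrow> 'm \<Rightarrow> 'm \<Rightarrow> 'm \<Rightarrow> bool" where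
  "pullback C f g p q \<longleftrightarrow> (\<exists>P. p \<in> hom C P (Dom C f) \<and> q \<in> hom C P (Dom C g) \<and>
     f \<cdot>\<^bsub>C\<^esub> p = g \<cdot>\<^bsub>C\<^esub> q \<and>
     (\<forall>Z. \<forall>a \<in> hom C Z (Dom C f). \<forall>b \<in> hom C Z (Dom C g). f \<cdot>\<^bsub>C\<^esub> a = g \<cdot>\<^bsub>C\<^esub> b \<longrightarrow>
        (\<exists>!h. h \<in> hom C Z P \<and> p \<cdot>\<^bsub>C\<^esub> h = a \<and> q \<cdot>\<^bsub>C\<^esub> h = b)))"

locale path_category = category C
  for C :: "('o, 'm) cat" (structure) +
  fixes weq :: "'m set" and fib :: "'m set"
  assumes weq_Mor: "weq \<subseteq> Mor C" and fib_Mor: "fib \<subseteq> Mor C"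
    and iso_fib: "iso C f \<Longrightarrow> f \<in> fib"
    and fib_comp: "\<lbrakk>f \<in> fib; g \<in> fib; Cod C f = Dom C g\<rbrakk> \<Longrightarrow> g \<cdot> f \<in> fib"
    and fib_pullback_exists:
      "\<lbrakk>f \<in> fib; g \<in> Mor C; Cod C f = Cod C g\<rbrakk> \<Longrightarrow> \<exists>p q. pullback C f g p q"
    and fib_pullback:
      "\<lbrakk>f \<in> fib; g \<in> Mor C; Cod C f = Cod C g; pullback C f g p q\<rbrakk> \<Longrightarrow> q \<in> fib"
    and terminal_exists: "\<exists>Z. terminal C Z"
    and fib_terminal: "\<lbrakk>terminal C Z; f \<in> Mor C; Cod C f = Z\<rbrakk> \<Longrightarrow> f \<in> fib"
    and iso_weq: "iso C f \<Longrightarrow> f \<in> weq"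
    and two_out_of_six:
      "\<lbrakk>f \<in> hom C X Y; g \<in> hom C Y Z; h \<in> hom C Z U; g \<cdot> f \<in> weq; h \<cdot> g \<in> weq\<rbrakk>
       \<Longrightarrow> f \<in> weq \<and> g \<in> weq \<and> h \<in> weq \<and> h \<cdot> g \<cdot> f \<in> weq"
    and product_exists: "B \<in> Obj C \<Longrightarrow> \<exists>P p q. product C B B P p q"
    and path_object:
      "\<lbrakk>product C B B P p q; \<delta> \<in> hom C B P; p \<cdot> \<delta> = Ide C B; q \<cdot> \<delta> = Ide C B\<rbrakk>
       \<Longrightarrow> \<exists>PB. \<exists>r \<in> hom C B PB \<inter> weq. \<exists>st \<in> hom C PB P \<inter> fib. st \<cdot> r = \<delta>"
    and section_exists:
      "f \<in> weq \<inter> fib \<Longrightarrow> \<exists>s \<in> hom C (Cod C f) (Dom C f). f \<cdot> s = Ide C (Cod C f)"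
    and acyclic_pullback_exists:
      "\<lbrakk>f \<in> weq \<inter> fib; g \<in> Mor C; Cod C f = Cod C g\<rbrakk> \<Longrightarrow> \<exists>p q. pullback C f g p q"
    and acyclic_pullback:
      "\<lbrakk>f \<in> weq \<inter> fib; g \<in> Mor C; Cod C f = Cod C g; pullback C f g p q\<rbrakk> \<Longrightarrow> q \<in> weq \<inter> fib"


section \<open>The classifying category\<close>

definition wf_ctx :: "'k type_theory \<Rightarrow> 'k ctx \<Rightarrow> bool" where
  "wf_ctx T \<Gamma> \<longleftrightarrow> (\<forall>i < length \<Gamma>. derivable T (drop (Suc i) \<Gamma>) (IsType (\<Gamma> ! i)))"

definition ctx_eq :: "'k type_theory \<Rightarrow> ('k ctx \<times> 'k ctx) set" where
  "ctx_eq T = {(\<Gamma>, \<Gamma>'). wf_ctx T \<Gamma> \<and> wf_ctx T \<Gamma>' \<and> length \<Gamma> = length \<Gamma>' \<and>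
     (\<forall>i < length \<Gamma>. derivable T (drop (Suc i) \<Gamma>) (EqType (\<Gamma> ! i) (\<Gamma>' ! i)))}"

text \<open>A morphism is represented by its domain, a sequence of terms, and its codomain.\<close>

type_synonym 'k pre_mor = "'k ctx \<times> 'k expr list \<times> 'k ctx"

definition pre_mors :: "'k type_theory \<Rightarrow> 'k pre_mor set" where
  "pre_mors T = {(\<Delta>, ts, \<Gamma>). wf_ctx T \<Delta> \<and> wf_ctx T \<Gamma> \<and> length ts = length \<Gamma> \<and>
     (\<forall>i < length \<Gamma>. derivable T \<Delta> (HasType (ts ! i) (subst (inst (drop (Suc i) ts)) (\<Gamma> ! i))))}"

definition mor_eq :: "'k type_theory \<Rightarrow> ('k pre_mor \<times> 'k pre_mor) set" where
  "mor_eq T = {((\<Delta>, ts, \<Gamma>), (\<Delta>', ts', \<Gamma>')).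
     (\<Delta>, ts, \<Gamma>) \<in> pre_mors T \<and> (\<Delta>', ts', \<Gamma>') \<in> pre_mors T \<and>
     (\<Delta>, \<Delta>') \<in> ctx_eq T \<and> (\<Gamma>, \<Gamma>') \<in> ctx_eq T \<and>
     (\<forall>i < length \<Gamma>.
        derivable T \<Delta> (EqTerm (ts ! i) (ts' ! i) (subst (inst (drop (Suc i) ts)) (\<Gamma> ! i))))}"

text \<open>
  The domain of a morphism, as an equivalence class of contexts, consists of the domains of all
  its representatives; likewise for the codomain.
\<close>

definition classifying_category :: "'k type_theory \<Rightarrow> ('k ctx set, 'k pre_mor set) cat" where
  "classifying_category T =
    \<lparr>Obj = {\<Gamma>. wf_ctx T \<Gamma>} // ctx_eq T,
     Mor = pre_mors T // mor_eq T,
     Dom = (\<lambda>f. {\<Delta>. \<exists>ts \<Gamma>. (\<Delta>, ts, \<Gamma>) \<in> f}),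
     Cod = (\<lambda>f. {\<Gamma>. \<exists>\<Delta> ts. (\<Delta>, ts, \<Gamma>) \<in> f}),
     Ide = (\<lambda>X. \<Union>\<Gamma> \<in> X. mor_eq T `` {(\<Gamma>, map Var [0..<length \<Gamma>], \<Gamma>)}),
     Comp = (\<lambda>g f. mor_eq T ``
       {(\<Theta>, map (subst (inst ts)) us, \<Gamma>) | \<Theta> ts \<Delta> us \<Gamma>. (\<Theta>, ts, \<Delta>) \<in> f \<and> (\<Delta>, us, \<Gamma>) \<in> g})\<rparr>"

definition dependent_projections :: "'k type_theory \<Rightarrow> 'k pre_mor set set" where
  "dependent_projections T =
    {mor_eq T `` {(\<Delta> @ \<Gamma>, map Var [length \<Delta>..<length \<Delta> + length \<Gamma>], \<Gamma>)} | \<Delta> \<Gamma>.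
       wf_ctx T (\<Delta> @ \<Gamma>)}"

text \<open>Morphisms isomorphic, in the arrow category, to a dependent projection.\<close>

definition fibrations :: "'k type_theory \<Rightarrow> 'k pre_mor set set" where
  "fibrations T = (let C = classifying_category T in
    {f \<in> Mor C. \<exists>\<pi> \<in> dependent_projections T.
       \<exists>\<alpha> \<in> hom C (Dom C f) (Dom C \<pi>). \<exists>\<beta> \<in> hom C (Cod C f) (Cod C \<pi>).
         iso C \<alpha> \<and> iso C \<beta> \<and> \<beta> \<cdot>\<^bsub>C\<^esub> f = \<pi> \<cdot>\<^bsub>C\<^esub> \<alpha>})"

end

theory Submission
  imports Defs
begin

text \<open>
  A context morphism is a simultaneous substitution, and substituting definitionally equal terms gives
  definitionally equal results, because the theory has the congruence rules; so the classifying
  category is a category with pullbacks of dependent projections. By strong sums every fibration is,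
  up to isomorphism, the projection \<open>[\<Gamma>, A] \<rightarrow> \<Gamma>\<close> of a single type, and every object is a closed type.
  Weak equivalences are the homotopy equivalences with respect to the identity types of closed types;
  2-out-of-6 holds since homotopy is a congruence. The rest follows from transport: for a section of
  an acyclic fibration \<open>f\<close>, transport a homotopy inverse \<open>g\<close> along \<open>f g \<sim> 1\<close>; for pullback stability,
  transport the type of \<open>z\<close> such that \<open>s (f z) = z\<close> in the fibre over \<open>f z\<close> along \<open>s f \<sim> 1\<close>, which
  gives a fibrewise homotopy.
\<close>

section \<open>Substitution\<close>

text \<open>Function types are not assumed, so data that depends on an endpoint of a path can be
  moved along the path only when it is carried as a contextual parameter of \<open>J\<close>.
  Transport is elimination with a one-variable parameter; symmetry, transitivity and congruence of
  homotopy, and the fibrewise homotopies, are all transport in an identity type with suitable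
  endpoints. Elimination over the whole path space makes reflexivity an equivalence. Both principles
  are stated as the existence of a section, and \<open>homotopic\<close> accepts any path structure
  as witness, so identity types are never chosen coherently. The syntactic obstacle is that
  \<open>congruence\<close> speaks of instances of rules, not of expressions, and that two equal
  substitutions give a bound variable two types that are only definitionally equal. Hence respect
  for equality is proved along derivations, together with respect by all types of the context. The
  issue recurs in the classifying category: equal morphisms have representatives that agree only
  definitionally, so terms must be converted before use.\<close>

lemma expr_induct [case_names Var Con]:
  assumes "\<And>i. P (Var i)"
    and "\<And>c as. (\<And>n e. (n, e) \<in> set as \<Longrightarrow> P e) \<Longrightarrow> P (Con c as)"
  shows "P e"
proof (induction e)
  case (Con c as)
  have "P e" if "(n, e) \<in> set as" for n e
    using Con.IH[OF that, of e] by simp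
  then show ?case by (rule assms(2))
qed (rule assms(1))

lemma rename_conv_subst:
  fixes e :: "'k expr"
  shows "rename f e = subst (\<lambda>i. Var (f i)) e"
proof (induction e arbitrary: f rule: expr_induct)
  case (Con c as)
  have "lift n (\<lambda>i. Var (f i)) = (\<lambda>i. Var (if i < n then i else f (i - n) + n) :: 'k expr)" for n
    by (auto simp: lift_def)
  then have "rename (\<lambda>i. if i < n then i else f (i - n) + n) e = subst (lift n (\<lambda>i. Var (f i))) e"
    if "(n, e) \<in> set as" for n e
    using Con[OF that] by simp
  then show ?case by auto
qed simp

lemma lift_alt:
  "lift n \<sigma> i = (if i < n then Var i else subst (\<lambda>j. Var (j + n)) (\<sigma> (i - n)))"
  by (simp add: lift_def rename_conv_subst)

lemma subst_cong_scoped: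
  assumes "scoped n e" "\<And>i. i < n \<Longrightarrow> \<sigma> i = \<tau> i"
  shows "subst \<sigma> e = subst \<tau> e"
  using assms
proof (induction e arbitrary: \<sigma> \<tau> n rule: expr_induct)
  case (Con c as)
  have "subst (lift k \<sigma>) e = subst (lift k \<tau>) e" if "(k, e) \<in> set as" for k e
  proof (rule Con.IH[OF that])
    show "scoped (n + k) e" using Con.prems that by auto
    show "lift k \<sigma> i = lift k \<tau> i" if "i < n + k" for i
      using that Con.prems(2)[of "i - k"] by (auto simp: lift_def)
  qed
  then show ?case by auto
qed simp

text \<open>\<open>lift\<close> is defined by renaming, so composition of substitutions cannot be
  proved directly: under a binder it needs renaming after substitution and substitution after
  renaming, and the former needs composition of renamings.\<close>

lemma rename_rename: "rename f (rename g e) = rename (\<lambda>i. f (g i)) e"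
proof (induction e arbitrary: f g rule: expr_induct)
  case (Con c as)
  let ?l = "\<lambda>n f i. if i < n then i else f (i - n) + n"
  have "(\<lambda>i. ?l n f (?l n g i)) = ?l n (\<lambda>i. f (g i))" for n
    by auto
  then have "rename (?l n f) (rename (?l n g) e) = rename (?l n (\<lambda>i. f (g i))) e"
    if "(n, e) \<in> set as" for n e
    using Con[OF that] by simp
  then show ?case by auto
qed simp

lemma subst_rename: "subst \<sigma> (rename f e) = subst (\<lambda>i. \<sigma> (f i)) e"
proof (induction e arbitrary: \<sigma> f rule: expr_induct)
  case (Con c as)
  have "(\<lambda>i. lift n \<sigma> (if i < n then i else f (i - n) + n)) = lift n (\<lambda>i. \<sigma> (f i))" for n
    by (auto simp: lift_def)
  with Con show ?case by auto
qed simp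

lemma rename_subst: "rename f (subst \<sigma> e) = subst (\<lambda>i. rename f (\<sigma> i)) e"
proof (induction e arbitrary: \<sigma> f rule: expr_induct)
  case (Con c as)
  have "(\<lambda>i. rename (\<lambda>i. if i < n then i else f (i - n) + n) (lift n \<sigma> i)) =
      lift n (\<lambda>i. rename f (\<sigma> i))" for n
    by (auto simp: lift_def rename_rename)
  with Con show ?case by auto
qed simp

lemma subst_subst: "subst \<tau> (subst \<sigma> e) = subst (\<lambda>i. subst \<tau> (\<sigma> i)) e"
proof (induction e arbitrary: \<sigma> \<tau> rule: expr_induct)
  case (Con c as)
  have "(\<lambda>i. subst (lift n \<tau>) (lift n \<sigma> i)) = lift n (\<lambda>i. subst \<tau> (\<sigma> i))" for n
    by (auto simp: lift_def subst_rename rename_subst)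
  with Con show ?case by auto
qed simp

lemma lift_Var [simp]: "lift n Var = Var"
  by (auto simp: lift_def)

lemma subst_Var [simp]: "subst Var e = e"
proof (induction e rule: expr_induct)
  case (Con c as)
  then show ?case by (auto intro!: map_idI)
qed simp

lemma subst_scoped_id: "scoped n e \<Longrightarrow> (\<And>i. i < n \<Longrightarrow> \<sigma> i = Var i) \<Longrightarrow> subst \<sigma> e = e"
  using subst_cong_scoped[of n e \<sigma> Var] by simp

lemma lift_0 [simp]: "lift 0 \<sigma> = \<sigma>"
  by (auto simp: lift_alt)

lemma lift_Suc_0 [simp]: "lift (Suc n) \<sigma> 0 = Var 0"
  by (simp add: lift_def)

lemma lift_Suc_Suc [simp]: "lift (Suc n) \<sigma> (Suc i) = subst wk (lift n \<sigma> i)"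
  by (auto simp: lift_alt subst_subst wk_def[abs_def])

lemma scoped_rename:
  "scoped n e \<Longrightarrow> (\<And>i. i < n \<Longrightarrow> f i < m) \<Longrightarrow> scoped m (rename f e)"
proof (induction e arbitrary: f n m rule: expr_induct)
  case (Con c as)
  have "scoped (m + k) (rename (\<lambda>i. if i < k then i else f (i - k) + k) e)"
    if "(k, e) \<in> set as" for k e
    by (rule Con.IH[OF that, of "n + k"]) (use Con.prems that in auto)
  then show ?case by auto
qed simp

lemma scoped_lift:
  "(\<And>i. i < n \<Longrightarrow> scoped m (\<sigma> i)) \<Longrightarrow> i < n + k \<Longrightarrow> scoped (m + k) (lift k \<sigma> i)"
  by (auto simp: lift_def intro!: scoped_rename[of m])

lemma scoped_subst:
  "scoped n e \<Longrightarrow> (\<And>i. i < n \<Longrightarrow> scoped m (\<sigma> i)) \<Longrightarrow> scoped m (subst \<sigma> e)"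
proof (induction e arbitrary: \<sigma> n m rule: expr_induct)
  case (Con c as)
  have "scoped (m + k) (subst (lift k \<sigma>) e)" if "(k, e) \<in> set as" for k e
    by (rule Con.IH[OF that, of "n + k"]) (use Con.prems that in \<open>auto intro: scoped_lift\<close>)
  then show ?case by auto
qed simp

lemma judg_scoped_subst:
  "judg_scoped n J \<Longrightarrow> (\<And>i. i < n \<Longrightarrow> scoped m (\<sigma> i)) \<Longrightarrow> judg_scoped m (judg_subst \<sigma> J)"
  by (cases J) (auto intro: scoped_subst)

lemma judg_subst_subst: "judg_subst \<tau> (judg_subst \<sigma> J) = judg_subst (\<lambda>i. subst \<tau> (\<sigma> i)) J"
  by (cases J) (simp_all add: subst_subst)

lemma judg_subst_Var [simp]: "judg_subst Var J = J"
  by (cases J) simp_all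

lemma judg_presup_subst: "judg_presup (judg_subst \<sigma> J) = map (judg_subst \<sigma>) (judg_presup J)"
  by (cases J) simp_all

lemma length_ctx_subst [simp]: "length (ctx_subst \<sigma> \<Delta>) = length \<Delta>"
  by (induction \<Delta>) simp_all

lemma inst_Cons_0 [simp]: "inst (t # ts) 0 = t"
  by (simp add: inst_def)

lemma inst_Cons_Suc [simp]: "inst (t # ts) (Suc i) = inst ts i"
  by (simp add: inst_def)

lemma inst_Nil [simp]: "inst [] = Var"
  by (auto simp: inst_def)

section \<open>Admissibility of simultaneous substitution\<close>

lemma wf_ctx_Nil [simp]: "wf_ctx T []"
  by (simp add: wf_ctx_def)

lemma wf_ctx_Cons: "wf_ctx T (A # \<Gamma>) \<longleftrightarrow> derivable T \<Gamma> (IsType A) \<and> wf_ctx T \<Gamma>"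
  by (auto simp: wf_ctx_def less_Suc_eq_0_disj)

lemma presup_derivable:
  "(\<forall>\<Gamma>' I. (\<Gamma>', I) \<in> set (presup \<Gamma> J) \<longrightarrow> derivable T \<Gamma>' I) \<longleftrightarrow>
    wf_ctx T \<Gamma> \<and> (\<forall>I \<in> set (judg_presup J). derivable T \<Gamma> I)"
  by (fastforce simp: presup_def wf_ctx_def)

lemma derivable_scoped: "derivable T \<Gamma> J \<Longrightarrow> judg_scoped (length \<Gamma>) J"
proof (induction rule: derivable.induct)
  case (variable \<Gamma> A)
  then show ?case by (auto intro!: scoped_subst[of "length \<Gamma>"] simp: wk_def)
next
  case (weakening \<Delta> \<Gamma> J A)
  show ?case
    by (rule judg_scoped_subst[OF weakening.IH(1)])
      (auto simp: lift_def wk_def)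
next
  case (substitution \<Delta> A \<Gamma> J a)
  show ?case
  proof (rule judg_scoped_subst[OF substitution.IH(1)])
    fix i assume "i < length (\<Delta> @ A # \<Gamma>)"
    then have "scoped (length \<Gamma> + length \<Delta>) (lift (length \<Delta>) (inst [a]) i)"
      using substitution.IH(2)
      by (intro scoped_lift[of "Suc (length \<Gamma>)"]) (auto simp: inst_def)
    then show "scoped (length (ctx_subst (inst [a]) \<Delta> @ \<Gamma>)) (lift (length \<Delta>) (inst [a]) i)"
      by (simp add: add.commute)
  qed
qed auto

lemma weaken1:
  "derivable T \<Gamma> J \<Longrightarrow> derivable T \<Gamma> (IsType A) \<Longrightarrow> derivable T (A # \<Gamma>) (judg_subst wk J)"
  using weakening[of T "[]" \<Gamma> J A] by simp

text \<open>The clauses \<open>rule\<close> and \<open>congruence\<close> carry the presuppositions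
  of their conclusion as premises, so this holds for every set of rules; the structural clauses only
  use that presuppositions commute with substitution.\<close>

lemma derivable_presup: "derivable T \<Gamma> J \<Longrightarrow> \<forall>I \<in> set (judg_presup J). derivable T \<Gamma> I"
proof (induction rule: derivable.induct)
  case (variable \<Gamma> A)
  then show ?case using weaken1[of T \<Gamma> "IsType A" A] by simp
next
  case (weakening \<Delta> \<Gamma> J A)
  then show ?case by (auto simp: judg_presup_subst intro!: derivable.weakening)
next
  case (substitution \<Delta> A \<Gamma> J a)
  then show ?case by (auto simp: judg_presup_subst intro!: derivable.substitution)
next
  case (rule \<rho> ps J \<Gamma>)
  then show ?case by (auto simp: presup_def)
next
  case (congruence \<rho> ps J qs K \<Gamma> E)
  then show ?case by (auto simp: presup_def)
qed (auto intro: derivable.intros)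

section \<open>Substitutions as context morphisms\<close>

fun sub_ok :: "'k type_theory \<Rightarrow> 'k ctx \<Rightarrow> (nat \<Rightarrow> 'k expr) \<Rightarrow> 'k ctx \<Rightarrow> bool" where
  "sub_ok T \<Theta> \<sigma> [] \<longleftrightarrow> True"
| "sub_ok T \<Theta> \<sigma> (A # \<Gamma>) \<longleftrightarrow>
     derivable T \<Theta> (HasType (\<sigma> 0) (subst (\<lambda>i. \<sigma> (Suc i)) A)) \<and> sub_ok T \<Theta> (\<lambda>i. \<sigma> (Suc i)) \<Gamma>"

text \<open>As for \<open>sub_ok\<close>, index 0 belongs to the newest variable, so
  \<open>\<lambda>i. \<sigma> (Suc i)\<close> is the part of \<sigma> for the rest of the context.
  Using functions instead of lists makes composition pointwise; values beyond the length of the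
  context are irrelevant.\<close>

fun sub_eq ::
  "'k type_theory \<Rightarrow> 'k ctx \<Rightarrow> (nat \<Rightarrow> 'k expr) \<Rightarrow> (nat \<Rightarrow> 'k expr) \<Rightarrow> 'k ctx \<Rightarrow> bool" where
  "sub_eq T \<Theta> \<sigma> \<tau> [] \<longleftrightarrow> True"
| "sub_eq T \<Theta> \<sigma> \<tau> (A # \<Gamma>) \<longleftrightarrow>
     derivable T \<Theta> (EqTerm (\<sigma> 0) (\<tau> 0) (subst (\<lambda>i. \<sigma> (Suc i)) A)) \<and>
     sub_eq T \<Theta> (\<lambda>i. \<sigma> (Suc i)) (\<lambda>i. \<tau> (Suc i)) \<Gamma>"

text \<open>The typing of both sides is kept beside the equality: to deduce the typing of \<tau>
  from that of \<sigma> one has to convert along an equality of substituted types, which only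
  becomes available with \<open>derivable_good\<close>.\<close>

definition sub_pair ::
  "'k type_theory \<Rightarrow> 'k ctx \<Rightarrow> (nat \<Rightarrow> 'k expr) \<Rightarrow> (nat \<Rightarrow> 'k expr) \<Rightarrow> 'k ctx \<Rightarrow> bool" where
  "sub_pair T \<Theta> \<sigma> \<tau> \<Gamma> \<longleftrightarrow> sub_ok T \<Theta> \<sigma> \<Gamma> \<and> sub_ok T \<Theta> \<tau> \<Gamma> \<and> sub_eq T \<Theta> \<sigma> \<tau> \<Gamma>"

lemma sub_pair_Nil [simp]: "sub_pair T \<Theta> \<sigma> \<tau> []"
  by (simp add: sub_pair_def)

lemma sub_pair_Cons:
  "sub_pair T \<Theta> \<sigma> \<tau> (A # \<Gamma>) \<longleftrightarrow> sub_pair T \<Theta> (\<lambda>i. \<sigma> (Suc i)) (\<lambda>i. \<tau> (Suc i)) \<Gamma> \<and>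
     derivable T \<Theta> (HasType (\<sigma> 0) (subst (\<lambda>i. \<sigma> (Suc i)) A)) \<and>
     derivable T \<Theta> (HasType (\<tau> 0) (subst (\<lambda>i. \<tau> (Suc i)) A)) \<and>
     derivable T \<Theta> (EqTerm (\<sigma> 0) (\<tau> 0) (subst (\<lambda>i. \<sigma> (Suc i)) A))"
  by (auto simp: sub_pair_def)

lemma sub_eq_refl: "sub_ok T \<Theta> \<sigma> \<Gamma> \<Longrightarrow> sub_eq T \<Theta> \<sigma> \<sigma> \<Gamma>"
  by (induction \<Gamma> arbitrary: \<sigma>) (auto intro: term_refl)

lemma sub_pair_refl: "sub_pair T \<Theta> \<sigma> \<sigma> \<Gamma> \<longleftrightarrow> sub_ok T \<Theta> \<sigma> \<Gamma>"
  by (auto simp: sub_pair_def sub_eq_refl)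

lemma sub_pair_weaken:
  assumes "sub_pair T \<Theta> \<sigma> \<tau> \<Gamma>" "derivable T \<Theta> (IsType B)"
  shows "sub_pair T (B # \<Theta>) (\<lambda>i. subst wk (\<sigma> i)) (\<lambda>i. subst wk (\<tau> i)) \<Gamma>"
  using assms(1)
proof (induction \<Gamma> arbitrary: \<sigma> \<tau>)
  case (Cons A \<Gamma>)
  then show ?case
    using weaken1[OF _ assms(2)] by (fastforce simp: sub_pair_Cons simp flip: subst_subst)
qed simp

lemma sub_pair_append:
  "sub_pair T \<Theta> \<sigma> \<tau> (\<Delta> @ \<Gamma>) \<Longrightarrow>
    sub_pair T \<Theta> (\<lambda>i. \<sigma> (length \<Delta> + i)) (\<lambda>i. \<tau> (length \<Delta> + i)) \<Gamma>"
proof (induction \<Delta> arbitrary: \<sigma> \<tau>)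
  case (Cons A \<Delta>)
  then show ?case by (simp add: sub_pair_Cons) blast
qed simp

lemma derivable_wf: "derivable T \<Gamma> J \<Longrightarrow> wf_ctx T \<Gamma>"
proof (induction rule: derivable.induct)
  case (weakening \<Delta> \<Gamma> J A)
  have "wf_ctx T (ctx_subst wk \<Delta> @ A # \<Gamma>)" using weakening.IH(1)
  proof (induction \<Delta>)
    case (Cons B \<Delta>)
    then show ?case
      using derivable.weakening[of T \<Delta> \<Gamma> "IsType B" A] weakening.hyps(2) by (simp add: wf_ctx_Cons)
  qed (simp add: wf_ctx_Cons weakening)
  then show ?case .
next
  case (substitution \<Delta> A \<Gamma> J a)
  have "wf_ctx T (ctx_subst (inst [a]) \<Delta> @ \<Gamma>)" using substitution.IH(1)
  proof (induction \<Delta>)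
    case (Cons B \<Delta>)
    then show ?case
      using derivable.substitution[of T \<Delta> A \<Gamma> "IsType B" a] substitution.hyps(2) by (simp add: wf_ctx_Cons)
  qed (simp add: substitution)
  then show ?case .
next
  case (rule \<rho> ps J \<Gamma>)
  then show ?case by (auto simp: presup_def wf_ctx_def)
next
  case (congruence \<rho> ps J qs K \<Gamma> E)
  then show ?case by (auto simp: presup_def wf_ctx_def)
qed (simp_all add: wf_ctx_Cons)

lemma ctx_subst_wf: "wf_ctx T \<Gamma> \<Longrightarrow> ctx_subst \<sigma> \<Gamma> = \<Gamma>"
  by (induction \<Gamma>)
    (auto simp: wf_ctx_Cons lift_def intro!: subst_scoped_id dest!: derivable_scoped)

lemma judg_subst_scoped_id:
  "judg_scoped n J \<Longrightarrow> (\<And>i. i < n \<Longrightarrow> \<sigma> i = Var i) \<Longrightarrow> judg_subst \<sigma> J = J"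
  by (cases J) (auto intro: subst_scoped_id)

lemma judg_subst_cong_scoped:
  "judg_scoped n J \<Longrightarrow> (\<And>i. i < n \<Longrightarrow> \<sigma> i = \<tau> i) \<Longrightarrow> judg_subst \<sigma> J = judg_subst \<tau> J"
  by (cases J) (auto intro: subst_cong_scoped)

text \<open>Nothing in \<open>\<Gamma>\<close> or \<open>J\<close> refers to variables beyond
  \<open>\<Gamma>\<close>, so weakening underneath \<open>\<Gamma>\<close> changes no expression.
  The types of \<open>\<Theta>\<close> are inserted one by one, the oldest first.\<close>

lemma weaken_bottom:
  assumes "derivable T \<Gamma> J" "wf_ctx T \<Theta>"
  shows "derivable T (\<Gamma> @ \<Theta>) J"
  using assms(2)
proof (induction \<Theta>)
  case (Cons A \<Theta>)
  have "judg_subst (lift (length \<Gamma>) wk) J = J"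
    using derivable_scoped[OF assms(1)] by (rule judg_subst_scoped_id) (simp add: lift_def)
  with Cons show ?case
    using derivable.weakening[of T \<Gamma> \<Theta> J A] ctx_subst_wf[OF derivable_wf[OF assms(1)], of wk]
    by (simp add: wf_ctx_Cons)
qed (use assms in simp)

lemma sub_ok_append: "sub_ok T \<Theta> \<sigma> (\<Delta> @ \<Gamma>) \<Longrightarrow> sub_ok T \<Theta> (\<lambda>i. \<sigma> (length \<Delta> + i)) \<Gamma>"
  using sub_pair_append[of T \<Theta> \<sigma> \<sigma>] by (simp add: sub_pair_refl)

text \<open>By composition of substitutions, the types that \<sigma> has to meet on the telescope
  \<open>ctx_subst \<rho> \<Delta>\<close> are those that the composite has to meet on
  \<open>\<Delta>\<close>. Only the variables below the telescope need a separate
  hypothesis.\<close>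

lemma sub_ok_factor_lift:
  assumes "sub_ok T \<Theta> (\<lambda>i. subst \<sigma> (lift (length \<Delta>) \<rho> i)) (\<Delta> @ \<Gamma>)"
    and "sub_ok T \<Theta> (\<lambda>i. \<sigma> (length \<Delta> + i)) \<Gamma>'"
  shows "sub_ok T \<Theta> \<sigma> (ctx_subst \<rho> \<Delta> @ \<Gamma>')"
  using assms
proof (induction \<Delta> arbitrary: \<sigma>)
  case (Cons A \<Delta>)
  then show ?case by (simp add: subst_subst wk_def)
qed simp

lemma sub_ok_Var: "wf_ctx T \<Theta> \<Longrightarrow> sub_ok T \<Theta> Var \<Theta>"
proof (induction \<Theta>)
  case (Cons A \<Theta>)
  then have A: "derivable T \<Theta> (IsType A)" and "sub_pair T \<Theta> Var Var \<Theta>"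
    by (auto simp: wf_ctx_Cons sub_pair_refl)
  from sub_pair_weaken[OF this(2,1)] show ?case
    using variable[OF A] by (simp add: sub_pair_refl wk_def[abs_def])
qed simp

text \<open>The substitution rule replaces one variable by a term over the context below it. The
  oldest type \<open>A\<close> of the telescope goes first, since the term for it lives over
  \<open>\<Theta>\<close> alone; a telescope over \<open>\<Theta>\<close> that is shorter by one
  remains.\<close>

lemma substitute_telescope:
  assumes "derivable T (\<Gamma> @ \<Theta>) J" "sub_ok T \<Theta> \<sigma> (\<Gamma> @ \<Theta>)" "\<And>i. \<sigma> (length \<Gamma> + i) = Var i"
  shows "derivable T \<Theta> (judg_subst \<sigma> J)"
  using assms
proof (induction "length \<Gamma>" arbitrary: \<Gamma> J \<sigma>)
  case 0
  then have "\<sigma> = Var" by auto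
  with 0 show ?case by simp
next
  case (Suc n)
  then obtain \<Delta> A where \<Gamma>: "\<Gamma> = \<Delta> @ [A]" and n: "n = length \<Delta>"
    by (cases \<Gamma> rule: rev_cases) auto
  define a where "a = \<sigma> n"
  \<comment> \<open>\<tau> is \<sigma> with the position \<open>n\<close> of \<open>A\<close>
    removed: newer positions keep their terms, older ones are the variables of
    \<open>\<Theta>\<close>, shifted down by one.\<close>
  define \<tau> where "\<tau> i = (if i < n then \<sigma> i else Var (i - n))" for i
  have "(\<lambda>i. \<sigma> (Suc (n + i))) = Var"
    using Suc.prems(3) by (auto simp: \<Gamma> n)
  then have a: "derivable T \<Theta> (HasType a A)"
    using sub_ok_append[of T \<Theta> \<sigma> \<Delta> "A # \<Theta>"] Suc.prems(2) by (simp add: \<Gamma> n a_def)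
  have \<sigma>: "(\<lambda>i. subst \<tau> (lift (length \<Delta>) (inst [a]) i)) = \<sigma>"
  proof
    fix i
    consider "i < n" | "i = n" | j where "i = Suc (n + j)"
      by (metis add.commute add_Suc_right less_imp_Suc_add linorder_neqE_nat)
    then show "subst \<tau> (lift (length \<Delta>) (inst [a]) i) = \<sigma> i"
    proof cases
      case 2
      have "(\<lambda>j. \<tau> (j + n)) = Var" by (auto simp: \<tau>_def)
      then show ?thesis using 2 by (simp add: lift_alt subst_subst a_def n)
    next
      case 3
      have "\<sigma> i = Var j" using Suc.prems(3)[of j] 3 by (simp add: \<Gamma> n)
      then show ?thesis using 3 by (simp add: lift_alt n \<tau>_def inst_def)
    qed (simp add: lift_alt n \<tau>_def)
  qed
  have "sub_ok T \<Theta> \<tau> (ctx_subst (inst [a]) \<Delta> @ \<Theta>)"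
  proof (rule sub_ok_factor_lift)
    show "sub_ok T \<Theta> (\<lambda>i. subst \<tau> (lift (length \<Delta>) (inst [a]) i)) (\<Delta> @ A # \<Theta>)"
      using Suc.prems(2) unfolding \<sigma> by (simp add: \<Gamma>)
    show "sub_ok T \<Theta> (\<lambda>i. \<tau> (length \<Delta> + i)) \<Theta>"
      using sub_ok_Var[OF derivable_wf[OF a]] by (simp add: \<tau>_def n)
  qed
  moreover have "derivable T (ctx_subst (inst [a]) \<Delta> @ \<Theta>) (judg_subst (lift (length \<Delta>) (inst [a])) J)"
    using Suc.prems(1) a by (intro derivable.substitution) (simp_all add: \<Gamma>)
  ultimately have "derivable T \<Theta> (judg_subst \<tau> (judg_subst (lift (length \<Delta>) (inst [a])) J))"
    by (intro Suc.hyps(1)) (auto simp: n \<tau>_def)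
  then show ?case by (simp add: judg_subst_subst \<sigma>)
qed

lemma sub_ok_cong:
  assumes "wf_ctx T \<Gamma>" "\<And>i. i < length \<Gamma> \<Longrightarrow> \<sigma> i = \<tau> i" "sub_ok T \<Theta> \<sigma> \<Gamma>"
  shows "sub_ok T \<Theta> \<tau> \<Gamma>"
  using assms
proof (induction \<Gamma> arbitrary: \<sigma> \<tau>)
  case (Cons A \<Gamma>)
  have "subst (\<lambda>i. \<sigma> (Suc i)) A = subst (\<lambda>i. \<tau> (Suc i)) A"
    using Cons.prems(1,2)
    by (intro subst_cong_scoped[of "length \<Gamma>"]) (auto simp: wf_ctx_Cons dest: derivable_scoped)
  moreover have "\<sigma> 0 = \<tau> 0" using Cons.prems(2)[of 0] by simp
  ultimately show ?case
    using Cons.prems Cons.IH[of "\<lambda>i. \<sigma> (Suc i)" "\<lambda>i. \<tau> (Suc i)"] by (simp add: wf_ctx_Cons)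
qed simp

lemma sub_ok_extend:
  assumes "wf_ctx T \<Gamma>" "sub_ok T \<Theta> (\<lambda>i. \<sigma> (length \<Gamma> + i)) \<Delta>" "sub_ok T \<Theta> \<sigma> \<Gamma>"
  shows "sub_ok T \<Theta> \<sigma> (\<Gamma> @ \<Delta>)"
  using assms by (induction \<Gamma> arbitrary: \<sigma>) (simp_all add: wf_ctx_Cons)

text \<open>Placing \<open>\<Gamma>\<close> on top of \<open>\<Theta>\<close> turns an arbitrary
  substitution into one for a telescope over \<open>\<Theta>\<close>.\<close>

theorem simultaneous_substitution:
  assumes "derivable T \<Gamma> J" "wf_ctx T \<Theta>" "sub_ok T \<Theta> \<sigma> \<Gamma>"
  shows "derivable T \<Theta> (judg_subst \<sigma> J)"
proof -
  \<comment> \<open>Beyond \<open>\<Gamma>\<close> the telescope lemma wants the identity on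
    \<open>\<Theta>\<close>. \<open>J\<close> is scoped in \<open>\<Gamma>\<close> and does not see
    the change.\<close>
  define \<tau> where "\<tau> i = (if i < length \<Gamma> then \<sigma> i else Var (i - length \<Gamma>))" for i
  note wf = derivable_wf[OF assms(1)]
  have "sub_ok T \<Theta> \<tau> \<Gamma>"
    using wf _ assms(3) by (rule sub_ok_cong) (simp add: \<tau>_def)
  then have "sub_ok T \<Theta> \<tau> (\<Gamma> @ \<Theta>)"
    using wf sub_ok_Var[OF assms(2)] by (intro sub_ok_extend) (simp_all add: \<tau>_def)
  then have "derivable T \<Theta> (judg_subst \<tau> J)"
    using weaken_bottom[OF assms(1,2)] by (intro substitute_telescope) (auto simp: \<tau>_def)
  also have "judg_subst \<tau> J = judg_subst \<sigma> J"
    using derivable_scoped[OF assms(1)] by (rule judg_subst_cong_scoped) (simp add: \<tau>_def)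
  finally show ?thesis .
qed

section \<open>Substitution respects definitional equality\<close>

definition subst_good :: "'k type_theory \<Rightarrow> 'k ctx \<Rightarrow> 'k judgement \<Rightarrow> bool" where
  "subst_good T \<Gamma> J \<longleftrightarrow> (\<forall>\<Theta> \<sigma> \<tau>. wf_ctx T \<Theta> \<longrightarrow> sub_pair T \<Theta> \<sigma> \<tau> \<Gamma> \<longrightarrow>
     derivable T \<Theta> (the (equate (judg_subst \<sigma> J) (judg_subst \<tau> J))))"

text \<open>For an equation, \<open>equate\<close> just returns the instance under \<sigma>, so
  \<open>subst_good\<close> is ordinary substitution. In \<open>subst_good\<close> both instances
  have the same shape, hence \<open>the\<close> never meets \<open>None\<close>.\<close>

lemma equation_subst_good:
  "derivable T \<Gamma> J \<Longrightarrow> equate J J = Some J \<Longrightarrow> subst_good T \<Gamma> J"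
  using simultaneous_substitution[of T \<Gamma> J]
  by (cases J) (simp_all add: subst_good_def sub_pair_def)

text \<open>This is what allows going under binders: a pair of equal substitutions extends by a
  variable only if the type of that variable respects the pair.\<close>

fun ctx_good :: "'k type_theory \<Rightarrow> 'k ctx \<Rightarrow> bool" where
  "ctx_good T [] \<longleftrightarrow> True"
| "ctx_good T (A # \<Gamma>) \<longleftrightarrow> subst_good T \<Gamma> (IsType A) \<and> ctx_good T \<Gamma>"

lemma ctx_good_append: "ctx_good T (\<Delta> @ \<Gamma>) \<Longrightarrow> ctx_good T \<Gamma>"
  by (induction \<Delta>) auto

lemma ctx_good_conv:
  "ctx_good T \<Gamma> \<longleftrightarrow> (\<forall>i < length \<Gamma>. subst_good T (drop (Suc i) \<Gamma>) (IsType (\<Gamma> ! i)))"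
  by (induction \<Gamma>) (auto simp: less_Suc_eq_0_disj)

text \<open>The extended context uses the types substituted by \<sigma>, whereas the lift of \<tau>
  must send a new variable to a term of the type substituted by \<tau>. Goodness of that type
  supplies the conversion.\<close>

lemma sub_pair_lift:
  assumes "ctx_good T (\<Delta> @ \<Gamma>)" "wf_ctx T \<Theta>" "sub_pair T \<Theta> \<sigma> \<tau> \<Gamma>"
  shows "wf_ctx T (ctx_subst \<sigma> \<Delta> @ \<Theta>) \<and>
    sub_pair T (ctx_subst \<sigma> \<Delta> @ \<Theta>) (lift (length \<Delta>) \<sigma>) (lift (length \<Delta>) \<tau>) (\<Delta> @ \<Gamma>)"
  using assms(1)
proof (induction \<Delta>)
  case Nil
  then show ?case using assms by simp
next
  case (Cons A \<Delta>)
  let ?\<Theta> = "ctx_subst \<sigma> \<Delta> @ \<Theta>" and ?\<sigma> = "lift (length \<Delta>) \<sigma>" and ?\<tau> = "lift (length \<Delta>) \<tau>"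
  have wf: "wf_ctx T ?\<Theta>" and pair: "sub_pair T ?\<Theta> ?\<sigma> ?\<tau> (\<Delta> @ \<Gamma>)"
    using Cons by auto
  then have eq: "derivable T ?\<Theta> (EqType (subst ?\<sigma> A) (subst ?\<tau> A))"
    using Cons.prems by (fastforce simp: subst_good_def)
  then have A: "derivable T ?\<Theta> (IsType (subst ?\<sigma> A))"
    by (auto dest: derivable_presup)
  have v: "derivable T (subst ?\<sigma> A # ?\<Theta>) (HasType (Var 0) (subst wk (subst ?\<sigma> A)))"
    using A by (rule variable)
  moreover have "derivable T (subst ?\<sigma> A # ?\<Theta>) (HasType (Var 0) (subst wk (subst ?\<tau> A)))"
    using weaken1[OF eq A] by (intro conversion[OF v]) simp
  ultimately show ?case
    using wf A sub_pair_weaken[OF pair A] term_refl[OF v]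
    by (simp add: wf_ctx_Cons sub_pair_Cons flip: subst_subst)
qed

lemma sub_pair_compose_lift:
  assumes "sub_pair T \<Theta> (\<lambda>i. subst (\<lambda>j. \<sigma> (length \<Delta> + j)) (\<rho> i))
      (\<lambda>i. subst (\<lambda>j. \<tau> (length \<Delta> + j)) (\<rho> i)) \<Gamma>"
    and "sub_pair T \<Theta> \<sigma> \<tau> (ctx_subst \<rho> \<Delta> @ \<Gamma>')"
  shows "sub_pair T \<Theta> (\<lambda>i. subst \<sigma> (lift (length \<Delta>) \<rho> i)) (\<lambda>i. subst \<tau> (lift (length \<Delta>) \<rho> i)) (\<Delta> @ \<Gamma>)"
  using assms
proof (induction \<Delta> arbitrary: \<sigma> \<tau>)
  case (Cons A \<Delta>)
  then show ?case
    using Cons.IH[of "\<lambda>i. \<sigma> (Suc i)" "\<lambda>i. \<tau> (Suc i)"]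
    by (simp add: sub_pair_Cons subst_subst wk_def)
qed simp

text \<open>A context morphism from \<open>\<Gamma>'\<close> to \<open>\<Gamma>\<close>, described
  only by its effect on pairs of equal substitutions. It covers \<open>wk\<close> and a single
  instantiation, so that, with \<open>resp_lift\<close>, the weakening and substitution clauses are
  treated alike.\<close>

definition resp :: "'k type_theory \<Rightarrow> 'k ctx \<Rightarrow> (nat \<Rightarrow> 'k expr) \<Rightarrow> 'k ctx \<Rightarrow> bool" where
  "resp T \<Gamma>' \<rho> \<Gamma> \<longleftrightarrow> (\<forall>\<Theta> \<sigma> \<tau>. wf_ctx T \<Theta> \<longrightarrow> sub_pair T \<Theta> \<sigma> \<tau> \<Gamma>' \<longrightarrow>
     sub_pair T \<Theta> (\<lambda>i. subst \<sigma> (\<rho> i)) (\<lambda>i. subst \<tau> (\<rho> i)) \<Gamma>)"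

lemma resp_lift: "resp T \<Gamma>' \<rho> \<Gamma> \<Longrightarrow> resp T (ctx_subst \<rho> \<Delta> @ \<Gamma>') (lift (length \<Delta>) \<rho>) (\<Delta> @ \<Gamma>)"
  using sub_pair_compose_lift sub_pair_append[of T _ _ _ "ctx_subst \<rho> \<Delta>"]
  unfolding resp_def by fastforce

lemma subst_good_resp: "resp T \<Gamma>' \<rho> \<Gamma> \<Longrightarrow> subst_good T \<Gamma> J \<Longrightarrow> subst_good T \<Gamma>' (judg_subst \<rho> J)"
  unfolding subst_good_def resp_def judg_subst_subst by blast

lemma ctx_good_resp:
  assumes "resp T \<Gamma>' \<rho> \<Gamma>" "ctx_good T (\<Delta> @ \<Gamma>)" "ctx_good T \<Gamma>'"
  shows "ctx_good T (ctx_subst \<rho> \<Delta> @ \<Gamma>')"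
  using assms(2)
proof (induction \<Delta>)
  case (Cons A \<Delta>)
  then show ?case using subst_good_resp[OF resp_lift[OF assms(1), of \<Delta>], of "IsType A"] by simp
qed (simp add: assms)

text \<open>By stability both substituted instances belong to the same rule, so
  \<open>congruence\<close> applies to them; the equations between their premises are the goodness
  of the premises, after lifting both substitutions under the binders.\<close>

lemma subst_good_applied:
  assumes "dependent_type_theory T" "\<rho> \<in> T" "(ps, J) \<in> \<rho>" and J: "derivable T \<Gamma> J"
    and prem: "\<And>\<Delta> I. (\<Delta>, I) \<in> set ps \<Longrightarrow> derivable T (\<Delta> @ \<Gamma>) I \<and> subst_good T (\<Delta> @ \<Gamma>) I \<and> ctx_good T (\<Delta> @ \<Gamma>)"
    and pre: "\<And>I. I \<in> set (judg_presup J) \<Longrightarrow> subst_good T \<Gamma> I"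
  shows "subst_good T \<Gamma> J"
  unfolding subst_good_def
proof (intro allI impI)
  fix \<Theta> \<sigma> \<tau> assume wf: "wf_ctx T \<Theta>" and pair: "sub_pair T \<Theta> \<sigma> \<tau> \<Gamma>"
  then have ok: "sub_ok T \<Theta> \<sigma> \<Gamma>" "sub_ok T \<Theta> \<tau> \<Gamma>" by (simp_all add: sub_pair_def)
  have inst: "(map (prem_subst \<xi>) ps, judg_subst \<xi> J) \<in> \<rho>" for \<xi>
    using assms(1-3) unfolding dependent_type_theory_def by blast
  have prems: "\<forall>\<Delta> I. (\<Delta>, I) \<in> set (map (prem_subst \<xi>) ps) \<longrightarrow> derivable T (\<Delta> @ \<Theta>) I"
    if "sub_ok T \<Theta> \<xi> \<Gamma>" for \<xi>
  proof (intro allI impI)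
    fix \<Delta>' I' assume "(\<Delta>', I') \<in> set (map (prem_subst \<xi>) ps)"
    then obtain \<Delta> I where *: "(\<Delta>, I) \<in> set ps"
      "\<Delta>' = ctx_subst \<xi> \<Delta>" "I' = judg_subst (lift (length \<Delta>) \<xi>) I"
      by (auto simp: prem_subst_def)
    show "derivable T (\<Delta>' @ \<Theta>) I'"
      unfolding * using prem[OF *(1)] sub_pair_lift[of T \<Delta> \<Gamma> \<Theta> \<xi> \<xi>] wf that
      by (auto simp: sub_pair_refl intro: simultaneous_substitution)
  qed
  have eqs: "\<forall>i < length (map (prem_subst \<sigma>) ps).
      \<exists>E. equate (snd (map (prem_subst \<sigma>) ps ! i)) (snd (map (prem_subst \<tau>) ps ! i)) = Some E \<and>
        derivable T (fst (map (prem_subst \<sigma>) ps ! i) @ \<Theta>) E"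
  proof (intro allI impI)
    fix i assume i: "i < length (map (prem_subst \<sigma>) ps)"
    obtain \<Delta> I where psi: "ps ! i = (\<Delta>, I)" by fastforce
    then have mem: "(\<Delta>, I) \<in> set ps" using i by (metis length_map nth_mem)
    obtain E where E: "equate (judg_subst (lift (length \<Delta>) \<sigma>) I) (judg_subst (lift (length \<Delta>) \<tau>) I) = Some E"
      by (cases I) auto
    have "derivable T (ctx_subst \<sigma> \<Delta> @ \<Theta>) E"
      using prem[OF mem] sub_pair_lift[of T \<Delta> \<Gamma> \<Theta> \<sigma> \<tau>] wf pair E by (fastforce simp: subst_good_def)
    then show "\<exists>E. equate (snd (map (prem_subst \<sigma>) ps ! i)) (snd (map (prem_subst \<tau>) ps ! i)) = Some E \<and>
        derivable T (fst (map (prem_subst \<sigma>) ps ! i) @ \<Theta>) E"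
      using i psi E by (simp add: prem_subst_def)
  qed
  note cong = derivable.congruence[OF assms(2) inst inst prems[OF ok(1)] prems[OF ok(2)] _ eqs]
  note J\<sigma> = simultaneous_substitution[OF J wf ok(1)] and J\<tau> = simultaneous_substitution[OF J wf ok(2)]
  note sc = derivable_scoped[OF J\<sigma>] derivable_scoped[OF J\<tau>]
  show "derivable T \<Theta> (the (equate (judg_subst \<sigma> J) (judg_subst \<tau> J)))"
  proof (cases J)
    case (IsType A)
    have "derivable T \<Theta> (EqType (subst \<sigma> A) (subst \<tau> A))"
      using cong[of "EqType (subst \<sigma> A) (subst \<tau> A)"] J\<sigma> J\<tau> sc wf
      unfolding presup_derivable IsType by simp
    then show ?thesis by (simp add: IsType)
  next
    case (HasType a A)
    have A: "derivable T \<Theta> (EqType (subst \<sigma> A) (subst \<tau> A))"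
      using pre[of "IsType A"] wf pair by (fastforce simp: HasType subst_good_def)
    \<comment> \<open>The presupposition of the desired equation types both sides by
      \<open>subst \<sigma> A\<close>, so the \<tau> instance has to be converted first.\<close>
    have "derivable T \<Theta> (HasType (subst \<tau> a) (subst \<sigma> A))"
      using J\<tau> type_sym[OF A] by (auto simp: HasType intro: conversion)
    then have "derivable T \<Theta> (EqTerm (subst \<sigma> a) (subst \<tau> a) (subst \<sigma> A))"
      using cong[of "EqTerm (subst \<sigma> a) (subst \<tau> a) (subst \<sigma> A)"] J\<sigma> sc wf
      unfolding presup_derivable HasType by simp
    then show ?thesis by (simp add: HasType)
  qed (use J\<sigma> in simp_all)
qed

lemma resp_wk: "resp T (A # \<Gamma>) wk \<Gamma>"
  by (simp add: resp_def wk_def sub_pair_Cons)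

lemma resp_inst:
  assumes "derivable T \<Gamma> (HasType a A)" "subst_good T \<Gamma> (HasType a A)"
  shows "resp T \<Gamma> (inst [a]) (A # \<Gamma>)"
  unfolding resp_def
proof (intro allI impI)
  fix \<Theta> \<sigma> \<tau> assume *: "wf_ctx T \<Theta>" "sub_pair T \<Theta> \<sigma> \<tau> \<Gamma>"
  then have "derivable T \<Theta> (judg_subst \<sigma> (HasType a A))" "derivable T \<Theta> (judg_subst \<tau> (HasType a A))"
    "derivable T \<Theta> (the (equate (judg_subst \<sigma> (HasType a A)) (judg_subst \<tau> (HasType a A))))"
    using simultaneous_substitution[OF assms(1)] assms(2) unfolding subst_good_def sub_pair_def by blast+
  then show "sub_pair T \<Theta> (\<lambda>i. subst \<sigma> (inst [a] i)) (\<lambda>i. subst \<tau> (inst [a] i)) (A # \<Gamma>)"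
    using * by (simp add: sub_pair_Cons)
qed

text \<open>
  The congruence rules only concern the last step of a derivation. That the equations derived by
  them are closed under substitution follows from the weakening and substitution rules; substituting
  into the premises would fail, as corresponding premises need not extend the ambient context alike.
\<close>

theorem derivable_good:
  assumes T: "dependent_type_theory T"
  shows "derivable T \<Gamma> J \<Longrightarrow> subst_good T \<Gamma> J \<and> ctx_good T \<Gamma>"
proof (induction rule: derivable.induct)
  case (variable \<Gamma> A)
  then show ?case by (auto simp: subst_good_def sub_pair_Cons subst_subst wk_def)
next
  case (weakening \<Delta> \<Gamma> J A)
  then show ?case
    using subst_good_resp[OF resp_lift[OF resp_wk, of T \<Delta> A \<Gamma>]]
      ctx_good_resp[OF resp_wk, of T \<Delta> \<Gamma> A]
    by (auto dest: ctx_good_append)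
next
  case (substitution \<Delta> A \<Gamma> J a)
  then have "resp T \<Gamma> (inst [a]) (A # \<Gamma>)" by (auto intro: resp_inst)
  from subst_good_resp[OF resp_lift[OF this, of \<Delta>]] ctx_good_resp[OF this, of \<Delta>] substitution.IH
  show ?case by auto
next
  case (conversion \<Gamma> a A B)
  have "derivable T \<Theta> (EqTerm (subst \<sigma> a) (subst \<tau> a) (subst \<sigma> B))"
    if *: "wf_ctx T \<Theta>" "sub_pair T \<Theta> \<sigma> \<tau> \<Gamma>" for \<Theta> \<sigma> \<tau>
  proof (rule conversion_eq)
    show "derivable T \<Theta> (EqTerm (subst \<sigma> a) (subst \<tau> a) (subst \<sigma> A))"
      using conversion.IH(1) * by (fastforce simp: subst_good_def)
    show "derivable T \<Theta> (EqType (subst \<sigma> A) (subst \<sigma> B))"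
      using simultaneous_substitution[OF conversion.hyps(2) *(1)] *(2) by (simp add: sub_pair_def)
  qed
  then show ?case using conversion.IH by (simp add: subst_good_def)
next
  case (rule \<rho> ps J \<Gamma>)
  have "derivable T \<Gamma> J"
    using rule.IH rule.hyps by (intro derivable.rule[OF rule.hyps(1,2) _ rule.hyps(3)]) blast+
  then have "subst_good T \<Gamma> J"
    using rule.IH(1,2) by (intro subst_good_applied[OF T rule.hyps(1,2)]) (auto simp: presup_def)
  moreover have "ctx_good T \<Gamma>"
    using rule.IH(2) by (auto simp: presup_def ctx_good_conv)
  ultimately show ?case by blast
next
  case (congruence \<rho> ps J qs K \<Gamma> E)
  have "derivable T \<Gamma> E"
    using derivable.congruence[OF congruence.hyps(1-3)] congruence by blast
  moreover have "equate E E = Some E"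
    using congruence.hyps(5) by (cases "(J, K)" rule: equate.cases) auto
  moreover have "ctx_good T \<Gamma>"
    using congruence.IH(4) by (auto simp: presup_def ctx_good_conv)
  ultimately show ?case using equation_subst_good by blast
next
  case (type_refl \<Gamma> A)
  then show ?case using derivable.type_refl[OF type_refl.hyps] by (simp add: equation_subst_good)
next
  case (type_sym \<Gamma> A B)
  then show ?case using derivable.type_sym[OF type_sym.hyps] by (simp add: equation_subst_good)
next
  case (type_trans \<Gamma> A B C)
  then show ?case using derivable.type_trans[OF type_trans.hyps] by (simp add: equation_subst_good)
next
  case (term_refl \<Gamma> a A)
  then show ?case using derivable.term_refl[OF term_refl.hyps] by (simp add: equation_subst_good)
next
  case (term_sym \<Gamma> a b A)
  then show ?case using derivable.term_sym[OF term_sym.hyps] by (simp add: equation_subst_good)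
next
  case (term_trans \<Gamma> a b A c)
  then show ?case using derivable.term_trans[OF term_trans.hyps] by (simp add: equation_subst_good)
next
  case (conversion_eq \<Gamma> a b A B)
  then show ?case using derivable.conversion_eq[OF conversion_eq.hyps] by (simp add: equation_subst_good)
qed

section \<open>Categories with display maps\<close>

context category
begin

lemma hom_iff: "f \<in> hom C X Y \<longleftrightarrow> f \<in> Mor C \<and> Dom C f = X \<and> Cod C f = Y"
  by (simp add: hom_def)

lemma Comp_simps [simp]:
  assumes "f \<in> Mor C" "g \<in> Mor C" "Cod C f = Dom C g"
  shows "g \<cdot> f \<in> Mor C" "Dom C (g \<cdot> f) = Dom C f" "Cod C (g \<cdot> f) = Cod C g"
  using Comp_in_hom[of f "Dom C f" "Dom C g" g "Cod C g"] assms by (simp_all add: hom_iff)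

lemma Ide_simps [simp]:
  assumes "X \<in> Obj C"
  shows "Ide C X \<in> Mor C" "Dom C (Ide C X) = X" "Cod C (Ide C X) = X"
  using Ide_in_hom[OF assms] by (simp_all add: hom_iff)

lemma Obj_simps [simp]:
  assumes "f \<in> Mor C"
  shows "Dom C f \<in> Obj C" "Cod C f \<in> Obj C"
  using assms Dom_in_Obj Cod_in_Obj by auto

lemma Comp_Ide_simps [simp]:
  "f \<in> Mor C \<Longrightarrow> Dom C f = X \<Longrightarrow> f \<cdot> Ide C X = f"
  "f \<in> Mor C \<Longrightarrow> Cod C f = X \<Longrightarrow> Ide C X \<cdot> f = f"
  using Comp_Ide[of f X "Cod C f"] Ide_Comp[of f "Dom C f" X] by (simp_all add: hom_iff)

lemma assoc [simp]:
  assumes "f \<in> Mor C" "g \<in> Mor C" "h \<in> Mor C" "Cod C f = Dom C g" "Cod C g = Dom C h"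
  shows "h \<cdot> g \<cdot> f = h \<cdot> (g \<cdot> f)"
  using Comp_assoc[of f "Dom C f" "Dom C g" g "Dom C h" h "Cod C h"] assms by (simp add: hom_iff)

text \<open>\<open>assoc\<close> brackets composites to the right, so a known equation for a
  composite of two maps does not match when a further map follows. This is its form with such a
  map.\<close>

lemma comp_reduce:
  assumes "g \<cdot> f = h" "f \<in> Mor C" "g \<in> Mor C" "k \<in> Mor C" "Cod C k = Dom C f" "Cod C f = Dom C g"
  shows "g \<cdot> (f \<cdot> k) = h \<cdot> k"
  using assms by (simp flip: assms(1))

definition inverse_pair :: "'m \<Rightarrow> 'm \<Rightarrow> bool" where
  "inverse_pair f g \<longleftrightarrow> f \<in> Mor C \<and> g \<in> Mor C \<and> Dom C g = Cod C f \<and> Cod C g = Dom C f \<and>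
     g \<cdot> f = Ide C (Dom C f) \<and> f \<cdot> g = Ide C (Cod C f)"

lemma iso_iff: "iso C f \<longleftrightarrow> (\<exists>g. inverse_pair f g)"
  by (auto simp: iso_def inverse_pair_def hom_iff)

lemma inverse_pair_sym: "inverse_pair f g \<Longrightarrow> inverse_pair g f"
  by (simp add: inverse_pair_def)

lemma inverse_pairD:
  assumes "inverse_pair f g"
  shows "f \<in> Mor C" "g \<in> Mor C" "Dom C g = Cod C f" "Cod C g = Dom C f"
    "g \<cdot> f = Ide C (Dom C f)" "f \<cdot> g = Ide C (Cod C f)"
    "k \<in> Mor C \<Longrightarrow> Cod C k = Dom C f \<Longrightarrow> g \<cdot> (f \<cdot> k) = k"
    "k \<in> Mor C \<Longrightarrow> Cod C k = Cod C f \<Longrightarrow> f \<cdot> (g \<cdot> k) = k"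
  using assms by (auto simp: inverse_pair_def comp_reduce[of g f] comp_reduce[of f g])

lemma inverse_pair_comp:
  assumes "inverse_pair f f'" "inverse_pair g g'" "Cod C f = Dom C g"
  shows "inverse_pair (g \<cdot> f) (f' \<cdot> g')"
  using assms inverse_pairD[OF assms(1)] inverse_pairD[OF assms(2)] by (simp add: inverse_pair_def)

lemma inverse_pair_Ide: "X \<in> Obj C \<Longrightarrow> inverse_pair (Ide C X) (Ide C X)"
  by (simp add: inverse_pair_def)

lemma pullback_iff:
  "pullback C f g p q \<longleftrightarrow>
    p \<in> Mor C \<and> q \<in> Mor C \<and> Dom C q = Dom C p \<and> Cod C p = Dom C f \<and> Cod C q = Dom C g \<and> f \<cdot> p = g \<cdot> q \<and>
    (\<forall>a\<in>Mor C. \<forall>b\<in>Mor C. Dom C a = Dom C b \<longrightarrow> Cod C a = Dom C f \<longrightarrow> Cod C b = Dom C g \<longrightarrow> f \<cdot> a = g \<cdot> b \<longrightarrow>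
      (\<exists>!h. h \<in> Mor C \<and> Dom C h = Dom C a \<and> Cod C h = Dom C p \<and> p \<cdot> h = a \<and> q \<cdot> h = b))"
  (is "_ \<longleftrightarrow> ?R")
proof
  assume "pullback C f g p q"
  then show ?R by (auto simp: pullback_def hom_iff)
next
  assume R: ?R
  show "pullback C f g p q"
    unfolding pullback_def
  proof (intro exI[of _ "Dom C p"] conjI allI ballI impI)
    fix Z a b
    assume ab: "a \<in> hom C Z (Dom C f)" "b \<in> hom C Z (Dom C g)" "f \<cdot> a = g \<cdot> b"
    have "\<exists>!h. h \<in> Mor C \<and> Dom C h = Dom C a \<and> Cod C h = Dom C p \<and> p \<cdot> h = a \<and> q \<cdot> h = b"
      by (intro R[THEN conjunct2, THEN conjunct2, THEN conjunct2, THEN conjunct2, THEN conjunct2,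
            THEN conjunct2, rule_format]) (use ab in \<open>auto simp: hom_iff\<close>)
    moreover have "Dom C a = Z" using ab by (simp add: hom_iff)
    ultimately show "\<exists>!h. h \<in> hom C Z (Dom C p) \<and> p \<cdot> h = a \<and> q \<cdot> h = b"
      by (simp add: hom_iff conj_assoc)
  qed (use R in \<open>simp_all only: hom_iff\<close>)
qed

lemma pullbackD:
  assumes "pullback C f g p q"
  shows "p \<in> Mor C" "q \<in> Mor C" "Dom C q = Dom C p" "Cod C p = Dom C f" "Cod C q = Dom C g" "f \<cdot> p = g \<cdot> q"
  using assms by (auto simp: pullback_iff)

lemma pullback_ex1:
  assumes "pullback C f g p q" "a \<in> Mor C" "b \<in> Mor C" "Dom C a = Dom C b" "Cod C a = Dom C f" "Cod C b = Dom C g"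
    "f \<cdot> a = g \<cdot> b"
  shows "\<exists>!h. h \<in> Mor C \<and> Dom C h = Dom C a \<and> Cod C h = Dom C p \<and> p \<cdot> h = a \<and> q \<cdot> h = b"
  using assms(1) unfolding pullback_iff using assms(2-7) by blast

lemma pullback_lift:
  assumes "pullback C f g p q" "a \<in> Mor C" "b \<in> Mor C" "Dom C a = Dom C b" "Cod C a = Dom C f" "Cod C b = Dom C g"
    "f \<cdot> a = g \<cdot> b"
  obtains h where "h \<in> Mor C" "Dom C h = Dom C b" "Cod C h = Dom C p" "p \<cdot> h = a" "q \<cdot> h = b"
  using pullback_ex1[OF assms] that assms(4) by auto

lemma pullback_eqI:
  assumes pb: "pullback C f g p q" and fg: "f \<in> Mor C" "g \<in> Mor C"
    and h: "h \<in> Mor C" "h' \<in> Mor C" "Cod C h = Dom C p" "Cod C h' = Dom C p"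
    and eq: "p \<cdot> h = p \<cdot> h'" "q \<cdot> h = q \<cdot> h'"
  shows "h = h'"
proof -
  note [simp] = pullbackD[OF pb]
  have "f \<cdot> (p \<cdot> h') = g \<cdot> (q \<cdot> h')"
    using fg h comp_reduce[OF pullbackD(6)[OF pb], of h'] by simp
  then have "\<exists>!k. k \<in> Mor C \<and> Dom C k = Dom C (p \<cdot> h') \<and> Cod C k = Dom C p \<and> p \<cdot> k = p \<cdot> h' \<and> q \<cdot> k = q \<cdot> h'"
    using h fg by (intro pullback_ex1[OF pb]) simp_all
  moreover have "Dom C h = Dom C h'"
    using arg_cong[OF eq(1), of "Dom C"] h by simp
  then have "Dom C h = Dom C (p \<cdot> h')" "Dom C h' = Dom C (p \<cdot> h')"
    using h by simp_all
  ultimately show ?thesis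
    using h eq by blast
qed

lemma pullbackI:
  assumes "p \<in> Mor C" "q \<in> Mor C" "Dom C q = Dom C p" "Cod C p = Dom C f" "Cod C q = Dom C g" "f \<cdot> p = g \<cdot> q"
    and "\<And>a b. a \<in> Mor C \<Longrightarrow> b \<in> Mor C \<Longrightarrow> Dom C a = Dom C b \<Longrightarrow> Cod C a = Dom C f \<Longrightarrow> Cod C b = Dom C g \<Longrightarrow> f \<cdot> a = g \<cdot> b
      \<Longrightarrow> \<exists>h. h \<in> Mor C \<and> Dom C h = Dom C a \<and> Cod C h = Dom C p \<and> p \<cdot> h = a \<and> q \<cdot> h = b"
    and "\<And>h h'. h \<in> Mor C \<Longrightarrow> h' \<in> Mor C \<Longrightarrow> Cod C h = Dom C p \<Longrightarrow> Cod C h' = Dom C p \<Longrightarrow>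
      p \<cdot> h = p \<cdot> h' \<Longrightarrow> q \<cdot> h = q \<cdot> h' \<Longrightarrow> h = h'"
  shows "pullback C f g p q"
  unfolding pullback_iff
proof (intro conjI ballI impI)
  fix a b assume "a \<in> Mor C" "b \<in> Mor C" "Dom C a = Dom C b" "Cod C a = Dom C f" "Cod C b = Dom C g" "f \<cdot> a = g \<cdot> b"
  from assms(7)[OF this] obtain h
    where h: "h \<in> Mor C \<and> Dom C h = Dom C a \<and> Cod C h = Dom C p \<and> p \<cdot> h = a \<and> q \<cdot> h = b" ..
  then show "\<exists>!h. h \<in> Mor C \<and> Dom C h = Dom C a \<and> Cod C h = Dom C p \<and> p \<cdot> h = a \<and> q \<cdot> h = b"
  proof (rule ex1I)
    fix h' assume "h' \<in> Mor C \<and> Dom C h' = Dom C a \<and> Cod C h' = Dom C p \<and> p \<cdot> h' = a \<and> q \<cdot> h' = b"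
    then show "h' = h" using h by - (rule assms(8), auto)
  qed
qed (use assms(1-6) in blast)+

lemma pullback_sym:
  assumes "pullback C f g p q" "f \<in> Mor C" "g \<in> Mor C"
  shows "pullback C g f q p"
proof (rule pullbackI)
  fix a b assume *: "a \<in> Mor C" "b \<in> Mor C" "Dom C a = Dom C b" "Cod C a = Dom C g" "Cod C b = Dom C f" "g \<cdot> a = f \<cdot> b"
  obtain h where "h \<in> Mor C" "Dom C h = Dom C a" "Cod C h = Dom C p" "p \<cdot> h = b" "q \<cdot> h = a"
    by (rule pullback_lift[OF assms(1), of b a]) (use * in auto)
  then show "\<exists>h. h \<in> Mor C \<and> Dom C h = Dom C a \<and> Cod C h = Dom C q \<and> q \<cdot> h = a \<and> p \<cdot> h = b"
    using pullbackD(3)[OF assms(1)] by auto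
next
  fix h h' assume "h \<in> Mor C" "h' \<in> Mor C" "Cod C h = Dom C q" "Cod C h' = Dom C q" "q \<cdot> h = q \<cdot> h'" "p \<cdot> h = p \<cdot> h'"
  then show "h = h'" using pullbackD(3)[OF assms(1)] by - (rule pullback_eqI[OF assms], auto)
qed (use pullbackD[OF assms(1)] in auto)

lemma pullback_iso_comp:
  assumes pb: "pullback C f g p q" and i: "inverse_pair \<alpha> \<beta>" and cod: "Cod C \<alpha> = Dom C f"
    and fg: "f \<in> Mor C" "g \<in> Mor C"
  shows "pullback C (f \<cdot> \<alpha>) g (\<beta> \<cdot> p) q"
proof (rule pullbackI)
  note [simp] = pullbackD[OF pb] inverse_pairD[OF i] cod fg
  fix a b assume *: "a \<in> Mor C" "b \<in> Mor C" "Dom C a = Dom C b"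
    "Cod C a = Dom C (f \<cdot> \<alpha>)" "Cod C b = Dom C g" "f \<cdot> \<alpha> \<cdot> a = g \<cdot> b"
  obtain h where "h \<in> Mor C" "Dom C h = Dom C b" "Cod C h = Dom C p" "p \<cdot> h = \<alpha> \<cdot> a" "q \<cdot> h = b"
    by (rule pullback_lift[OF pb, of "\<alpha> \<cdot> a" b]) (use * in simp_all)
  then show "\<exists>h. h \<in> Mor C \<and> Dom C h = Dom C a \<and> Cod C h = Dom C (\<beta> \<cdot> p) \<and> \<beta> \<cdot> p \<cdot> h = a \<and> q \<cdot> h = b"
    using * by (intro exI[of _ h]) simp
next
  note [simp] = pullbackD[OF pb] inverse_pairD[OF i] cod fg
  fix h h' assume *: "h \<in> Mor C" "h' \<in> Mor C" "Cod C h = Dom C (\<beta> \<cdot> p)" "Cod C h' = Dom C (\<beta> \<cdot> p)"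
    "\<beta> \<cdot> p \<cdot> h = \<beta> \<cdot> p \<cdot> h'" "q \<cdot> h = q \<cdot> h'"
  then have "\<alpha> \<cdot> (\<beta> \<cdot> (p \<cdot> h)) = \<alpha> \<cdot> (\<beta> \<cdot> (p \<cdot> h'))" by simp
  then show "h = h'"
    using * by - (rule pullback_eqI[OF pb], simp_all)
qed (use inverse_pairD[OF i] pullbackD[OF pb] cod fg in simp_all)

lemma pullback_unique:
  assumes pb: "pullback C f g p q" and pb': "pullback C f g p' q'" and fg: "f \<in> Mor C" "g \<in> Mor C"
  obtains \<phi> \<psi> where "inverse_pair \<phi> \<psi>" "Dom C \<phi> = Dom C p" "Cod C \<phi> = Dom C p'" "p' \<cdot> \<phi> = p" "q' \<cdot> \<phi> = q"
proof -
  note [simp] = pullbackD(1-5)[OF pb] pullbackD(1-5)[OF pb'] fg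
  obtain \<phi> where \<phi>: "\<phi> \<in> Mor C" "Dom C \<phi> = Dom C q" "Cod C \<phi> = Dom C p'" "p' \<cdot> \<phi> = p" "q' \<cdot> \<phi> = q"
    by (rule pullback_lift[OF pb', of p q]) (simp_all add: pullbackD(6)[OF pb])
  obtain \<psi> where \<psi>: "\<psi> \<in> Mor C" "Dom C \<psi> = Dom C q'" "Cod C \<psi> = Dom C p" "p \<cdot> \<psi> = p'" "q \<cdot> \<psi> = q'"
    by (rule pullback_lift[OF pb, of p' q']) (simp_all add: pullbackD(6)[OF pb'])
  have "\<psi> \<cdot> \<phi> = Ide C (Dom C p)"
    by (rule pullback_eqI[OF pb]) (use \<phi> \<psi> in \<open>simp_all add: comp_reduce[OF \<psi>(4)] comp_reduce[OF \<psi>(5)]\<close>)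
  moreover have "\<phi> \<cdot> \<psi> = Ide C (Dom C p')"
    by (rule pullback_eqI[OF pb']) (use \<phi> \<psi> in \<open>simp_all add: comp_reduce[OF \<phi>(4)] comp_reduce[OF \<phi>(5)]\<close>)
  ultimately have "inverse_pair \<phi> \<psi>" using \<phi> \<psi> by (simp add: inverse_pair_def)
  then show thesis using that \<phi> by simp
qed

end

text \<open>The model is the projection that drops one variable. Such projections contain identities
  and are closed under composition only up to an isomorphism of the source, which the unit type and
  the sum types provide.\<close>

locale display_category = category C
  for C :: "('o, 'm) cat" (structure) +
  fixes disp :: "'m set"
  assumes disp_Mor: "disp \<subseteq> Mor C"
    and disp_pullback: "\<lbrakk>d \<in> disp; g \<in> Mor C; Cod C d = Cod C g\<rbrakk> \<Longrightarrow> \<exists>p. \<exists>q\<in>disp. pullback C d g p q"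
    and disp_Ide: "X \<in> Obj C \<Longrightarrow> \<exists>d\<in>disp. \<exists>\<alpha>. iso C \<alpha> \<and> Cod C \<alpha> = Dom C d \<and> d \<cdot> \<alpha> = Ide C X"
    and disp_comp:
      "\<lbrakk>d \<in> disp; e \<in> disp; Cod C e = Dom C d\<rbrakk> \<Longrightarrow>
        \<exists>d'\<in>disp. \<exists>\<alpha>. iso C \<alpha> \<and> Cod C \<alpha> = Dom C d' \<and> d \<cdot> e = d' \<cdot> \<alpha>"
begin

text \<open>An isomorphism on the source side is enough: by \<open>iso_comp_disp\<close> one on the
  target side can be moved past a display map.\<close>

definition fib :: "'m set" where
  "fib = {d \<cdot> \<alpha> | d \<alpha>. d \<in> disp \<and> iso C \<alpha> \<and> Cod C \<alpha> = Dom C d}"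

lemma fibE:
  assumes "f \<in> fib"
  obtains d \<alpha> \<beta> where "d \<in> disp" "d \<in> Mor C" "inverse_pair \<alpha> \<beta>" "Cod C \<alpha> = Dom C d" "f = d \<cdot> \<alpha>"
  using assms disp_Mor unfolding fib_def iso_iff by blast

lemma fibI: "d \<in> disp \<Longrightarrow> inverse_pair \<alpha> \<beta> \<Longrightarrow> Cod C \<alpha> = Dom C d \<Longrightarrow> d \<cdot> \<alpha> \<in> fib"
  unfolding fib_def iso_iff by blast

lemma fib_Mor [simp]: "f \<in> fib \<Longrightarrow> f \<in> Mor C"
  by (elim fibE) (simp add: inverse_pair_def)

lemma disp_fib: "d \<in> disp \<Longrightarrow> d \<in> fib"
  using fibI[of d "Ide C (Dom C d)" "Ide C (Dom C d)"] disp_Mor inverse_pair_Ide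
  by (auto simp: subset_iff)

lemma fib_comp_iso:
  assumes "f \<in> fib" "inverse_pair \<alpha> \<beta>" "Cod C \<alpha> = Dom C f"
  shows "f \<cdot> \<alpha> \<in> fib"
proof -
  obtain d \<gamma> \<delta> where d: "d \<in> disp" "d \<in> Mor C" "inverse_pair \<gamma> \<delta>" "Cod C \<gamma> = Dom C d" "f = d \<cdot> \<gamma>"
    using assms(1) by (rule fibE)
  note [simp] = inverse_pairD(1-4)[OF d(3)] inverse_pairD(1-4)[OF assms(2)]
  have "d \<cdot> (\<gamma> \<cdot> \<alpha>) \<in> fib"
    using inverse_pair_comp[OF assms(2) d(3)] assms d by (intro fibI) simp_all
  then show ?thesis using assms d by simp
qed

lemma iso_in_fib:
  assumes "inverse_pair \<alpha> \<beta>"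
  shows "\<alpha> \<in> fib"
proof -
  note [simp] = inverse_pairD[OF assms]
  obtain d \<gamma> where d: "d \<in> disp" "iso C \<gamma>" "Cod C \<gamma> = Dom C d" "d \<cdot> \<gamma> = Ide C (Cod C \<alpha>)"
    using disp_Ide[of "Cod C \<alpha>"] by auto
  then have "Ide C (Cod C \<alpha>) \<in> fib" unfolding fib_def by force
  from fib_comp_iso[OF this assms] show ?thesis by simp
qed

lemma fib_pullback_exists:
  assumes "f \<in> fib" "g \<in> Mor C" "Cod C f = Cod C g"
  shows "\<exists>p. \<exists>q\<in>fib. pullback C f g p q"
proof -
  obtain d \<alpha> \<beta> where d: "d \<in> disp" "d \<in> Mor C" "inverse_pair \<alpha> \<beta>" "Cod C \<alpha> = Dom C d" "f = d \<cdot> \<alpha>"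
    using assms(1) by (rule fibE)
  then obtain p q where "q \<in> disp" "pullback C d g p q"
    using disp_pullback[of d g] assms inverse_pairD(1)[OF d(3)] by auto
  then show ?thesis
    using pullback_iso_comp[of d g p q \<alpha> \<beta>] d assms(2) disp_fib by blast
qed

lemma fib_pullback:
  assumes "f \<in> fib" "g \<in> Mor C" "Cod C f = Cod C g" "pullback C f g p q"
  shows "q \<in> fib"
proof -
  obtain p' q' where pb: "pullback C f g p' q'" and q': "q' \<in> fib"
    using fib_pullback_exists assms by blast
  obtain \<phi> \<psi> where "inverse_pair \<phi> \<psi>" "Dom C \<phi> = Dom C p" "Cod C \<phi> = Dom C p'" "p' \<cdot> \<phi> = p" "q' \<cdot> \<phi> = q"
    by (rule pullback_unique[OF assms(4) pb]) (use assms in simp_all)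
  then show ?thesis using fib_comp_iso[OF q'] pullbackD(3)[OF pb] by force
qed

text \<open>The new display map is the pullback \<open>q\<close> of \<open>d\<close> along the
  inverse \<beta>. As \<beta> is invertible, so is the other projection \<open>p\<close>, its
  inverse being the map \<open>h\<close> induced by the identity and
  \<open>\<alpha> \<cdot> d\<close>.\<close>

lemma iso_comp_disp:
  assumes d: "d \<in> disp" and i: "inverse_pair \<alpha> \<beta>" and cod: "Dom C \<alpha> = Cod C d"
  obtains e \<gamma> \<delta> where "e \<in> disp" "inverse_pair \<gamma> \<delta>" "Cod C \<gamma> = Dom C e" "\<alpha> \<cdot> d = e \<cdot> \<gamma>"
    "Dom C \<gamma> = Dom C d" "Cod C e = Cod C \<alpha>"
proof -
  have [simp]: "d \<in> Mor C" using d disp_Mor by auto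
  note [simp] = inverse_pairD[OF i] cod
  obtain p q where pb: "pullback C d \<beta> p q" and q: "q \<in> disp"
    using disp_pullback[of d \<beta>] d by auto
  note [simp] = pullbackD(1-5)[OF pb]
  obtain h where h [simp]: "h \<in> Mor C" "Dom C h = Dom C (\<alpha> \<cdot> d)" "Cod C h = Dom C p"
    "p \<cdot> h = Ide C (Dom C d)" "q \<cdot> h = \<alpha> \<cdot> d"
    by (rule pullback_lift[OF pb, of "Ide C (Dom C d)" "\<alpha> \<cdot> d"]) simp_all
  have "h \<cdot> p = Ide C (Dom C p)"
  proof (rule pullback_eqI[OF pb])
    show "q \<cdot> (h \<cdot> p) = q \<cdot> Ide C (Dom C p)"
      using comp_reduce[OF h(5), of p] by (simp add: pullbackD(6)[OF pb])
  qed (simp_all add: comp_reduce[OF h(4)])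
  then have "inverse_pair h p" by (simp add: inverse_pair_def)
  then show thesis using that[OF q] by simp
qed

text \<open>In \<open>e \<cdot> \<beta> \<cdot> d \<cdot> \<alpha>\<close> the isomorphism \<beta>
  separates the display maps. Moving it to the right of \<open>d\<close> leaves a composite of two
  display maps followed on the source side by isomorphisms.\<close>

lemma fib_comp:
  assumes "f \<in> fib" "g \<in> fib" "Cod C f = Dom C g"
  shows "g \<cdot> f \<in> fib"
proof -
  obtain d \<alpha> \<alpha>' where d: "d \<in> disp" "d \<in> Mor C" "inverse_pair \<alpha> \<alpha>'" "Cod C \<alpha> = Dom C d" "f = d \<cdot> \<alpha>"
    using assms(1) by (rule fibE)
  obtain e \<beta> \<beta>' where e: "e \<in> disp" "e \<in> Mor C" "inverse_pair \<beta> \<beta>'" "Cod C \<beta> = Dom C e" "g = e \<cdot> \<beta>"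
    using assms(2) by (rule fibE)
  note [simp] = inverse_pairD(1-4)[OF d(3)] inverse_pairD(1-4)[OF e(3)]
  have [simp]: "Cod C d = Dom C \<beta>" using assms(3) d e by simp
  obtain e' \<gamma> \<gamma>' where e': "e' \<in> disp" "inverse_pair \<gamma> \<gamma>'" "Cod C \<gamma> = Dom C e'" "\<beta> \<cdot> d = e' \<cdot> \<gamma>"
    "Dom C \<gamma> = Dom C d" "Cod C e' = Cod C \<beta>"
    using iso_comp_disp[OF d(1) e(3)] by auto
  have [simp]: "e' \<in> Mor C" using e' disp_Mor by auto
  note [simp] = inverse_pairD(1-4)[OF e'(2)]
  have [simp]: "Cod C e' = Dom C e" "Dom C \<gamma> = Dom C d"
    using e'(5,6) e(4) by simp_all
  obtain d' \<delta> where d': "d' \<in> disp" "iso C \<delta>" "Cod C \<delta> = Dom C d'" "e \<cdot> e' = d' \<cdot> \<delta>"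
    using disp_comp[OF e(1) e'(1)] by auto
  then obtain \<delta>' where \<delta>: "inverse_pair \<delta> \<delta>'" by (auto simp: iso_iff)
  note [simp] = inverse_pairD(1-4)[OF \<delta>]
  have [simp]: "d' \<in> Mor C" using d' disp_Mor by auto
  have [simp]: "Dom C \<delta> = Dom C e'"
    using arg_cong[OF d'(4), of "Dom C"] d'(3) e(2) by simp
  have "g \<cdot> f = e \<cdot> (\<beta> \<cdot> d \<cdot> \<alpha>)" using d(2,4,5) e(2,4,5) by simp
  also have "\<dots> = e \<cdot> e' \<cdot> (\<gamma> \<cdot> \<alpha>)" unfolding e'(4) using d(2,4) e(2,4) e'(3) by simp
  also have "\<dots> = d' \<cdot> (\<delta> \<cdot> (\<gamma> \<cdot> \<alpha>))" unfolding d'(4) using d(2,4) e(2,4) e'(3) d'(3) by simp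
  also have "\<dots> \<in> fib"
    using inverse_pair_comp[OF inverse_pair_comp[OF d(3) e'(2)] \<delta>] d(4) e'(3) d'(1,3)
    by (intro fibI) simp_all
  finally show ?thesis .
qed

lemma fib_set_iso_factor:
  assumes "q \<in> fib"
  obtains d \<alpha> \<beta> where "d \<in> disp" "inverse_pair \<alpha> \<beta>" "q = d \<cdot> \<alpha>" "d \<in> Mor C" "Cod C \<alpha> = Dom C d"
    "Dom C \<alpha> = Dom C q" "Cod C d = Cod C q"
proof -
  obtain d \<alpha> \<beta> where d: "d \<in> disp" "d \<in> Mor C" "inverse_pair \<alpha> \<beta>" "Cod C \<alpha> = Dom C d" "q = d \<cdot> \<alpha>"
    using assms by (rule fibE)
  then show thesis using that inverse_pairD(1)[OF d(3)] by simp
qed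

end

section \<open>Path structures and homotopy\<close>

text \<open>In the intended use \<open>a\<close> and \<open>e\<close> are the projections of the
  pullback of a fibration along the common image of its points \<open>x\<close> and
  \<open>y\<close>, so that \<open>x\<close> and \<open>y\<close> become sections of
  \<open>e\<close>. A type \<open>q\<close> over this fibre that is inhabited at \<open>x\<close> is
  inhabited at \<open>y\<close>. Describing the sections by equations avoids having to name
  them.\<close>

definition (in category) section_transport :: "'m set \<Rightarrow> 'm \<Rightarrow> 'm \<Rightarrow> 'o \<Rightarrow> 'm \<Rightarrow> 'm \<Rightarrow> bool" where
  "section_transport D a e X x y \<longleftrightarrow>
    (\<forall>q\<in>D. \<forall>c\<in>Mor C. Cod C q = Dom C a \<longrightarrow> Dom C c = X \<longrightarrow> Cod C c = Dom C q \<longrightarrow>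
      a \<cdot> (q \<cdot> c) = x \<longrightarrow> e \<cdot> (q \<cdot> c) = Ide C X \<longrightarrow>
      (\<exists>c'\<in>Mor C. Dom C c' = X \<and> Cod C c' = Dom C q \<and> a \<cdot> (q \<cdot> c') = y \<and> e \<cdot> (q \<cdot> c') = Ide C X))"

text \<open>
  \<open>s\<close>, \<open>t\<close> and \<open>r\<close> are source, target and reflexivity of an identity type of the fibration \<open>f\<close>.
  The condition on \<open>u\<close> is transport along an arbitrary family \<open>u\<close> of paths in a type
  over the pullback of \<open>f\<close> to the parameters of \<open>u\<close>; the last condition is elimination without
  contextual parameters.
\<close>

definition (in category) path_structure :: "'m set \<Rightarrow> 'm \<Rightarrow> 'm \<Rightarrow> 'm \<Rightarrow> 'm \<Rightarrow> bool" where
  "path_structure D f s t r \<longleftrightarrow>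
    s \<in> Mor C \<and> t \<in> Mor C \<and> r \<in> Mor C \<and> Dom C t = Dom C s \<and> Cod C s = Dom C f \<and> Cod C t = Dom C f \<and>
    f \<cdot> s = f \<cdot> t \<and> Dom C r = Dom C f \<and> Cod C r = Dom C s \<and>
    s \<cdot> r = Ide C (Dom C f) \<and> t \<cdot> r = Ide C (Dom C f) \<and>
    (\<exists>p q. \<exists>k\<in>D. pullback C f f p q \<and> Dom C k = Dom C s \<and> Cod C k = Dom C p \<and> p \<cdot> k = s \<and> q \<cdot> k = t) \<and>
    (\<forall>u\<in>Mor C. Cod C u = Dom C s \<longrightarrow> (\<exists>a e. pullback C f (f \<cdot> (s \<cdot> u)) a e \<and>
      section_transport D a e (Dom C u) (s \<cdot> u) (t \<cdot> u))) \<and>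
    (\<forall>c\<in>D. \<forall>d\<in>Mor C. Cod C c = Dom C s \<longrightarrow> Dom C d = Dom C r \<longrightarrow> Cod C d = Dom C c \<longrightarrow> c \<cdot> d = r \<longrightarrow>
      (\<exists>j\<in>Mor C. Dom C j = Dom C s \<and> Cod C j = Dom C c \<and> c \<cdot> j = Ide C (Dom C s)))"

context category
begin

lemma path_structureD:
  assumes "path_structure D f s t r"
  shows "s \<in> Mor C" "t \<in> Mor C" "r \<in> Mor C" "Dom C t = Dom C s" "Cod C s = Dom C f" "Cod C t = Dom C f"
    "Dom C r = Dom C f" "Cod C r = Dom C s" "s \<cdot> r = Ide C (Dom C f)" "t \<cdot> r = Ide C (Dom C f)" "f \<cdot> s = f \<cdot> t"
  using assms by (simp_all add: path_structure_def)

lemma path_structure_kernel: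
  assumes "path_structure D f s t r"
  obtains p q k where "k \<in> D" "pullback C f f p q" "Dom C k = Dom C s" "Cod C k = Dom C p" "p \<cdot> k = s" "q \<cdot> k = t"
  using assms unfolding path_structure_def by blast

lemma section_transportI:
  assumes "\<And>q c. q \<in> D \<Longrightarrow> c \<in> Mor C \<Longrightarrow> Cod C q = Dom C a \<Longrightarrow> Dom C c = X \<Longrightarrow> Cod C c = Dom C q \<Longrightarrow>
    a \<cdot> (q \<cdot> c) = x \<Longrightarrow> e \<cdot> (q \<cdot> c) = Ide C X \<Longrightarrow>
    \<exists>c'\<in>Mor C. Dom C c' = X \<and> Cod C c' = Dom C q \<and> a \<cdot> (q \<cdot> c') = y \<and> e \<cdot> (q \<cdot> c') = Ide C X"
  shows "section_transport D a e X x y"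
  using assms unfolding section_transport_def by blast

lemma section_transportD:
  assumes "section_transport D a e X x y" "q \<in> D" "c \<in> Mor C" "Cod C q = Dom C a" "Dom C c = X" "Cod C c = Dom C q"
    "a \<cdot> (q \<cdot> c) = x" "e \<cdot> (q \<cdot> c) = Ide C X"
  obtains c' where "c' \<in> Mor C" "Dom C c' = X" "Cod C c' = Dom C q" "a \<cdot> (q \<cdot> c') = y" "e \<cdot> (q \<cdot> c') = Ide C X"
  using assms unfolding section_transport_def by blast

lemma path_structure_transport:
  assumes "path_structure D f s t r" "u \<in> Mor C" "Cod C u = Dom C s"
  obtains a e where "pullback C f (f \<cdot> (s \<cdot> u)) a e"
    "section_transport D a e (Dom C u) (s \<cdot> u) (t \<cdot> u)"
  using assms unfolding path_structure_def by blast

lemma path_structure_elim: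
  assumes "path_structure D f s t r" "c \<in> D" "d \<in> Mor C" "Cod C c = Dom C s" "Dom C d = Dom C r" "Cod C d = Dom C c"
    "c \<cdot> d = r"
  obtains j where "j \<in> Mor C" "Dom C j = Dom C s" "Cod C j = Dom C c" "c \<cdot> j = Ide C (Dom C s)"
  using assms unfolding path_structure_def by blast

end

section \<open>Path structures on arbitrary fibrations\<close>

locale identity_category = display_category C disp
  for C :: "('o, 'm) cat" (structure) and disp :: "'m set" +
  assumes terminal_fib: "\<exists>Z. terminal C Z \<and> (\<forall>f\<in>Mor C. Cod C f = Z \<longrightarrow> f \<in> fib)"
    and disp_path_structure: "d \<in> disp \<Longrightarrow> \<exists>s t r. path_structure disp d s t r"
begin

lemma section_transport_fib:
  assumes "section_transport disp a e X x y"
  shows "section_transport fib a e X x y"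
proof (rule section_transportI)
  show "\<exists>c'\<in>Mor C. Dom C c' = X \<and> Cod C c' = Dom C q \<and>
        a \<cdot> (q \<cdot> c') = y \<and> e \<cdot> (q \<cdot> c') = Ide C X"
    if q: "q \<in> fib" and c: "c \<in> Mor C" "Cod C q = Dom C a" "Dom C c = X" "Cod C c = Dom C q"
      "a \<cdot> (q \<cdot> c) = x" "e \<cdot> (q \<cdot> c) = Ide C X" for q c
  proof -
    obtain d \<alpha> \<beta> where d: "d \<in> disp" "inverse_pair \<alpha> \<beta>" "q = d \<cdot> \<alpha>" "d \<in> Mor C" "Cod C \<alpha> = Dom C d"
      "Dom C \<alpha> = Dom C q" "Cod C d = Cod C q"
      using q by (rule fib_set_iso_factor)
    note [simp] = inverse_pairD[OF d(2)]
    have "d \<cdot> (\<alpha> \<cdot> c) = q \<cdot> c" using d(4-6) c(1,4) by (simp add: d(3))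
    then obtain c' where c': "c' \<in> Mor C" "Dom C c' = X" "Cod C c' = Dom C d"
        "a \<cdot> (d \<cdot> c') = y" "e \<cdot> (d \<cdot> c') = Ide C X"
      using section_transportD[OF assms, of d "\<alpha> \<cdot> c"] d(1,4-7) c by auto
    moreover have "q \<cdot> (\<beta> \<cdot> c') = d \<cdot> c'" using d(4-6) c' by (simp add: d(3))
    ultimately show ?thesis using d(5,6) by (intro bexI[of _ "\<beta> \<cdot> c'"]) simp_all
  qed
qed

lemma path_structure_fib:
  assumes "path_structure disp f s t r" and f: "f \<in> Mor C"
  shows "path_structure fib f s t r"
proof -
  note D = path_structureD[OF assms(1)]
  note [simp] = D(1-8) f
  have "\<exists>p q. \<exists>k\<in>fib. pullback C f f p q \<and> Dom C k = Dom C s \<and> Cod C k = Dom C p \<and> p \<cdot> k = s \<and> q \<cdot> k = t"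
    using path_structure_kernel[OF assms(1)] disp_fib by metis
  moreover have "\<exists>a e. pullback C f (f \<cdot> (s \<cdot> u)) a e \<and> section_transport fib a e (Dom C u) (s \<cdot> u) (t \<cdot> u)"
    if "u \<in> Mor C" "Cod C u = Dom C s" for u
    using path_structure_transport[OF assms(1) that] section_transport_fib by metis
  moreover have "\<exists>j\<in>Mor C. Dom C j = Dom C s \<and> Cod C j = Dom C c \<and> c \<cdot> j = Ide C (Dom C s)"
    if c: "c \<in> fib" and d: "d \<in> Mor C" "Cod C c = Dom C s" "Dom C d = Dom C r" "Cod C d = Dom C c" "c \<cdot> d = r" for c d
  proof -
    obtain e \<alpha> \<beta> where e: "e \<in> disp" "inverse_pair \<alpha> \<beta>" "c = e \<cdot> \<alpha>" "e \<in> Mor C" "Cod C \<alpha> = Dom C e"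
      "Dom C \<alpha> = Dom C c" "Cod C e = Cod C c"
      using c by (rule fib_set_iso_factor)
    note [simp] = inverse_pairD[OF e(2)]
    have "e \<cdot> (\<alpha> \<cdot> d) = r" using e(4-6) d by (simp add: e(3))
    then obtain j where j: "j \<in> Mor C" "Dom C j = Dom C s" "Cod C j = Dom C e" "e \<cdot> j = Ide C (Dom C s)"
      using path_structure_elim[OF assms(1) e(1), of "\<alpha> \<cdot> d"] e(4-7) d(1-4) by auto
    moreover have "c \<cdot> (\<beta> \<cdot> j) = e \<cdot> j" using e(4-6) j by (simp add: e(3))
    ultimately show ?thesis using e(5,6) by (intro bexI[of _ "\<beta> \<cdot> j"]) simp_all
  qed
  ultimately show ?thesis
    unfolding path_structure_def using D by (auto 0 0)
qed

text \<open>The path space of \<open>f\<close> serves for \<open>f \<cdot> \<alpha>\<close> as well: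
  endpoints are carried back by \<beta>, and reflexivity is precomposed with \<alpha>. The fibred
  square keeps its apex, so the display map of endpoints \<open>k\<close> is unchanged.\<close>

lemma path_structure_comp_iso:
  assumes "path_structure D f s t r" and f: "f \<in> Mor C"
    and i: "inverse_pair \<alpha> \<beta>" "Cod C \<alpha> = Dom C f" and D: "D \<subseteq> Mor C"
  shows "path_structure D (f \<cdot> \<alpha>) (\<beta> \<cdot> s) (\<beta> \<cdot> t) (r \<cdot> \<alpha>)"
proof -
  note [simp] = path_structureD(1-10)[OF assms(1)] f inverse_pairD[OF i(1)] i(2)
  note [simp] = comp_reduce[OF path_structureD(9)[OF assms(1)]] comp_reduce[OF path_structureD(10)[OF assms(1)]]
  have "\<exists>p q. \<exists>k\<in>D. pullback C (f \<cdot> \<alpha>) (f \<cdot> \<alpha>) p q \<and> Dom C k = Dom C (\<beta> \<cdot> s) \<and> Cod C k = Dom C p \<and>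
      p \<cdot> k = \<beta> \<cdot> s \<and> q \<cdot> k = \<beta> \<cdot> t"
  proof -
    obtain p q k where k: "k \<in> D" "pullback C f f p q" "Dom C k = Dom C s" "Cod C k = Dom C p" "p \<cdot> k = s" "q \<cdot> k = t"
      by (rule path_structure_kernel[OF assms(1)])
    note [simp] = pullbackD(1-5)[OF k(2)]
    have [simp]: "k \<in> Mor C" using k D by auto
    have "pullback C (f \<cdot> \<alpha>) f (\<beta> \<cdot> p) q"
      using k(2) i by (rule pullback_iso_comp) simp_all
    then have "pullback C f (f \<cdot> \<alpha>) q (\<beta> \<cdot> p)"
      by (rule pullback_sym) simp_all
    then have "pullback C (f \<cdot> \<alpha>) (f \<cdot> \<alpha>) (\<beta> \<cdot> q) (\<beta> \<cdot> p)"
      using i by (rule pullback_iso_comp) simp_all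
    then have "pullback C (f \<cdot> \<alpha>) (f \<cdot> \<alpha>) (\<beta> \<cdot> p) (\<beta> \<cdot> q)"
      by (rule pullback_sym) simp_all
    then show ?thesis using k by (intro exI[of _ "\<beta> \<cdot> p"] exI[of _ "\<beta> \<cdot> q"] bexI[of _ k]) simp_all
  qed
  moreover have "\<exists>a e. pullback C (f \<cdot> \<alpha>) (f \<cdot> \<alpha> \<cdot> (\<beta> \<cdot> s \<cdot> u)) a e \<and>
      section_transport D a e (Dom C u) (\<beta> \<cdot> s \<cdot> u) (\<beta> \<cdot> t \<cdot> u)"
    if u: "u \<in> Mor C" "Cod C u = Dom C (\<beta> \<cdot> s)" for u
  proof -
    have u': "Cod C u = Dom C s" using u by simp
    obtain a e where pb: "pullback C f (f \<cdot> (s \<cdot> u)) a e" and tr: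
      "section_transport D a e (Dom C u) (s \<cdot> u) (t \<cdot> u)"
      by (rule path_structure_transport[OF assms(1) u(1) u'])
    note [simp] = pullbackD(1-5)[OF pb] u(1) u'
    have pb': "pullback C (f \<cdot> \<alpha>) (f \<cdot> \<alpha> \<cdot> (\<beta> \<cdot> s \<cdot> u)) (\<beta> \<cdot> a) e"
      using pullback_iso_comp[OF pb i] by simp
    have "\<exists>c'\<in>Mor C. Dom C c' = Dom C u \<and> Cod C c' = Dom C q \<and>
          \<beta> \<cdot> a \<cdot> (q \<cdot> c') = \<beta> \<cdot> t \<cdot> u \<and> e \<cdot> (q \<cdot> c') = Ide C (Dom C u)"
      if c: "q \<in> D" "c \<in> Mor C" "Cod C q = Dom C (\<beta> \<cdot> a)" "Dom C c = Dom C u" "Cod C c = Dom C q"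
        "\<beta> \<cdot> a \<cdot> (q \<cdot> c) = \<beta> \<cdot> s \<cdot> u" "e \<cdot> (q \<cdot> c) = Ide C (Dom C u)" for q c
    proof -
      have q [simp]: "q \<in> Mor C" "Cod C q = Dom C a" using c D by auto
      have "\<alpha> \<cdot> (\<beta> \<cdot> a \<cdot> (q \<cdot> c)) = \<alpha> \<cdot> (\<beta> \<cdot> s \<cdot> u)" using c(6) by simp
      then have "a \<cdot> (q \<cdot> c) = s \<cdot> u" using c(2-5) by simp
      then obtain c' where "c' \<in> Mor C" "Dom C c' = Dom C u" "Cod C c' = Dom C q"
          "a \<cdot> (q \<cdot> c') = t \<cdot> u" "e \<cdot> (q \<cdot> c') = Ide C (Dom C u)"
        using section_transportD[OF tr, of q c] c by auto
      then show ?thesis by (intro bexI[of _ c']) simp_all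
    qed
    then have "section_transport D (\<beta> \<cdot> a) e (Dom C u) (\<beta> \<cdot> s \<cdot> u) (\<beta> \<cdot> t \<cdot> u)"
      by (rule section_transportI)
    then show ?thesis using pb' by blast
  qed
  moreover have "\<exists>j\<in>Mor C. Dom C j = Dom C (\<beta> \<cdot> s) \<and> Cod C j = Dom C c \<and> c \<cdot> j = Ide C (Dom C (\<beta> \<cdot> s))"
    if c: "c \<in> D" "d \<in> Mor C" "Cod C c = Dom C (\<beta> \<cdot> s)" "Dom C d = Dom C (r \<cdot> \<alpha>)" "Cod C d = Dom C c" "c \<cdot> d = r \<cdot> \<alpha>" for c d
  proof -
    have [simp]: "c \<in> Mor C" using c D by auto
    obtain j where "j \<in> Mor C" "Dom C j = Dom C s" "Cod C j = Dom C c" "c \<cdot> j = Ide C (Dom C s)"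
    proof (rule path_structure_elim[OF assms(1) c(1), of "d \<cdot> \<beta>"])
      show "c \<cdot> (d \<cdot> \<beta>) = r" using comp_reduce[OF c(6), of \<beta>] c(2-5) by simp
    qed (use c in simp_all)
    then show ?thesis by auto
  qed
  moreover have "f \<cdot> \<alpha> \<cdot> (\<beta> \<cdot> s) = f \<cdot> \<alpha> \<cdot> (\<beta> \<cdot> t)"
    by (simp add: path_structureD(11)[OF assms(1)])
  ultimately show ?thesis
    unfolding path_structure_def by simp
qed

lemma path_structure_exists:
  assumes "f \<in> fib"
  obtains s t r where "path_structure fib f s t r"
proof -
  obtain d \<alpha> \<beta> where d: "d \<in> disp" "d \<in> Mor C" "inverse_pair \<alpha> \<beta>" "Cod C \<alpha> = Dom C d" "f = d \<cdot> \<alpha>"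
    using assms by (rule fibE)
  from disp_path_structure[OF d(1)] obtain s t r where "path_structure disp d s t r" by blast
  from path_structure_comp_iso[OF path_structure_fib[OF this d(2)] d(2-4)]
  show thesis using that d(5) by (simp add: subset_iff)
qed

lemma fib_pullback_obtain:
  assumes "f \<in> fib" "g \<in> Mor C" "Cod C f = Cod C g"
  obtains p q where "q \<in> fib" "pullback C f g p q"
  using fib_pullback_exists[OF assms] by blast

section \<open>Homotopy relative to a fibration\<close>

definition homotopic :: "'m \<Rightarrow> 'm \<Rightarrow> 'm \<Rightarrow> bool" where
  "homotopic f x y \<longleftrightarrow> (\<exists>s t r. \<exists>u\<in>Mor C.
     path_structure fib f s t r \<and> Cod C u = Dom C s \<and> s \<cdot> u = x \<and> t \<cdot> u = y)"

lemma homotopicD: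
  assumes "homotopic f x y" "f \<in> Mor C"
  shows "x \<in> Mor C" "y \<in> Mor C" "Dom C y = Dom C x" "Cod C x = Dom C f" "Cod C y = Dom C f" "f \<cdot> y = f \<cdot> x"
proof -
  obtain s t r u where u: "path_structure fib f s t r" "u \<in> Mor C" "Cod C u = Dom C s" "s \<cdot> u = x" "t \<cdot> u = y"
    using assms unfolding homotopic_def by blast
  note [simp] = path_structureD(1-10)[OF u(1)] u(2,3) assms(2)
  show "x \<in> Mor C" "y \<in> Mor C" "Dom C y = Dom C x" "Cod C x = Dom C f" "Cod C y = Dom C f" "f \<cdot> y = f \<cdot> x"
    unfolding u(4,5)[symmetric] using comp_reduce[OF path_structureD(11)[OF u(1)], of u] by simp_all
qed

lemma homotopic_refl:
  assumes "f \<in> fib" "x \<in> Mor C" "Cod C x = Dom C f"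
  shows "homotopic f x x"
proof -
  obtain s t r where st: "path_structure fib f s t r"
    using assms(1) by (rule path_structure_exists)
  note [simp] = path_structureD(1-10)[OF st] assms(2,3)
  have "s \<cdot> (r \<cdot> x) = x" "t \<cdot> (r \<cdot> x) = x"
    using comp_reduce[OF path_structureD(9)[OF st], of x] comp_reduce[OF path_structureD(10)[OF st], of x] by simp_all
  then show ?thesis
    unfolding homotopic_def using st by (intro exI[of _ s] exI[of _ t] exI[of _ r] bexI[of _ "r \<cdot> x"]) simp_all
qed

lemma homotopic_precomp:
  assumes "homotopic f x y" "f \<in> Mor C" "h \<in> Mor C" "Cod C h = Dom C x"
  shows "homotopic f (x \<cdot> h) (y \<cdot> h)"
proof -
  obtain s t r u where u: "path_structure fib f s t r" "u \<in> Mor C" "Cod C u = Dom C s" "s \<cdot> u = x" "t \<cdot> u = y"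
    using assms unfolding homotopic_def by blast
  note [simp] = path_structureD(1-10)[OF u(1)] u(2,3) assms(2,3)
  have [simp]: "Cod C h = Dom C u" using assms(4) unfolding u(4)[symmetric] by simp
  show ?thesis
    unfolding homotopic_def u(4,5)[symmetric] using u(1)
    by (intro exI[of _ s] exI[of _ t] exI[of _ r] bexI[of _ "u \<cdot> h"]) simp_all
qed

text \<open>With \<open>a\<close> and \<open>e\<close> the projections of a pullback of
  \<open>f\<close> along \<open>f \<cdot> x\<close>, this is the point \<open>x\<close> viewed as a
  section of the fibre through it; another point with the same image under \<open>f\<close> gives
  another section of that fibre.\<close>

definition point_over :: "'m \<Rightarrow> 'm \<Rightarrow> 'o \<Rightarrow> 'm \<Rightarrow> 'm \<Rightarrow> bool" where
  "point_over a e X x v \<longleftrightarrow> v \<in> Mor C \<and> Dom C v = X \<and> Cod C v = Dom C a \<and> a \<cdot> v = x \<and> e \<cdot> v = Ide C X"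

lemma point_overD:
  assumes "point_over a e X x v"
  shows "v \<in> Mor C" "Dom C v = X" "Cod C v = Dom C a" "a \<cdot> v = x" "e \<cdot> v = Ide C X"
  using assms by (simp_all add: point_over_def)

text \<open>This is transport freed from the path structure: only the sections \<open>v\<close> and
  \<open>w\<close> of the two ends remain. That the new lift lies strictly over \<open>w\<close>
  follows from uniqueness in the pullback.\<close>

lemma homotopic_transport_fib:
  assumes "homotopic f x y" "f \<in> fib"
  obtains a e v w where "e \<in> fib" "pullback C f (f \<cdot> x) a e"
    "point_over a e (Dom C x) x v"
    "point_over a e (Dom C x) y w"
    "\<And>q c. q \<in> fib \<Longrightarrow> Cod C q = Dom C a \<Longrightarrow> c \<in> Mor C \<Longrightarrow> Dom C c = Dom C x \<Longrightarrow> Cod C c = Dom C q \<Longrightarrow>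
      q \<cdot> c = v \<Longrightarrow> \<exists>c'\<in>Mor C. Dom C c' = Dom C x \<and> Cod C c' = Dom C q \<and> q \<cdot> c' = w"
proof -
  obtain s t r u where u: "path_structure fib f s t r" "u \<in> Mor C" "Cod C u = Dom C s" "s \<cdot> u = x" "t \<cdot> u = y"
    using assms unfolding homotopic_def by blast
  note [simp] = path_structureD(1-10)[OF u(1)] u(2,3) assms(2)
  obtain a e where pb: "pullback C f (f \<cdot> (s \<cdot> u)) a e" and tr:
      "section_transport fib a e (Dom C u) (s \<cdot> u) (t \<cdot> u)"
    by (rule path_structure_transport[OF u(1-3)])
  have e: "e \<in> fib"
    using pb by (intro fib_pullback[OF assms(2) _ _ pb]) simp_all
  note pbD [simp] = pullbackD(1-5)[OF pb]
  obtain v where v: "v \<in> Mor C" "Dom C v = Dom C u" "Cod C v = Dom C a" "a \<cdot> v = s \<cdot> u" "e \<cdot> v = Ide C (Dom C u)"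
    by (rule pullback_lift[OF pb, of "s \<cdot> u" "Ide C (Dom C u)"]) simp_all
  obtain w where w: "w \<in> Mor C" "Dom C w = Dom C u" "Cod C w = Dom C a" "a \<cdot> w = t \<cdot> u" "e \<cdot> w = Ide C (Dom C u)"
    by (rule pullback_lift[OF pb, of "t \<cdot> u" "Ide C (Dom C u)"])
      (use comp_reduce[OF path_structureD(11)[OF u(1)], of u] in simp_all)
  have "\<exists>c'\<in>Mor C. Dom C c' = Dom C u \<and> Cod C c' = Dom C q \<and> q \<cdot> c' = w"
    if c: "q \<in> fib" "Cod C q = Dom C a" "c \<in> Mor C" "Dom C c = Dom C u" "Cod C c = Dom C q" "q \<cdot> c = v" for q c
  proof -
    obtain c' where c': "c' \<in> Mor C" "Dom C c' = Dom C u" "Cod C c' = Dom C q"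
        "a \<cdot> (q \<cdot> c') = t \<cdot> u" "e \<cdot> (q \<cdot> c') = Ide C (Dom C u)"
      using section_transportD[OF tr, of q c] c v by auto
    moreover have "q \<cdot> c' = w"
      by (rule pullback_eqI[OF pb]) (use c c' w in simp_all)
    ultimately show ?thesis by blast
  qed
  then show thesis
    by (intro that[of e a v w]) (use e pb v w in \<open>simp_all add: point_over_def flip: u(4,5)\<close>)
qed

text \<open>Transport acts on types over the fibre; a fibration \<open>q\<close> over the domain of
  \<open>f\<close> becomes one by pullback along \<open>a\<close>.\<close>

lemma transport_section:
  assumes "homotopic f x y" "f \<in> fib" "q \<in> fib" "Cod C q = Dom C f"
    and c: "c \<in> Mor C" "Cod C c = Dom C q" "q \<cdot> c = x"
  obtains c' where "c' \<in> Mor C" "Dom C c' = Dom C x" "Cod C c' = Dom C q" "q \<cdot> c' = y"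
proof -
  obtain a e v w where e: "e \<in> fib" and pb: "pullback C f (f \<cdot> x) a e"
    and v: "point_over a e (Dom C x) x v"
    and w: "point_over a e (Dom C x) y w"
    and tr: "\<And>q c. q \<in> fib \<Longrightarrow> Cod C q = Dom C a \<Longrightarrow> c \<in> Mor C \<Longrightarrow> Dom C c = Dom C x \<Longrightarrow> Cod C c = Dom C q \<Longrightarrow>
      q \<cdot> c = v \<Longrightarrow> \<exists>c'\<in>Mor C. Dom C c' = Dom C x \<and> Cod C c' = Dom C q \<and> q \<cdot> c' = w"
    using homotopic_transport_fib[OF assms(1,2)] by metis
  note v = point_overD[OF v] and w = point_overD[OF w]
  note [simp] = pullbackD(1-5)[OF pb] assms(2,3,4) c(1,2) homotopicD(1-5)[OF assms(1) fib_Mor[OF assms(2)]] v(1-3) w(1-3)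
  have [simp]: "Dom C c = Dom C x" using arg_cong[OF c(3), of "Dom C"] by simp
  obtain p4 q4 where q4: "q4 \<in> fib" and pb4: "pullback C q a p4 q4"
    by (rule fib_pullback_obtain[of q a]) simp_all
  note [simp] = pullbackD(1-5)[OF pb4] q4
  obtain d where d: "d \<in> Mor C" "Dom C d = Dom C v" "Cod C d = Dom C p4" "p4 \<cdot> d = c" "q4 \<cdot> d = v"
    by (rule pullback_lift[OF pb4, of c v]) (simp_all add: c(3) v(4))
  then obtain d' where d': "d' \<in> Mor C" "Dom C d' = Dom C x" "Cod C d' = Dom C p4" "q4 \<cdot> d' = w"
    using tr[of q4 d] by auto
  have "q \<cdot> (p4 \<cdot> d') = y"
    using comp_reduce[OF pullbackD(6)[OF pb4], of d'] d' w(4) by simp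
  then show thesis using that[of "p4 \<cdot> d'"] d' by simp
qed

text \<open>Transport in an identity type: over a point \<open>z\<close> of the fibre one has the
  type of paths from \<open>m z\<close> to \<open>n z\<close> in the fibration \<open>k\<close>.
  Each later use only has to choose \<open>m\<close> and \<open>n\<close>.\<close>

definition transports :: "'m \<Rightarrow> 'm \<Rightarrow> 'm \<Rightarrow> bool" where
  "transports a v w \<longleftrightarrow> (\<forall>k\<in>fib. \<forall>m\<in>Mor C. \<forall>n\<in>Mor C. Dom C m = Dom C a \<longrightarrow> Dom C n = Dom C a \<longrightarrow>
     Cod C m = Dom C k \<longrightarrow> Cod C n = Dom C k \<longrightarrow> k \<cdot> m = k \<cdot> n \<longrightarrow>
     homotopic k (m \<cdot> v) (n \<cdot> v) \<longrightarrow> homotopic k (m \<cdot> w) (n \<cdot> w))"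

lemma transportsD:
  "transports a v w \<Longrightarrow> k \<in> fib \<Longrightarrow> m \<in> Mor C \<Longrightarrow> n \<in> Mor C \<Longrightarrow> Dom C m = Dom C a \<Longrightarrow> Dom C n = Dom C a \<Longrightarrow>
    Cod C m = Dom C k \<Longrightarrow> Cod C n = Dom C k \<Longrightarrow> k \<cdot> m = k \<cdot> n \<Longrightarrow>
    homotopic k (m \<cdot> v) (n \<cdot> v) \<Longrightarrow> homotopic k (m \<cdot> w) (n \<cdot> w)"
  unfolding transports_def by blast

lemma transport_homotopic:
  assumes "homotopic f x y" "f \<in> fib"
  obtains a e v w where "pullback C f (f \<cdot> x) a e"
    "point_over a e (Dom C x) x v"
    "point_over a e (Dom C x) y w"
    "transports a v w"
proof -
  obtain a e v w where e: "e \<in> fib" and pb: "pullback C f (f \<cdot> x) a e"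
    and v': "point_over a e (Dom C x) x v"
    and w': "point_over a e (Dom C x) y w"
    and tr: "\<And>q c. q \<in> fib \<Longrightarrow> Cod C q = Dom C a \<Longrightarrow> c \<in> Mor C \<Longrightarrow> Dom C c = Dom C x \<Longrightarrow> Cod C c = Dom C q \<Longrightarrow>
      q \<cdot> c = v \<Longrightarrow> \<exists>c'\<in>Mor C. Dom C c' = Dom C x \<and> Cod C c' = Dom C q \<and> q \<cdot> c' = w"
    using homotopic_transport_fib[OF assms(1,2)] by metis
  note v = point_overD[OF v'] and w = point_overD[OF w']
  have "homotopic k (m \<cdot> w) (n \<cdot> w)"
    if k: "k \<in> fib" and mn: "m \<in> Mor C" "n \<in> Mor C" "Dom C m = Dom C a" "Dom C n = Dom C a"
      "Cod C m = Dom C k" "Cod C n = Dom C k" "k \<cdot> m = k \<cdot> n" and hot: "homotopic k (m \<cdot> v) (n \<cdot> v)" for k m n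
  proof -
    obtain s t r u where u: "path_structure fib k s t r" "u \<in> Mor C" "Cod C u = Dom C s" "s \<cdot> u = m \<cdot> v" "t \<cdot> u = n \<cdot> v"
      using hot unfolding homotopic_def by blast
    note [simp] = path_structureD(1-10)[OF u(1)] u(2,3) k pullbackD(1-5)[OF pb] mn(1-6) v(1-3) w(1-3)
    have [simp]: "Dom C u = Dom C x" using arg_cong[OF u(4), of "Dom C"] by simp
    obtain p q l where l: "l \<in> fib" and kp: "pullback C k k p q" and l': "Dom C l = Dom C s" "Cod C l = Dom C p" "p \<cdot> l = s" "q \<cdot> l = t"
      using path_structure_kernel[OF u(1)] by metis
    note [simp] = pullbackD(1-5)[OF kp] l l'(1,2)
    \<comment> \<open>\<open>h\<close> is the pair of \<open>m\<close> and \<open>n\<close> into the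
      fibred square of \<open>k\<close>. The pullback \<open>q3\<close> along \<open>h\<close> of
      the endpoint map \<open>l\<close> is the type of paths from \<open>m z\<close> to
      \<open>n z\<close>; a lift of \<open>v\<close> to it is a homotopy from
      \<open>m \<cdot> v\<close> to \<open>n \<cdot> v\<close>.\<close>
    obtain h where h [simp]: "h \<in> Mor C" "Dom C h = Dom C n" "Cod C h = Dom C p" and h': "p \<cdot> h = m" "q \<cdot> h = n"
      by (rule pullback_lift[OF kp, of m n]) (simp_all add: mn(7))
    obtain p3 q3 where q3: "q3 \<in> fib" and pb3: "pullback C l h p3 q3"
      by (rule fib_pullback_obtain[of l h]) simp_all
    note [simp] = pullbackD(1-5)[OF pb3] q3
    have "l \<cdot> u = h \<cdot> v"
      by (rule pullback_eqI[OF kp])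
        (simp_all add: comp_reduce[OF l'(3)] comp_reduce[OF l'(4)] comp_reduce[OF h'(1)] comp_reduce[OF h'(2)] u(4,5))
    then obtain c where "c \<in> Mor C" "Dom C c = Dom C v" "Cod C c = Dom C p3" "p3 \<cdot> c = u" "q3 \<cdot> c = v"
      using pullback_lift[OF pb3, of u v] by auto
    then obtain c' where c' [simp]: "c' \<in> Mor C" "Dom C c' = Dom C x" "Cod C c' = Dom C p3" and "q3 \<cdot> c' = w"
      using tr[of q3 c] by auto
    then have lp: "l \<cdot> (p3 \<cdot> c') = h \<cdot> w"
      using comp_reduce[OF pullbackD(6)[OF pb3], of c'] by simp
    have "s \<cdot> (p3 \<cdot> c') = m \<cdot> w"
      using arg_cong[OF lp, of "\<lambda>z. p \<cdot> z"] by (simp add: comp_reduce[OF l'(3)] comp_reduce[OF h'(1)])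
    moreover have "t \<cdot> (p3 \<cdot> c') = n \<cdot> w"
      using arg_cong[OF lp, of "\<lambda>z. q \<cdot> z"] by (simp add: comp_reduce[OF l'(4)] comp_reduce[OF h'(2)])
    ultimately show ?thesis
      unfolding homotopic_def using u(1)
      by (intro exI[of _ s] exI[of _ t] exI[of _ r] bexI[of _ "p3 \<cdot> c'"]) simp_all
  qed
  then have "transports a v w" unfolding transports_def by blast
  with pb v' w' show thesis by (rule that)
qed

text \<open>Transport the type of paths from \<open>z\<close> to the fixed point \<open>x\<close>,
  with \<open>z\<close> varying from \<open>x\<close> to \<open>y\<close>, starting from
  reflexivity.\<close>

lemma homotopic_sym:
  assumes "homotopic f x y" "f \<in> fib"
  shows "homotopic f y x"
proof -
  obtain a e v w where pb: "pullback C f (f \<cdot> x) a e"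
    and v: "point_over a e (Dom C x) x v"
    and w: "point_over a e (Dom C x) y w"
    and tr: "transports a v w"
    by (rule transport_homotopic[OF assms])
  note v = point_overD[OF v] and w = point_overD[OF w]
  note [simp] = assms(2) pullbackD(1-5)[OF pb] homotopicD(1-5)[OF assms(1) fib_Mor[OF assms(2)]] v w
  show ?thesis
    using transportsD[OF tr, of f a "x \<cdot> e"] homotopic_refl[of f x] pullbackD(6)[OF pb] by simp
qed

text \<open>Here the transported type consists of the paths from the fixed point \<open>x\<close> to
  the varying point; it is moved along the second homotopy.\<close>

lemma homotopic_trans:
  assumes "homotopic f x y" "homotopic f y z" "f \<in> fib"
  shows "homotopic f x z"
proof -
  obtain a e v w where pb: "pullback C f (f \<cdot> y) a e"
    and v: "point_over a e (Dom C y) y v"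
    and w: "point_over a e (Dom C y) z w"
    and tr: "transports a v w"
    by (rule transport_homotopic[OF assms(2,3)])
  note v = point_overD[OF v] and w = point_overD[OF w]
  note xy = homotopicD[OF assms(1) fib_Mor[OF assms(3)]]
  note [simp] = assms(3) pullbackD(1-5)[OF pb] xy(1-5) v w
  have "f \<cdot> (x \<cdot> e) = f \<cdot> a"
    using pullbackD(6)[OF pb] unfolding xy(6) by simp
  then show ?thesis
    using transportsD[OF tr, of f "x \<cdot> e" a] assms(1) by simp
qed

section \<open>Homotopy of maps and homotopy equivalences\<close>

definition one :: 'o where
  "one = (SOME Z. terminal C Z \<and> (\<forall>f\<in>Mor C. Cod C f = Z \<longrightarrow> f \<in> fib))"

lemma one: "terminal C one" "\<And>f. f \<in> Mor C \<Longrightarrow> Cod C f = one \<Longrightarrow> f \<in> fib"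
  using someI_ex[OF terminal_fib] unfolding one_def by blast+

lemma one_unique:
  assumes "f \<in> Mor C" "g \<in> Mor C" "Dom C f = Dom C g" "Cod C f = one" "Cod C g = one"
  shows "f = g"
proof -
  have "\<exists>!h. h \<in> hom C (Dom C g) one"
    using one(1) assms(2) by (simp add: terminal_def)
  moreover have "f \<in> hom C (Dom C g) one" "g \<in> hom C (Dom C g) one"
    using assms by (simp_all add: hom_iff)
  ultimately show ?thesis by blast
qed

definition bang :: "'o \<Rightarrow> 'm" where
  "bang X = (THE f. f \<in> hom C X one)"

lemma bang [simp]:
  assumes "X \<in> Obj C"
  shows "bang X \<in> Mor C" "Dom C (bang X) = X" "Cod C (bang X) = one"
proof -
  have "\<exists>!f. f \<in> hom C X one" using one(1) assms by (simp add: terminal_def)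
  then have "bang X \<in> hom C X one" unfolding bang_def by (rule theI')
  then show "bang X \<in> Mor C" "Dom C (bang X) = X" "Cod C (bang X) = one" by (simp_all add: hom_iff)
qed

lemma bang_fib [simp]: "X \<in> Obj C \<Longrightarrow> bang X \<in> fib"
  by (simp add: one(2))

lemma bang_comp [simp]: "f \<in> Mor C \<Longrightarrow> Cod C f = X \<Longrightarrow> bang X \<cdot> f = bang (Dom C f)"
  by (rule one_unique) auto

definition heq :: "'m \<Rightarrow> 'm \<Rightarrow> bool"  (infix "\<simeq>" 50) where
  "f \<simeq> g \<longleftrightarrow> f \<in> Mor C \<and> homotopic (bang (Cod C f)) f g"

lemma heqD:
  assumes "f \<simeq> g"
  shows "f \<in> Mor C" "g \<in> Mor C" "Dom C g = Dom C f" "Cod C g = Cod C f"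
  using assms homotopicD[of "bang (Cod C f)" f g] by (auto simp: heq_def)

lemma heq_refl: "f \<in> Mor C \<Longrightarrow> f \<simeq> f"
  by (simp add: heq_def homotopic_refl)

lemma heq_sym: "f \<simeq> g \<Longrightarrow> g \<simeq> f"
  using heqD[of f g] homotopic_sym[of "bang (Cod C f)" f g] by (simp add: heq_def)

lemma heq_trans: "f \<simeq> g \<Longrightarrow> g \<simeq> h \<Longrightarrow> f \<simeq> h"
  using heqD[of f g] homotopic_trans[of "bang (Cod C f)" f g h] by (simp add: heq_def)

lemma heq_precomp: "f \<simeq> g \<Longrightarrow> h \<in> Mor C \<Longrightarrow> Cod C h = Dom C f \<Longrightarrow> f \<cdot> h \<simeq> g \<cdot> h"
  using heqD[of f g] homotopic_precomp[of "bang (Cod C f)" f g h] by (simp add: heq_def)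

text \<open>Transport the type of paths from \<open>h \<cdot> f\<close> to \<open>h\<close> applied
  to the varying point, starting from reflexivity at \<open>f\<close>. Thus \<open>h\<close> is
  never applied to a path.\<close>

lemma heq_postcomp:
  assumes "f \<simeq> g" "h \<in> Mor C" "Cod C f = Dom C h"
  shows "h \<cdot> f \<simeq> h \<cdot> g"
proof -
  note [simp] = heqD[OF assms(1)] assms(2,3)
  have "homotopic (bang (Cod C f)) f g" using assms(1) by (simp add: heq_def)
  then obtain a e v w where pb: "pullback C (bang (Cod C f)) (bang (Cod C f) \<cdot> f) a e"
    and v: "point_over a e (Dom C f) f v"
    and w: "point_over a e (Dom C f) g w"
    and tr: "transports a v w"
    by (rule transport_homotopic) simp_all
  note v = point_overD[OF v] and w = point_overD[OF w]
  note [simp] = pullbackD(1-5)[OF pb] v w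
  show ?thesis
    using transportsD[OF tr, of "bang (Cod C h)" "h \<cdot> (f \<cdot> e)" "h \<cdot> a"] homotopic_refl[of "bang (Cod C h)" "h \<cdot> f"] by (simp add: heq_def)
qed

definition weq :: "'m set" where
  "weq = {f \<in> Mor C. \<exists>g\<in>Mor C. Dom C g = Cod C f \<and> Cod C g = Dom C f \<and>
     f \<cdot> g \<simeq> Ide C (Cod C f) \<and> g \<cdot> f \<simeq> Ide C (Dom C f)}"

lemma weqE:
  assumes "f \<in> weq"
  obtains g where "f \<in> Mor C" "g \<in> Mor C" "Dom C g = Cod C f" "Cod C g = Dom C f"
    "f \<cdot> g \<simeq> Ide C (Cod C f)" "g \<cdot> f \<simeq> Ide C (Dom C f)"
  using assms unfolding weq_def by blast

lemma weqI:
  assumes "f \<in> Mor C" "g \<in> Mor C" "Dom C g = Cod C f" "Cod C g = Dom C f"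
    "f \<cdot> g \<simeq> Ide C (Cod C f)" "g \<cdot> f \<simeq> Ide C (Dom C f)"
  shows "f \<in> weq"
  using assms unfolding weq_def by blast

lemma heq_cancel_middle:
  assumes "g \<cdot> f \<simeq> Ide C X" "f \<in> Mor C" "g \<in> Mor C" "Cod C f = Dom C g"
    and "h \<in> Mor C" "Dom C h = X" "k \<in> Mor C" "Cod C k = Dom C f"
  shows "h \<cdot> (g \<cdot> (f \<cdot> k)) \<simeq> h \<cdot> k"
proof -
  note gf = heqD[OF assms(1)]
  have [simp]: "X \<in> Obj C" using Obj_simps(1)[OF assms(5)] assms(6) by simp
  note [simp] = assms(2-8)
  have [simp]: "Dom C f = X" "Cod C g = X" using gf(3,4) by simp_all
  have "g \<cdot> f \<cdot> k \<simeq> Ide C X \<cdot> k"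
    using assms(1) by (rule heq_precomp) simp_all
  then have "g \<cdot> (f \<cdot> k) \<simeq> k" by simp
  then show ?thesis by (rule heq_postcomp) simp_all
qed

text \<open>A left and a right homotopy inverse agree, as both are homotopic to
  \<open>l \<cdot> g \<cdot> k\<close>; either is then two-sided.\<close>

lemma weq_left_right:
  assumes "g \<in> Mor C" "k \<in> Mor C" "l \<in> Mor C" "Dom C k = Cod C g" "Cod C k = Dom C g" "Dom C l = Cod C g" "Cod C l = Dom C g"
    and "g \<cdot> k \<simeq> Ide C (Cod C g)" "l \<cdot> g \<simeq> Ide C (Dom C g)"
  shows "g \<in> weq" "l \<simeq> k" "k \<cdot> g \<simeq> Ide C (Dom C g)"
proof -
  note [simp] = assms(1-7)
  have "l \<cdot> (g \<cdot> k) \<simeq> l \<cdot> Ide C (Cod C g)"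
    using assms(8) by (rule heq_postcomp) simp_all
  then have "l \<simeq> l \<cdot> (g \<cdot> k)" by - (rule heq_sym, simp)
  moreover have "l \<cdot> g \<cdot> k \<simeq> Ide C (Dom C g) \<cdot> k"
    using assms(9) by (rule heq_precomp) simp_all
  then have "l \<cdot> (g \<cdot> k) \<simeq> k" by simp
  ultimately show lk: "l \<simeq> k" by (rule heq_trans)
  have "k \<cdot> g \<simeq> l \<cdot> g"
    using heq_sym[OF lk] by (rule heq_precomp) simp_all
  then show kg: "k \<cdot> g \<simeq> Ide C (Dom C g)" using heq_trans assms(9) by blast
  show "g \<in> weq" using assms kg by (intro weqI[of g k])
qed

lemma weq_comp:
  assumes "f \<in> weq" "g \<in> weq" "Cod C f = Dom C g"
  shows "g \<cdot> f \<in> weq"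
proof -
  obtain f' where f: "f \<in> Mor C" "f' \<in> Mor C" "Dom C f' = Cod C f" "Cod C f' = Dom C f"
    "f \<cdot> f' \<simeq> Ide C (Cod C f)" "f' \<cdot> f \<simeq> Ide C (Dom C f)"
    using assms(1) by (rule weqE)
  obtain g' where g: "g \<in> Mor C" "g' \<in> Mor C" "Dom C g' = Cod C g" "Cod C g' = Dom C g"
    "g \<cdot> g' \<simeq> Ide C (Cod C g)" "g' \<cdot> g \<simeq> Ide C (Dom C g)"
    using assms(2) by (rule weqE)
  note [simp] = f(1-4) g(1-4) assms(3)
  show ?thesis
  proof (rule weqI[of _ "f' \<cdot> g'"])
    have "g \<cdot> (f \<cdot> (f' \<cdot> g')) \<simeq> g \<cdot> g'"
      using f(5) by (rule heq_cancel_middle) simp_all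
    then show "g \<cdot> f \<cdot> (f' \<cdot> g') \<simeq> Ide C (Cod C (g \<cdot> f))"
      using heq_trans[OF _ g(5)] by simp
    have "f' \<cdot> (g' \<cdot> (g \<cdot> f)) \<simeq> f' \<cdot> f"
      using g(6) by (rule heq_cancel_middle) simp_all
    then show "f' \<cdot> g' \<cdot> (g \<cdot> f) \<simeq> Ide C (Dom C (g \<cdot> f))"
      using heq_trans[OF _ f(6)] by simp
  qed simp_all
qed

text \<open>Inverses \<open>k\<close> of \<open>g \<cdot> f\<close> and \<open>l\<close> of
  \<open>h \<cdot> g\<close> make \<open>f \<cdot> k\<close> a right and \<open>l \<cdot> h\<close>
  a left inverse of \<open>g\<close>. Their agreement yields the missing homotopies for the inverses
  \<open>k \<cdot> g\<close> of \<open>f\<close> and \<open>g \<cdot> l\<close> of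
  \<open>h\<close>.\<close>

lemma weq_two_out_of_six:
  assumes [simp]: "f \<in> Mor C" "g \<in> Mor C" "h \<in> Mor C" "Cod C f = Dom C g" "Cod C g = Dom C h"
    and "g \<cdot> f \<in> weq" "h \<cdot> g \<in> weq"
  shows "f \<in> weq" "g \<in> weq" "h \<in> weq"
proof -
  obtain k where k: "k \<in> Mor C" "Dom C k = Cod C (g \<cdot> f)" "Cod C k = Dom C (g \<cdot> f)"
    "g \<cdot> f \<cdot> k \<simeq> Ide C (Cod C (g \<cdot> f))" "k \<cdot> (g \<cdot> f) \<simeq> Ide C (Dom C (g \<cdot> f))"
    using assms(6) by (rule weqE)
  obtain l where l: "l \<in> Mor C" "Dom C l = Cod C (h \<cdot> g)" "Cod C l = Dom C (h \<cdot> g)"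
    "h \<cdot> g \<cdot> l \<simeq> Ide C (Cod C (h \<cdot> g))" "l \<cdot> (h \<cdot> g) \<simeq> Ide C (Dom C (h \<cdot> g))"
    using assms(7) by (rule weqE)
  have [simp]: "k \<in> Mor C" "Dom C k = Cod C g" "Cod C k = Dom C f" "l \<in> Mor C" "Dom C l = Cod C h" "Cod C l = Dom C g"
    using k(1-3) l(1-3) by simp_all
  have gfk: "g \<cdot> (f \<cdot> k) \<simeq> Ide C (Cod C g)" and kgf: "k \<cdot> g \<cdot> f \<simeq> Ide C (Dom C f)"
    and hgl: "h \<cdot> (g \<cdot> l) \<simeq> Ide C (Cod C h)" and lhg: "l \<cdot> h \<cdot> g \<simeq> Ide C (Dom C g)"
    using k(4,5) l(4,5) by simp_all
  note lr = weq_left_right[of g "f \<cdot> k" "l \<cdot> h", OF _ _ _ _ _ _ _ gfk lhg]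
  show "g \<in> weq" by (rule lr) simp_all
  have "f \<cdot> (k \<cdot> g) \<simeq> Ide C (Cod C f)" using lr(3) by simp
  then show "f \<in> weq" using kgf by (intro weqI[of f "k \<cdot> g"]) simp_all
  have "l \<cdot> h \<simeq> f \<cdot> k" by (rule lr) simp_all
  then have "g \<cdot> (l \<cdot> h) \<simeq> g \<cdot> (f \<cdot> k)" by (rule heq_postcomp) simp_all
  then have "g \<cdot> l \<cdot> h \<simeq> Ide C (Dom C h)" using heq_trans[OF _ gfk] by simp
  then show "h \<in> weq" using hgl by (intro weqI[of h "g \<cdot> l"]) simp_all
qed

lemma iso_in_weq: "inverse_pair f g \<Longrightarrow> f \<in> weq"
  using inverse_pairD[of f g] by (intro weqI[of f g]) (simp_all add: heq_refl)

lemma acyclic_section: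
  assumes "f \<in> weq" "f \<in> fib"
  obtains s where "s \<in> Mor C" "Dom C s = Cod C f" "Cod C s = Dom C f" "f \<cdot> s = Ide C (Cod C f)"
proof -
  obtain g where g: "f \<in> Mor C" "g \<in> Mor C" "Dom C g = Cod C f" "Cod C g = Dom C f"
    "f \<cdot> g \<simeq> Ide C (Cod C f)" "g \<cdot> f \<simeq> Ide C (Dom C f)"
    using assms(1) by (rule weqE)
  have hot: "homotopic (bang (Cod C f)) (f \<cdot> g) (Ide C (Cod C f))"
    using g(5) by (simp add: heq_def g(1-4))
  \<comment> \<open>The family over the codomain of \<open>f\<close> is \<open>f\<close> itself, and
    \<open>g\<close> is its lift of \<open>f \<cdot> g\<close>; transport turns it into a lift of
    the identity.\<close>
  show thesis
    by (rule transport_section[OF hot _ assms(2), of g]) (use that g(1-4) in simp_all)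
qed

text \<open>
  Transporting the type \<open>s (f z) = z\<close> in the fibre over \<open>f z\<close> along the homotopy from \<open>s f\<close> to the
  identity makes this homotopy fibrewise; fibrewise homotopies can be pulled back.
\<close>

lemma acyclic_fibrewise:
  assumes "f \<in> weq" "f \<in> fib"
  obtains s where "s \<in> Mor C" "Dom C s = Cod C f" "Cod C s = Dom C f" "f \<cdot> s = Ide C (Cod C f)"
    "homotopic f (s \<cdot> f) (Ide C (Dom C f))"
proof -
  obtain s where s: "s \<in> Mor C" "Dom C s = Cod C f" "Cod C s = Dom C f" "f \<cdot> s = Ide C (Cod C f)"
    using assms by (rule acyclic_section)
  obtain g where g: "f \<in> Mor C" "g \<in> Mor C" "Dom C g = Cod C f" "Cod C g = Dom C f"
    "f \<cdot> g \<simeq> Ide C (Cod C f)" "g \<cdot> f \<simeq> Ide C (Dom C f)"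
    using assms(1) by (rule weqE)
  note [simp] = s g(1-4) comp_reduce[OF s(4)] assms(2)
  \<comment> \<open>The strict section is unrelated to \<open>g\<close> by construction, but
    \<open>f \<cdot> s\<close> is an identity, so the composite here is \<open>g\<close> and
    \<open>s\<close> inherits the homotopy for \<open>g\<close>.\<close>
  have "g \<cdot> f \<cdot> s \<simeq> Ide C (Dom C f) \<cdot> s" using g(6) by (rule heq_precomp) simp_all
  then have "s \<simeq> g" by - (rule heq_sym, simp)
  then have "s \<cdot> f \<simeq> g \<cdot> f" by (rule heq_precomp) simp_all
  then have "s \<cdot> f \<simeq> Ide C (Dom C f)" using g(6) by (rule heq_trans)
  then have hot: "homotopic (bang (Dom C f)) (s \<cdot> f) (Ide C (Dom C f))" by (simp add: heq_def)
  have bf: "bang (Dom C f) \<in> fib" by simp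
  obtain a e v w where pb: "pullback C (bang (Dom C f)) (bang (Dom C f) \<cdot> (s \<cdot> f)) a e"
    and v: "point_over a e (Dom C (s \<cdot> f)) (s \<cdot> f) v"
    and w: "point_over a e (Dom C (s \<cdot> f)) (Ide C (Dom C f)) w"
    and tr: "transports a v w"
    by (rule transport_homotopic[OF hot bf])
  note v = point_overD[OF v] and w = point_overD[OF w]
  have [simp]: "Dom C v = Dom C f" "Dom C w = Dom C f" using v w by simp_all
  note [simp] = pullbackD(1-5)[OF pb] v(1,3,4) w(1,3,4)
  have "homotopic f (s \<cdot> f) (Ide C (Dom C f))"
    using transportsD[OF tr, of f "s \<cdot> (f \<cdot> a)" a] homotopic_refl[of f "s \<cdot> f"] by simp
  with that s show thesis by blast
qed

text \<open>The strict section \<open>s\<close> induces a strict section \<open>s'\<close> of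
  \<open>q\<close>, so only \<open>s' \<cdot> q\<close> has to be compared with the identity. The
  homotopy from \<open>s \<cdot> f\<close> to the identity stays in the fibres of \<open>f\<close>,
  so it can be carried into the pullback.\<close>

lemma acyclic_pullback:
  assumes "f \<in> weq" "f \<in> fib" "g \<in> Mor C" "Cod C f = Cod C g" "pullback C f g p q"
  shows "q \<in> weq"
proof -
  obtain s where s: "s \<in> Mor C" "Dom C s = Cod C f" "Cod C s = Dom C f" "f \<cdot> s = Ide C (Cod C f)"
    and hot: "homotopic f (s \<cdot> f) (Ide C (Dom C f))"
    using assms(1,2) by (rule acyclic_fibrewise)
  note pb = assms(5)
  note [simp] = s(1,2,3) assms(2,3) pullbackD(1-5)[OF pb]
  have [simp]: "Cod C g = Cod C f" using assms(4) by simp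
  note [simp] = s(4) comp_reduce[OF s(4)]
  note fp = pullbackD(6)[OF pb] comp_reduce[OF pullbackD(6)[OF pb]]
  obtain s' where s' [simp]: "s' \<in> Mor C" "Dom C s' = Dom C g" "Cod C s' = Dom C p" "p \<cdot> s' = s \<cdot> g" "q \<cdot> s' = Ide C (Dom C g)"
    by (rule pullback_lift[OF pb, of "s \<cdot> g" "Ide C (Dom C g)"]) simp_all
  have "homotopic f (s \<cdot> f \<cdot> p) (Ide C (Dom C f) \<cdot> p)"
    using hot by (rule homotopic_precomp) simp_all
  then have hot': "homotopic f (s \<cdot> (g \<cdot> q)) p" by (simp add: fp)
  obtain a e v w where pb2: "pullback C f (f \<cdot> (s \<cdot> (g \<cdot> q))) a e"
    and v: "point_over a e (Dom C (s \<cdot> (g \<cdot> q))) (s \<cdot> (g \<cdot> q)) v"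
    and w: "point_over a e (Dom C (s \<cdot> (g \<cdot> q))) p w"
    and tr: "transports a v w"
    by (rule transport_homotopic[OF hot' assms(2)])
  note v = point_overD[OF v] and w = point_overD[OF w]
  have pb2': "pullback C f (g \<cdot> q) a e" using pb2 by simp
  have [simp]: "Dom C v = Dom C p" "Dom C w = Dom C p" "e \<cdot> v = Ide C (Dom C p)" "e \<cdot> w = Ide C (Dom C p)"
    using v w by simp_all
  note [simp] = v(1,3,4) w(1,3,4) pullbackD(1-5)[OF pb2']
  \<comment> \<open>Over a point \<open>z\<close>, the map \<open>b\<close> carries the fibre of
    \<open>f\<close> over \<open>g (q z)\<close> into the domain of \<open>q\<close>, keeping the
    base point \<open>q z\<close>. It sends \<open>v\<close> to \<open>s' \<cdot> q\<close> and
    \<open>w\<close> to the identity, so the wanted homotopy arises by transporting the type of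
    paths from \<open>s' (q z)\<close> to the image under \<open>b\<close>.\<close>
  obtain b where b [simp]: "b \<in> Mor C" "Dom C b = Dom C a" "Cod C b = Dom C p" and b': "p \<cdot> b = a" "q \<cdot> b = q \<cdot> e"
    by (rule pullback_lift[OF pb, of a "q \<cdot> e"]) (simp_all add: pullbackD(6)[OF pb2'])
  have bv: "b \<cdot> v = s' \<cdot> q"
    by (rule pullback_eqI[OF pb])
      (simp_all add: comp_reduce[OF b'(1)] comp_reduce[OF b'(2)] comp_reduce[OF s'(4)] comp_reduce[OF s'(5)])
  have bw: "b \<cdot> w = Ide C (Dom C p)"
    by (rule pullback_eqI[OF pb]) (simp_all add: comp_reduce[OF b'(1)] comp_reduce[OF b'(2)])
  have "homotopic (bang (Dom C p)) (s' \<cdot> q) (Ide C (Dom C p))"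
    using transportsD[OF tr, of "bang (Dom C p)" "s' \<cdot> (q \<cdot> e)" b] homotopic_refl[of "bang (Dom C p)" "s' \<cdot> q"] bv bw by simp
  then have "s' \<cdot> q \<simeq> Ide C (Dom C q)" by (simp add: heq_def)
  then show "q \<in> weq" by (intro weqI[of q s']) (simp_all add: heq_refl)
qed

text \<open>Since \<open>s \<cdot> r\<close> is an identity, it remains to join
  \<open>r \<cdot> s\<close> to the identity of the path space. By elimination, such paths need only
  be given at reflexivity, where both ends are \<open>r\<close>.\<close>

lemma path_structure_refl_weq:
  assumes st: "path_structure fib f s t r" and f: "f \<in> Mor C"
  shows "r \<in> weq"
proof -
  note [simp] = path_structureD(1-10)[OF st] f
  note rr [simp] = comp_reduce[OF path_structureD(9)[OF st]]
  obtain s2 t2 r2 where st2: "path_structure fib (bang (Dom C s)) s2 t2 r2"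
    by (rule path_structure_exists[of "bang (Dom C s)"]) simp_all
  obtain p q k where k: "k \<in> fib" and kp: "pullback C (bang (Dom C s)) (bang (Dom C s)) p q"
    and k': "Dom C k = Dom C s2" "Cod C k = Dom C p" "p \<cdot> k = s2" "q \<cdot> k = t2"
    using path_structure_kernel[OF st2] by metis
  have [simp]: "s2 \<in> Mor C" "t2 \<in> Mor C" "r2 \<in> Mor C" "Dom C t2 = Dom C s2" "Cod C s2 = Dom C s" "Cod C t2 = Dom C s"
    "Dom C r2 = Dom C s" "Cod C r2 = Dom C s2" "s2 \<cdot> r2 = Ide C (Dom C s)" "t2 \<cdot> r2 = Ide C (Dom C s)"
    using path_structureD(1-10)[OF st2] by simp_all
  have [simp]: "p \<in> Mor C" "q \<in> Mor C" "Dom C q = Dom C p" "Cod C p = Dom C s" "Cod C q = Dom C s"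
    using pullbackD(1-5)[OF kp] by simp_all
  note [simp] = k k'(1,2)
  \<comment> \<open>\<open>h\<close> pairs \<open>r \<cdot> s\<close> with the identity, so its
    pullback \<open>q3\<close> is the type, over \<open>z\<close> in the path space of
    \<open>f\<close>, of paths from \<open>r (s z)\<close> to \<open>z\<close> in that path
    space.\<close>
  obtain h where h [simp]: "h \<in> Mor C" "Dom C h = Dom C s" "Cod C h = Dom C p" and h': "p \<cdot> h = r \<cdot> s" "q \<cdot> h = Ide C (Dom C s)"
    by (rule pullback_lift[OF kp, of "r \<cdot> s" "Ide C (Dom C s)"]) simp_all
  obtain p3 q3 where q3: "q3 \<in> fib" and pb3: "pullback C k h p3 q3"
    by (rule fib_pullback_obtain[of k h]) simp_all
  note [simp] = pullbackD(1-5)[OF pb3] q3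
  have "k \<cdot> (r2 \<cdot> r) = h \<cdot> r"
    by (rule pullback_eqI[OF kp])
      (simp_all add: comp_reduce[OF k'(3)] comp_reduce[OF k'(4)] comp_reduce[OF h'(1)] comp_reduce[OF h'(2)]
        comp_reduce[OF \<open>s2 \<cdot> r2 = _\<close>] comp_reduce[OF \<open>t2 \<cdot> r2 = _\<close>])
  then obtain d where d: "d \<in> Mor C" "Dom C d = Dom C r" "Cod C d = Dom C p3" "p3 \<cdot> d = r2 \<cdot> r" "q3 \<cdot> d = r"
    using pullback_lift[OF pb3, of "r2 \<cdot> r" r] by auto
  obtain j where j [simp]: "j \<in> Mor C" "Dom C j = Dom C s" "Cod C j = Dom C q3" and qj: "q3 \<cdot> j = Ide C (Dom C s)"
    by (rule path_structure_elim[OF st q3, of d]) (use d in simp_all)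
  have kj: "k \<cdot> (p3 \<cdot> j) = h"
    using comp_reduce[OF pullbackD(6)[OF pb3], of j] qj by simp
  have "s2 \<cdot> (p3 \<cdot> j) = r \<cdot> s"
    using arg_cong[OF kj, of "\<lambda>z. p \<cdot> z"] by (simp add: comp_reduce[OF k'(3)] h')
  moreover have "t2 \<cdot> (p3 \<cdot> j) = Ide C (Dom C s)"
    using arg_cong[OF kj, of "\<lambda>z. q \<cdot> z"] by (simp add: comp_reduce[OF k'(4)] h')
  ultimately have "homotopic (bang (Dom C s)) (r \<cdot> s) (Ide C (Dom C s))"
    unfolding homotopic_def using st2
    by (intro exI[of _ s2] exI[of _ t2] exI[of _ r2] bexI[of _ "p3 \<cdot> j"]) simp_all
  then have "r \<cdot> s \<simeq> Ide C (Cod C r)" by (simp add: heq_def)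
  then show ?thesis by (intro weqI[of r s]) (simp_all add: heq_refl)
qed

lemma product_pullback:
  assumes "product C X Y P p q"
  shows "pullback C (bang X) (bang Y) p q"
proof -
  have [simp]: "p \<in> Mor C" "q \<in> Mor C" "Dom C p = P" "Dom C q = P" "Cod C p = X" "Cod C q = Y"
    using assms by (auto simp: product_def hom_iff)
  have [simp]: "X \<in> Obj C" "Y \<in> Obj C" "P \<in> Obj C"
    using Obj_simps[of p] Obj_simps[of q] by simp_all
  have "\<exists>!h. h \<in> hom C Z P \<and> p \<cdot> h = a \<and> q \<cdot> h = b" if "a \<in> hom C Z X" "b \<in> hom C Z Y" for Z a b
    using assms that unfolding product_def by blast
  then show ?thesis
    unfolding pullback_def
    by (intro exI[of _ P] conjI allI ballI impI) (simp_all add: hom_iff[of p] hom_iff[of q])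
qed

lemma pullback_product:
  assumes "pullback C (bang X) (bang Y) p q" and [simp]: "X \<in> Obj C" "Y \<in> Obj C"
  shows "product C X Y (Dom C p) p q"
proof -
  note pb = pullbackD[OF assms(1)]
  have "\<exists>!h. h \<in> hom C Z (Dom C p) \<and> p \<cdot> h = a \<and> q \<cdot> h = b" if "a \<in> hom C Z X" "b \<in> hom C Z Y" for Z a b
  proof -
    have "bang X \<cdot> a = bang Y \<cdot> b" using that by (simp add: hom_iff)
    then show ?thesis
      using pullback_ex1[OF assms(1), of a b] that by (simp add: hom_iff conj_assoc)
  qed
  then show ?thesis using pb by (auto simp: product_def hom_iff[of p] hom_iff[of q])
qed

theorem path_category_weq_fib: "path_category C weq fib"
proof
  show "weq \<subseteq> Mor C" by (auto simp: weq_def)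
  show "fib \<subseteq> Mor C" by auto
  show "f \<in> fib" "f \<in> weq" if "iso C f" for f
    using that iso_in_fib iso_in_weq by (auto simp: iso_iff)
  show "g \<cdot> f \<in> fib" if "f \<in> fib" "g \<in> fib" "Cod C f = Dom C g" for f g
    using that by (rule fib_comp)
  show "\<exists>p q. pullback C f g p q" if "f \<in> fib" "g \<in> Mor C" "Cod C f = Cod C g" for f g
    using fib_pullback_exists[OF that] by blast
  show "q \<in> fib" if "f \<in> fib" "g \<in> Mor C" "Cod C f = Cod C g" "pullback C f g p q" for f g p q
    using that by (rule fib_pullback)
  show "\<exists>Z. terminal C Z" using one(1) by blast
  \<comment> \<open>Fibrancy is known over the chosen object \<open>one\<close>. Any other terminal
    object is isomorphic to it, and \<open>f\<close> factors as the map to \<open>one\<close>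
    followed by this isomorphism.\<close>
  show "f \<in> fib" if Z: "terminal C Z" and [simp]: "f \<in> Mor C" "Cod C f = Z" for Z f
  proof -
    have [simp]: "Z \<in> Obj C" using Z by (simp add: terminal_def)
    obtain g where g: "g \<in> hom C one Z" using Z one(1) by (auto simp: terminal_def)
    then have [simp]: "g \<in> Mor C" "Dom C g = one" "Cod C g = Z" by (simp_all add: hom_iff)
    have [simp]: "one \<in> Obj C" using one(1) by (simp add: terminal_def)
    have Z_unique: "h = k" if "h \<in> hom C X Z" "k \<in> hom C X Z" "X \<in> Obj C" for h k X
      using Z that unfolding terminal_def by blast
    have "inverse_pair g (bang Z)"
      unfolding inverse_pair_def using Z_unique[of "g \<cdot> bang Z" Z "Ide C Z"]
      by (auto simp: hom_iff intro: one_unique)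
    then have "g \<in> fib" by (rule iso_in_fib)
    then have "g \<cdot> bang (Dom C f) \<in> fib" by (intro fib_comp) simp_all
    also have "g \<cdot> bang (Dom C f) = f"
      by (rule Z_unique[of _ "Dom C f"]) (simp_all add: hom_iff)
    finally show ?thesis .
  qed
  show "f \<in> weq \<and> g \<in> weq \<and> h \<in> weq \<and> h \<cdot> g \<cdot> f \<in> weq"
    if fgh: "f \<in> hom C X Y" "g \<in> hom C Y Z" "h \<in> hom C Z U" "g \<cdot> f \<in> weq" "h \<cdot> g \<in> weq" for f g h X Y Z U
  proof -
    have *: "f \<in> weq" "g \<in> weq" "h \<in> weq"
      using weq_two_out_of_six[of f g h] fgh by (auto simp: hom_iff)
    have "h \<cdot> g \<cdot> f \<in> weq"
      using fgh * by (intro weq_comp) (auto simp: hom_iff)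
    with * show ?thesis by blast
  qed
  show "\<exists>P p q. product C B B P p q" if B: "B \<in> Obj C" for B
  proof -
    obtain p q where "pullback C (bang B) (bang B) p q"
      using fib_pullback_exists[of "bang B" "bang B"] B by auto
    then show ?thesis using pullback_product B by blast
  qed
  show "\<exists>PB. \<exists>r \<in> hom C B PB \<inter> weq. \<exists>st \<in> hom C PB P \<inter> fib. st \<cdot> r = \<delta>"
    if prod: "product C B B P p q" and \<delta>: "\<delta> \<in> hom C B P" "p \<cdot> \<delta> = Ide C B" "q \<cdot> \<delta> = Ide C B" for B P p q \<delta>
  proof -
    have B [simp]: "B \<in> Obj C" using \<delta>(1) Obj_simps(1)[of \<delta>] by (auto simp: hom_iff)
    have pb: "pullback C (bang B) (bang B) p q" using prod by (rule product_pullback)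
    obtain s t r where st: "path_structure fib (bang B) s t r"
      by (rule path_structure_exists[of "bang B"]) simp_all
    obtain p' q' k where k: "k \<in> fib" "pullback C (bang B) (bang B) p' q'" "Dom C k = Dom C s" "Cod C k = Dom C p'"
      "p' \<cdot> k = s" "q' \<cdot> k = t"
      using path_structure_kernel[OF st] by metis
    have [simp]: "s \<in> Mor C" "t \<in> Mor C" "r \<in> Mor C" "Dom C t = Dom C s" "Cod C s = B" "Cod C t = B"
      "Dom C r = B" "Cod C r = Dom C s" "s \<cdot> r = Ide C B" "t \<cdot> r = Ide C B"
      using path_structureD(1-10)[OF st] by simp_all
    note [simp] = pullbackD(1-5)[OF k(2)] pullbackD(1-5)[OF pb] k(1,3,4)
    have [simp]: "Dom C p = P" "\<delta> \<in> Mor C" "Dom C \<delta> = B" "Cod C \<delta> = P"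
      using prod \<delta>(1) by (auto simp: product_def hom_iff)
    \<comment> \<open>The fibred square that comes with the path structure need not be the given
      product; \<phi> identifies the two.\<close>
    obtain \<phi> \<psi> where \<phi>: "inverse_pair \<phi> \<psi>" "Dom C \<phi> = Dom C p'" "Cod C \<phi> = Dom C p" "p \<cdot> \<phi> = p'" "q \<cdot> \<phi> = q'"
      by (rule pullback_unique[OF k(2) pb]) simp_all
    note [simp] = inverse_pairD(1)[OF \<phi>(1)] \<phi>(2,3)
    have "\<phi> \<cdot> k \<in> fib"
      using iso_in_fib[OF \<phi>(1)] by (intro fib_comp) simp_all
    moreover have "\<phi> \<cdot> k \<cdot> r = \<delta>"
      by (rule pullback_eqI[OF pb])
        (simp_all add: comp_reduce[OF \<phi>(4)] comp_reduce[OF \<phi>(5)] comp_reduce[OF k(5)] comp_reduce[OF k(6)] \<delta>)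
    moreover have "r \<in> weq" by (rule path_structure_refl_weq[OF st]) simp
    ultimately show ?thesis
      by (intro exI[of _ "Dom C s"] bexI[of _ r] bexI[of _ "\<phi> \<cdot> k"]) (simp_all add: hom_iff)
  qed
  show "\<exists>s \<in> hom C (Cod C f) (Dom C f). f \<cdot> s = Ide C (Cod C f)" if "f \<in> weq \<inter> fib" for f
    using acyclic_section[of f] that by (metis IntD1 IntD2 hom_iff)
  show "\<exists>p q. pullback C f g p q" if "f \<in> weq \<inter> fib" "g \<in> Mor C" "Cod C f = Cod C g" for f g
    using fib_pullback_exists[of f g] that by blast
  show "q \<in> weq \<inter> fib" if "f \<in> weq \<inter> fib" "g \<in> Mor C" "Cod C f = Cod C g" "pullback C f g p q" for f g p q
    using acyclic_pullback[of f g p q] fib_pullback[of f g p q] that by blast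
qed

end

section \<open>The classifying category\<close>

locale theory_of_types =
  fixes T :: "'k type_theory"
  assumes stable: "dependent_type_theory T"
begin

lemma congruence_substitution:
  assumes "derivable T \<Gamma> J" "wf_ctx T \<Theta>" "sub_pair T \<Theta> \<sigma> \<tau> \<Gamma>"
  shows "derivable T \<Theta> (the (equate (judg_subst \<sigma> J) (judg_subst \<tau> J)))"
  using derivable_good[OF stable assms(1)] assms(2,3) unfolding subst_good_def by blast

lemma EqType_subst:
  "derivable T \<Gamma> (IsType A) \<Longrightarrow> wf_ctx T \<Theta> \<Longrightarrow> sub_pair T \<Theta> \<sigma> \<tau> \<Gamma> \<Longrightarrow>
    derivable T \<Theta> (EqType (subst \<sigma> A) (subst \<tau> A))"
  using congruence_substitution[of \<Gamma> "IsType A"] by simp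

lemma EqTerm_subst:
  "derivable T \<Gamma> (HasType a A) \<Longrightarrow> wf_ctx T \<Theta> \<Longrightarrow> sub_pair T \<Theta> \<sigma> \<tau> \<Gamma> \<Longrightarrow>
    derivable T \<Theta> (EqTerm (subst \<sigma> a) (subst \<tau> a) (subst \<sigma> A))"
  using congruence_substitution[of \<Gamma> "HasType a A"] by simp

lemma EqTerm_conv: "derivable T \<Gamma> (EqTerm a b A) \<Longrightarrow> derivable T \<Gamma> (HasType a A) \<and> derivable T \<Gamma> (HasType b A)"
  using derivable_presup[of T \<Gamma> "EqTerm a b A"] by simp

text \<open>With congruence at hand, the typing of \<tau> follows from that of \<sigma> and the
  equality, by conversion one variable at a time.\<close>

lemma sub_pairI:
  assumes "wf_ctx T \<Theta>" "wf_ctx T \<Gamma>" "sub_ok T \<Theta> \<sigma> \<Gamma>" "sub_eq T \<Theta> \<sigma> \<tau> \<Gamma>"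
  shows "sub_pair T \<Theta> \<sigma> \<tau> \<Gamma>"
  using assms(2-)
proof (induction \<Gamma> arbitrary: \<sigma> \<tau>)
  case (Cons A \<Gamma>)
  then have pair: "sub_pair T \<Theta> (\<lambda>i. \<sigma> (Suc i)) (\<lambda>i. \<tau> (Suc i)) \<Gamma>" and A: "derivable T \<Gamma> (IsType A)"
    by (simp_all add: wf_ctx_Cons)
  have "derivable T \<Theta> (HasType (\<tau> 0) (subst (\<lambda>i. \<sigma> (Suc i)) A))"
    using Cons.prems(3) by (auto dest: EqTerm_conv)
  then have "derivable T \<Theta> (HasType (\<tau> 0) (subst (\<lambda>i. \<tau> (Suc i)) A))"
    using EqType_subst[OF A assms(1) pair] by (rule conversion)
  then show ?case using Cons.prems pair by (simp add: sub_pair_Cons)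
qed simp

lemma sub_pair_sym:
  assumes "wf_ctx T \<Theta>" "wf_ctx T \<Gamma>" "sub_pair T \<Theta> \<sigma> \<tau> \<Gamma>"
  shows "sub_pair T \<Theta> \<tau> \<sigma> \<Gamma>"
  using assms(2-)
proof (induction \<Gamma> arbitrary: \<sigma> \<tau>)
  case (Cons A \<Gamma>)
  then have pair: "sub_pair T \<Theta> (\<lambda>i. \<sigma> (Suc i)) (\<lambda>i. \<tau> (Suc i)) \<Gamma>" and A: "derivable T \<Gamma> (IsType A)"
    by (simp_all add: wf_ctx_Cons sub_pair_Cons)
  have "derivable T \<Theta> (EqTerm (\<tau> 0) (\<sigma> 0) (subst (\<lambda>i. \<sigma> (Suc i)) A))"
    using Cons.prems(2) by (simp add: sub_pair_Cons term_sym)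
  then have "derivable T \<Theta> (EqTerm (\<tau> 0) (\<sigma> 0) (subst (\<lambda>i. \<tau> (Suc i)) A))"
    using EqType_subst[OF A assms(1) pair] by (rule conversion_eq)
  then show ?case using Cons pair by (simp add: sub_pair_Cons wf_ctx_Cons)
qed simp

lemma sub_pair_trans:
  assumes "wf_ctx T \<Theta>" "wf_ctx T \<Gamma>" "sub_pair T \<Theta> \<sigma> \<tau> \<Gamma>" "sub_pair T \<Theta> \<tau> \<upsilon> \<Gamma>"
  shows "sub_pair T \<Theta> \<sigma> \<upsilon> \<Gamma>"
  using assms(2-)
proof (induction \<Gamma> arbitrary: \<sigma> \<tau> \<upsilon>)
  case (Cons A \<Gamma>)
  then have "sub_pair T \<Theta> (\<lambda>i. \<sigma> (Suc i)) (\<lambda>i. \<tau> (Suc i)) \<Gamma>" "wf_ctx T \<Gamma>" and A: "derivable T \<Gamma> (IsType A)"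
    by (simp_all add: wf_ctx_Cons sub_pair_Cons)
  then have pair: "sub_pair T \<Theta> (\<lambda>i. \<tau> (Suc i)) (\<lambda>i. \<sigma> (Suc i)) \<Gamma>"
    using sub_pair_sym[OF assms(1)] by blast
  have "derivable T \<Theta> (EqTerm (\<tau> 0) (\<upsilon> 0) (subst (\<lambda>i. \<tau> (Suc i)) A))"
    using Cons.prems by (simp add: sub_pair_Cons)
  then have "derivable T \<Theta> (EqTerm (\<tau> 0) (\<upsilon> 0) (subst (\<lambda>i. \<sigma> (Suc i)) A))"
    using EqType_subst[OF A assms(1) pair] by (rule conversion_eq)
  moreover have "derivable T \<Theta> (EqTerm (\<sigma> 0) (\<tau> 0) (subst (\<lambda>i. \<sigma> (Suc i)) A))"
    using Cons.prems by (simp add: sub_pair_Cons)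
  ultimately have "derivable T \<Theta> (EqTerm (\<sigma> 0) (\<upsilon> 0) (subst (\<lambda>i. \<sigma> (Suc i)) A))"
    by (blast intro: term_trans)
  moreover have "sub_pair T \<Theta> (\<lambda>i. \<sigma> (Suc i)) (\<lambda>i. \<upsilon> (Suc i)) \<Gamma>"
    using Cons.prems Cons.IH[of "\<lambda>i. \<sigma> (Suc i)" "\<lambda>i. \<tau> (Suc i)" "\<lambda>i. \<upsilon> (Suc i)"] by (simp add: sub_pair_Cons wf_ctx_Cons)
  ultimately show ?case using Cons.prems by (simp add: sub_pair_Cons)
qed simp

lemma sub_ok_comp:
  assumes "wf_ctx T \<Theta>" "sub_ok T \<Theta> \<sigma> \<Delta>" "sub_ok T \<Delta> \<tau> \<Gamma>"
  shows "sub_ok T \<Theta> (\<lambda>i. subst \<sigma> (\<tau> i)) \<Gamma>"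
  using assms(3)
proof (induction \<Gamma> arbitrary: \<tau>)
  case (Cons A \<Gamma>)
  then show ?case
    using simultaneous_substitution[OF _ assms(1,2), of "HasType (\<tau> 0) (subst (\<lambda>i. \<tau> (Suc i)) A)"]
    by (simp add: subst_subst)
qed simp

lemma sub_eq_comp_left:
  assumes "wf_ctx T \<Theta>" "sub_ok T \<Theta> \<sigma> \<Delta>" "sub_eq T \<Delta> \<tau> \<tau>' \<Gamma>"
  shows "sub_eq T \<Theta> (\<lambda>i. subst \<sigma> (\<tau> i)) (\<lambda>i. subst \<sigma> (\<tau>' i)) \<Gamma>"
  using assms(3)
proof (induction \<Gamma> arbitrary: \<tau> \<tau>')
  case (Cons A \<Gamma>)
  then show ?case
    using simultaneous_substitution[OF _ assms(1,2), of "EqTerm (\<tau> 0) (\<tau>' 0) (subst (\<lambda>i. \<tau> (Suc i)) A)"]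
    by (simp add: subst_subst)
qed simp

lemma sub_eq_comp_right:
  assumes "wf_ctx T \<Theta>" "sub_pair T \<Theta> \<sigma> \<sigma>' \<Delta>" "sub_ok T \<Delta> \<tau> \<Gamma>"
  shows "sub_eq T \<Theta> (\<lambda>i. subst \<sigma> (\<tau> i)) (\<lambda>i. subst \<sigma>' (\<tau> i)) \<Gamma>"
  using assms(3)
proof (induction \<Gamma> arbitrary: \<tau>)
  case (Cons A \<Gamma>)
  then show ?case
    using EqTerm_subst[OF _ assms(1,2), of "\<tau> 0" "subst (\<lambda>i. \<tau> (Suc i)) A"]
    by (simp add: subst_subst)
qed simp

text \<open>The two factors are changed one after the other: changing \<tau> is substitution into
  equations, changing \<sigma> is congruence of substitution.\<close>

lemma sub_pair_comp:
  assumes wf: "wf_ctx T \<Theta>" "wf_ctx T \<Gamma>" and "sub_pair T \<Theta> \<sigma> \<sigma>' \<Delta>" "sub_pair T \<Delta> \<tau> \<tau>' \<Gamma>"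
  shows "sub_pair T \<Theta> (\<lambda>i. subst \<sigma> (\<tau> i)) (\<lambda>i. subst \<sigma>' (\<tau>' i)) \<Gamma>"
proof (rule sub_pair_trans[OF wf])
  have ok: "sub_ok T \<Theta> \<sigma> \<Delta>" "sub_ok T \<Theta> \<sigma>' \<Delta>" "sub_ok T \<Delta> \<tau> \<Gamma>" "sub_ok T \<Delta> \<tau>' \<Gamma>"
    "sub_eq T \<Delta> \<tau> \<tau>' \<Gamma>"
    using assms by (simp_all add: sub_pair_def)
  show "sub_pair T \<Theta> (\<lambda>i. subst \<sigma> (\<tau> i)) (\<lambda>i. subst \<sigma> (\<tau>' i)) \<Gamma>"
    using wf ok by (simp add: sub_pair_def sub_ok_comp sub_eq_comp_left)
  show "sub_pair T \<Theta> (\<lambda>i. subst \<sigma> (\<tau>' i)) (\<lambda>i. subst \<sigma>' (\<tau>' i)) \<Gamma>"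
    unfolding sub_pair_def using wf ok sub_ok_comp[of \<Theta> _ \<Delta> \<tau>'] sub_eq_comp_right[OF wf(1) assms(3) ok(4)] by blast
qed

lemma sub_pair_cong:
  assumes "wf_ctx T \<Gamma>" "\<And>i. i < length \<Gamma> \<Longrightarrow> \<sigma> i = \<sigma>' i" "\<And>i. i < length \<Gamma> \<Longrightarrow> \<tau> i = \<tau>' i" "sub_pair T \<Theta> \<sigma> \<tau> \<Gamma>"
  shows "sub_pair T \<Theta> \<sigma>' \<tau>' \<Gamma>"
  using assms
proof (induction \<Gamma> arbitrary: \<sigma> \<tau> \<sigma>' \<tau>')
  case (Cons A \<Gamma>)
  have "subst (\<lambda>i. \<sigma> (Suc i)) A = subst (\<lambda>i. \<sigma>' (Suc i)) A" "subst (\<lambda>i. \<tau> (Suc i)) A = subst (\<lambda>i. \<tau>' (Suc i)) A"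
    using Cons.prems(1-3)
    by (auto intro!: subst_cong_scoped[of "length \<Gamma>"] simp: wf_ctx_Cons dest: derivable_scoped)
  moreover have "\<sigma> 0 = \<sigma>' 0" "\<tau> 0 = \<tau>' 0" using Cons.prems(2,3)[of 0] by simp_all
  ultimately show ?case
    using Cons.prems Cons.IH[of "\<lambda>i. \<sigma> (Suc i)" "\<lambda>i. \<sigma>' (Suc i)" "\<lambda>i. \<tau> (Suc i)" "\<lambda>i. \<tau>' (Suc i)"]
    by (simp add: wf_ctx_Cons sub_pair_Cons)
qed simp

section \<open>Contexts and morphisms up to definitional equality\<close>

lemma ctx_eq_Nil [simp]: "([], \<Gamma>') \<in> ctx_eq T \<longleftrightarrow> \<Gamma>' = []"
  by (auto simp: ctx_eq_def)

lemma ctx_eq_Cons: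
  "(A # \<Gamma>, A' # \<Gamma>') \<in> ctx_eq T \<longleftrightarrow> (\<Gamma>, \<Gamma>') \<in> ctx_eq T \<and> derivable T \<Gamma> (IsType A) \<and> derivable T \<Gamma>' (IsType A') \<and>
     derivable T \<Gamma> (EqType A A')"
  by (auto simp: ctx_eq_def wf_ctx_Cons less_Suc_eq_0_disj)

lemma ctx_eqD: "(\<Gamma>, \<Gamma>') \<in> ctx_eq T \<Longrightarrow> wf_ctx T \<Gamma> \<and> wf_ctx T \<Gamma>' \<and> length \<Gamma>' = length \<Gamma>"
  by (simp add: ctx_eq_def)

lemma ctx_eq_refl: "wf_ctx T \<Gamma> \<Longrightarrow> (\<Gamma>, \<Gamma>) \<in> ctx_eq T"
  by (auto simp: ctx_eq_def wf_ctx_def type_refl)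

text \<open>\<open>ctx_eq\<close> compares types over the first context only. Once the identity is a
  morphism between the two contexts, whole derivations move across by \<open>ctx_conv\<close>, and
  this is what makes \<open>ctx_eq\<close> symmetric and transitive.\<close>

lemma ctx_eq_sub_ok: "(\<Gamma>, \<Gamma>') \<in> ctx_eq T \<Longrightarrow> sub_ok T \<Gamma>' Var \<Gamma>"
proof (induction \<Gamma> arbitrary: \<Gamma>')
  case (Cons A \<Gamma>)
  then obtain A' \<Delta> where [simp]: "\<Gamma>' = A' # \<Delta>" by (cases \<Gamma>') (auto dest: ctx_eqD)
  have *: "(\<Gamma>, \<Delta>) \<in> ctx_eq T" "derivable T \<Gamma> (IsType A)" "derivable T \<Delta> (IsType A')" "derivable T \<Gamma> (EqType A A')"
    using Cons.prems by (simp_all add: ctx_eq_Cons)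
  note ok = Cons.IH[OF *(1)]
  have "derivable T \<Delta> (EqType A' A)"
    using simultaneous_substitution[OF *(4) _ ok] ctx_eqD[OF *(1)] by (simp add: type_sym)
  then have "derivable T \<Gamma>' (HasType (Var 0) (subst wk A))"
    using weaken1[of T \<Delta> "EqType A' A" A'] variable[OF *(3)] *(3) by (auto intro: conversion)
  moreover have "sub_ok T \<Gamma>' (\<lambda>i. Var (Suc i)) \<Gamma>"
    using sub_pair_weaken[of T \<Delta> Var Var \<Gamma> A'] ok *(3) by (simp add: sub_pair_refl wk_def)
  ultimately show ?case by (simp add: wk_def[abs_def])
qed simp

lemma ctx_conv: "derivable T \<Gamma> J \<Longrightarrow> (\<Gamma>, \<Gamma>') \<in> ctx_eq T \<Longrightarrow> derivable T \<Gamma>' J"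
  using simultaneous_substitution[of T \<Gamma> J \<Gamma>' Var] ctx_eq_sub_ok ctx_eqD by auto

lemma ctx_eq_sym: "(\<Gamma>, \<Gamma>') \<in> ctx_eq T \<Longrightarrow> (\<Gamma>', \<Gamma>) \<in> ctx_eq T"
proof (induction \<Gamma> arbitrary: \<Gamma>')
  case (Cons A \<Gamma>)
  then obtain A' \<Delta> where "\<Gamma>' = A' # \<Delta>" by (cases \<Gamma>') (auto dest: ctx_eqD)
  then show ?case using Cons ctx_conv[of \<Gamma> "EqType A A'" \<Delta>] by (auto simp: ctx_eq_Cons type_sym)
qed simp

lemma ctx_eq_trans: "(\<Gamma>, \<Gamma>') \<in> ctx_eq T \<Longrightarrow> (\<Gamma>', \<Gamma>'') \<in> ctx_eq T \<Longrightarrow> (\<Gamma>, \<Gamma>'') \<in> ctx_eq T"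
proof (induction \<Gamma> arbitrary: \<Gamma>' \<Gamma>'')
  case (Cons A \<Gamma>)
  then obtain A' \<Delta> A'' \<Delta>' where *: "\<Gamma>' = A' # \<Delta>" "\<Gamma>'' = A'' # \<Delta>'"
    by (cases \<Gamma>'; cases \<Gamma>'') (auto dest: ctx_eqD)
  then have "derivable T \<Gamma> (EqType A' A'')"
    using Cons.prems ctx_conv[of \<Delta> "EqType A' A''" \<Gamma>] ctx_eq_sym by (simp add: ctx_eq_Cons)
  then show ?case using Cons * by (auto simp: ctx_eq_Cons intro: type_trans)
qed auto

lemma equiv_ctx_eq: "equiv {\<Gamma>. wf_ctx T \<Gamma>} (ctx_eq T)"
  by (rule equivI) (auto simp: refl_on_def sym_def trans_def ctx_eq_refl ctx_eqD
      dest: ctx_eqD intro: ctx_eq_sym ctx_eq_trans)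

lemma sub_pair_conv_dom: "sub_pair T \<Theta> \<sigma> \<tau> \<Gamma> \<Longrightarrow> (\<Theta>, \<Theta>') \<in> ctx_eq T \<Longrightarrow> sub_pair T \<Theta>' \<sigma> \<tau> \<Gamma>"
  by (induction \<Gamma> arbitrary: \<sigma> \<tau>) (auto simp: sub_pair_Cons intro: ctx_conv)

lemma sub_pair_conv_cod:
  assumes "wf_ctx T \<Theta>"
  shows "sub_pair T \<Theta> \<sigma> \<tau> \<Gamma> \<Longrightarrow> (\<Gamma>, \<Gamma>') \<in> ctx_eq T \<Longrightarrow> sub_pair T \<Theta> \<sigma> \<tau> \<Gamma>'"
proof (induction \<Gamma> arbitrary: \<sigma> \<tau> \<Gamma>')
  case (Cons A \<Gamma>)
  then obtain A' \<Delta> where [simp]: "\<Gamma>' = A' # \<Delta>" by (cases \<Gamma>') (auto dest: ctx_eqD)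
  have pair: "sub_pair T \<Theta> (\<lambda>i. \<sigma> (Suc i)) (\<lambda>i. \<tau> (Suc i)) \<Gamma>" and *: "(\<Gamma>, \<Delta>) \<in> ctx_eq T" "derivable T \<Gamma> (EqType A A')"
    using Cons.prems by (auto simp: sub_pair_Cons ctx_eq_Cons)
  have eq: "derivable T \<Theta> (EqType (subst \<xi> A) (subst \<xi> A'))" if "sub_ok T \<Theta> \<xi> \<Gamma>" for \<xi>
    using simultaneous_substitution[OF *(2) assms that] by simp
  show ?case
    using Cons.IH[OF pair *(1)] Cons.prems(1) eq[of "\<lambda>i. \<sigma> (Suc i)"] eq[of "\<lambda>i. \<tau> (Suc i)"] pair
    unfolding sub_pair_def by (auto intro: conversion conversion_eq)
qed simp

lemma pre_mors_iff:
  "(\<Delta>, ts, \<Gamma>) \<in> pre_mors T \<longleftrightarrow> wf_ctx T \<Delta> \<and> wf_ctx T \<Gamma> \<and> length ts = length \<Gamma> \<and> sub_ok T \<Delta> (inst ts) \<Gamma>"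
proof -
  have "(\<forall>i < length \<Gamma>. derivable T \<Delta> (HasType (ts ! i) (subst (inst (drop (Suc i) ts)) (\<Gamma> ! i)))) \<longleftrightarrow> sub_ok T \<Delta> (inst ts) \<Gamma>"
    if "length ts = length \<Gamma>"
    using that by (induction ts \<Gamma> rule: list_induct2) (simp_all add: All_less_Suc2)
  then show ?thesis by (auto simp: pre_mors_def)
qed

text \<open>Conversion along equal contexts reduces the typing of the second sequence, over its own
  contexts, to typing over the first pair of contexts, so that a single \<open>sub_pair\<close>
  expresses everything about the terms.\<close>

lemma mor_eq_iff:
  "((\<Delta>, ts, \<Gamma>), (\<Delta>', ts', \<Gamma>')) \<in> mor_eq T \<longleftrightarrow> (\<Delta>, \<Delta>') \<in> ctx_eq T \<and> (\<Gamma>, \<Gamma>') \<in> ctx_eq T \<and>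
    length ts = length \<Gamma> \<and> length ts' = length \<Gamma> \<and> sub_pair T \<Delta> (inst ts) (inst ts') \<Gamma>"
proof -
  have eq: "(\<forall>i < length \<Gamma>. derivable T \<Delta> (EqTerm (ts ! i) (ts' ! i) (subst (inst (drop (Suc i) ts)) (\<Gamma> ! i)))) \<longleftrightarrow>
      sub_eq T \<Delta> (inst ts) (inst ts') \<Gamma>"
    if "length ts = length \<Gamma>" "length ts' = length \<Gamma>"
  proof -
    have "length ts = length ts'" "length ts' = length \<Gamma>" using that by simp_all
    then show ?thesis
      by (induction ts ts' \<Gamma> rule: list_induct3) (simp_all add: All_less_Suc2)
  qed
  have ok: "sub_ok T \<Delta>' (inst ts') \<Gamma>'" if "(\<Delta>, \<Delta>') \<in> ctx_eq T" "(\<Gamma>, \<Gamma>') \<in> ctx_eq T" "sub_pair T \<Delta> (inst ts) (inst ts') \<Gamma>"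
  proof -
    have "sub_pair T \<Delta> (inst ts') (inst ts') \<Gamma>"
      using that(3) by (simp add: sub_pair_def sub_eq_refl)
    then have "sub_pair T \<Delta>' (inst ts') (inst ts') \<Gamma>"
      using that(1) by (rule sub_pair_conv_dom)
    from sub_pair_conv_cod[OF _ this that(2)] ctx_eqD[OF that(1)] show ?thesis
      by (simp add: sub_pair_refl)
  qed
  show ?thesis
  proof
    assume *: "((\<Delta>, ts, \<Gamma>), (\<Delta>', ts', \<Gamma>')) \<in> mor_eq T"
    then have "length ts' = length \<Gamma>" by (auto simp: mor_eq_def pre_mors_iff dest: ctx_eqD)
    with * eq show "(\<Delta>, \<Delta>') \<in> ctx_eq T \<and> (\<Gamma>, \<Gamma>') \<in> ctx_eq T \<and>
      length ts = length \<Gamma> \<and> length ts' = length \<Gamma> \<and> sub_pair T \<Delta> (inst ts) (inst ts') \<Gamma>"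
      by (auto simp: mor_eq_def pre_mors_iff intro: sub_pairI)
  next
    assume *: "(\<Delta>, \<Delta>') \<in> ctx_eq T \<and> (\<Gamma>, \<Gamma>') \<in> ctx_eq T \<and>
      length ts = length \<Gamma> \<and> length ts' = length \<Gamma> \<and> sub_pair T \<Delta> (inst ts) (inst ts') \<Gamma>"
    then show "((\<Delta>, ts, \<Gamma>), (\<Delta>', ts', \<Gamma>')) \<in> mor_eq T"
      using ok eq ctx_eqD[of \<Delta> \<Delta>'] ctx_eqD[of \<Gamma> \<Gamma>'] by (auto simp: mor_eq_def pre_mors_iff sub_pair_def)
  qed
qed

lemma equiv_mor_eq: "equiv (pre_mors T) (mor_eq T)"
proof (rule equivI)
  show "mor_eq T \<subseteq> pre_mors T \<times> pre_mors T" by (auto simp: mor_eq_def)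
  show "refl_on (pre_mors T) (mor_eq T)"
    unfolding refl_on_def by (auto simp: mor_eq_iff pre_mors_iff sub_pair_refl ctx_eq_refl)
  show "sym (mor_eq T)"
  proof (rule symI)
    fix x y assume *: "(x, y) \<in> mor_eq T"
    obtain \<Delta> ts \<Gamma> \<Delta>' ts' \<Gamma>' where [simp]: "x = (\<Delta>, ts, \<Gamma>)" "y = (\<Delta>', ts', \<Gamma>')" by (cases x; cases y) auto
    have eqs: "(\<Delta>, \<Delta>') \<in> ctx_eq T" "(\<Gamma>, \<Gamma>') \<in> ctx_eq T" and pair: "sub_pair T \<Delta> (inst ts) (inst ts') \<Gamma>"
      using * by (simp_all add: mor_eq_iff)
    note wf = ctx_eqD[OF eqs(1)] ctx_eqD[OF eqs(2)]
    have "sub_pair T \<Delta>' (inst ts) (inst ts') \<Gamma>'"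
      using wf sub_pair_conv_cod[OF _ sub_pair_conv_dom[OF pair eqs(1)] eqs(2)] by blast
    then have "sub_pair T \<Delta>' (inst ts') (inst ts) \<Gamma>'"
      using wf sub_pair_sym by blast
    then show "(y, x) \<in> mor_eq T"
      using * wf ctx_eq_sym[OF eqs(1)] ctx_eq_sym[OF eqs(2)] by (simp add: mor_eq_iff)
  qed
  show "trans (mor_eq T)"
  proof (rule transI)
    fix x y z assume *: "(x, y) \<in> mor_eq T" "(y, z) \<in> mor_eq T"
    obtain \<Delta> ts \<Gamma> \<Delta>' ts' \<Gamma>' \<Delta>'' ts'' \<Gamma>'' where [simp]: "x = (\<Delta>, ts, \<Gamma>)" "y = (\<Delta>', ts', \<Gamma>')" "z = (\<Delta>'', ts'', \<Gamma>'')"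
      by (cases x; cases y; cases z) auto
    have eqs: "(\<Delta>, \<Delta>') \<in> ctx_eq T" "(\<Gamma>, \<Gamma>') \<in> ctx_eq T" "(\<Delta>', \<Delta>'') \<in> ctx_eq T" "(\<Gamma>', \<Gamma>'') \<in> ctx_eq T"
      and pair: "sub_pair T \<Delta> (inst ts) (inst ts') \<Gamma>" "sub_pair T \<Delta>' (inst ts') (inst ts'') \<Gamma>'"
      using * by (simp_all add: mor_eq_iff)
    note wf = ctx_eqD[OF eqs(1)] ctx_eqD[OF eqs(2)]
    have "sub_pair T \<Delta> (inst ts') (inst ts'') \<Gamma>"
      using wf sub_pair_conv_cod[OF _ sub_pair_conv_dom[OF pair(2) ctx_eq_sym[OF eqs(1)]] ctx_eq_sym[OF eqs(2)]] by blast
    then have "sub_pair T \<Delta> (inst ts) (inst ts'') \<Gamma>"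
      using wf pair(1) sub_pair_trans by blast
    then show "(x, z) \<in> mor_eq T"
      using * wf ctx_eq_trans[OF eqs(1,3)] ctx_eq_trans[OF eqs(2,4)] by (simp add: mor_eq_iff)
  qed
qed

lemma sub_pair_cong_iff:
  assumes "wf_ctx T \<Gamma>" "\<And>i. i < length \<Gamma> \<Longrightarrow> \<sigma> i = \<sigma>' i" "\<And>i. i < length \<Gamma> \<Longrightarrow> \<tau> i = \<tau>' i"
  shows "sub_pair T \<Theta> \<sigma> \<tau> \<Gamma> \<longleftrightarrow> sub_pair T \<Theta> \<sigma>' \<tau>' \<Gamma>"
  using sub_pair_cong[of \<Gamma> \<sigma> \<sigma>' \<tau> \<tau>' \<Theta>] sub_pair_cong[of \<Gamma> \<sigma>' \<sigma> \<tau>' \<tau> \<Theta>] assms by fastforce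

section \<open>Representation of morphisms by substitutions\<close>

definition arrow :: "'k ctx \<Rightarrow> (nat \<Rightarrow> 'k expr) \<Rightarrow> 'k ctx \<Rightarrow> bool" where
  "arrow \<Theta> \<sigma> \<Gamma> \<longleftrightarrow> wf_ctx T \<Theta> \<and> wf_ctx T \<Gamma> \<and> sub_ok T \<Theta> \<sigma> \<Gamma>"

definition ob :: "'k ctx \<Rightarrow> 'k ctx set" where
  "ob \<Gamma> = ctx_eq T `` {\<Gamma>}"

text \<open>Only the values of \<sigma> on the variables of \<open>\<Gamma>\<close> enter, so
  infinitely supported functions such as \<open>Var\<close> and \<open>wk\<close> can represent
  morphisms, and \<open>mor_Comp\<close> needs no list operations.\<close>

definition mor :: "'k ctx \<Rightarrow> (nat \<Rightarrow> 'k expr) \<Rightarrow> 'k ctx \<Rightarrow> 'k pre_mor set" where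
  "mor \<Theta> \<sigma> \<Gamma> = mor_eq T `` {(\<Theta>, map \<sigma> [0..<length \<Gamma>], \<Gamma>)}"

abbreviation Cl where "Cl \<equiv> classifying_category T"

lemma inst_map: "i < n \<Longrightarrow> inst (map \<sigma> [0..<n]) i = \<sigma> i"
  by (simp add: inst_def)

lemma map_inst: "length ts = n \<Longrightarrow> map (inst ts) [0..<n] = ts"
  by (rule nth_equalityI) (simp_all add: inst_def)

lemma arrowD: "arrow \<Theta> \<sigma> \<Gamma> \<Longrightarrow> wf_ctx T \<Theta> \<and> wf_ctx T \<Gamma> \<and> sub_ok T \<Theta> \<sigma> \<Gamma>"
  by (simp add: arrow_def)

lemma arrow_pre_mors: "arrow \<Theta> \<sigma> \<Gamma> \<Longrightarrow> (\<Theta>, map \<sigma> [0..<length \<Gamma>], \<Gamma>) \<in> pre_mors T"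
  by (auto simp: arrow_def pre_mors_iff inst_map intro: sub_ok_cong)

lemma ob_eq_iff: "wf_ctx T \<Gamma> \<Longrightarrow> wf_ctx T \<Gamma>' \<Longrightarrow> ob \<Gamma> = ob \<Gamma>' \<longleftrightarrow> (\<Gamma>, \<Gamma>') \<in> ctx_eq T"
  unfolding ob_def by (rule eq_equiv_class_iff[OF equiv_ctx_eq]) simp_all

lemma mor_mem:
  assumes "arrow \<Theta> \<sigma> \<Gamma>"
  shows "(\<Theta>', ts, \<Gamma>') \<in> mor \<Theta> \<sigma> \<Gamma> \<longleftrightarrow>
    (\<Theta>, \<Theta>') \<in> ctx_eq T \<and> (\<Gamma>, \<Gamma>') \<in> ctx_eq T \<and> length ts = length \<Gamma> \<and> sub_pair T \<Theta> \<sigma> (inst ts) \<Gamma>"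
proof -
  have "sub_pair T \<Theta> (inst (map \<sigma> [0..<length \<Gamma>])) (inst ts) \<Gamma> \<longleftrightarrow> sub_pair T \<Theta> \<sigma> (inst ts) \<Gamma>"
    by (rule sub_pair_cong_iff) (use assms in \<open>simp_all add: arrow_def inst_map\<close>)
  then show ?thesis by (simp add: mor_def mor_eq_iff)
qed

lemma mor_eqI:
  assumes "arrow \<Theta> \<sigma> \<Gamma>" "(\<Theta>, \<Theta>') \<in> ctx_eq T" "(\<Gamma>, \<Gamma>') \<in> ctx_eq T" "sub_pair T \<Theta> \<sigma> \<tau> \<Gamma>"
  shows "mor \<Theta> \<sigma> \<Gamma> = mor \<Theta>' \<tau> \<Gamma>'"
  unfolding mor_def
proof (rule equiv_class_eq[OF equiv_mor_eq])
  have "sub_pair T \<Theta> \<sigma> (inst (map \<tau> [0..<length \<Gamma>'])) \<Gamma>"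
    by (rule sub_pair_cong[OF _ _ _ assms(4)]) (use ctx_eqD[OF assms(3)] in \<open>simp_all add: inst_map\<close>)
  then show "((\<Theta>, map \<sigma> [0..<length \<Gamma>], \<Gamma>), \<Theta>', map \<tau> [0..<length \<Gamma>'], \<Gamma>') \<in> mor_eq T"
    using assms ctx_eqD[OF assms(3)] mor_mem[OF assms(1)] by (auto simp: mor_def)
qed

lemma mor_self: "arrow \<Theta> \<sigma> \<Gamma> \<Longrightarrow> (\<Theta>, map \<sigma> [0..<length \<Gamma>], \<Gamma>) \<in> mor \<Theta> \<sigma> \<Gamma>"
  unfolding mor_def by (rule equiv_class_self[OF equiv_mor_eq arrow_pre_mors])

lemma mor_eq_arrow_iff:
  assumes "arrow \<Theta> \<sigma> \<Gamma>" "arrow \<Theta> \<tau> \<Gamma>"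
  shows "mor \<Theta> \<sigma> \<Gamma> = mor \<Theta> \<tau> \<Gamma> \<longleftrightarrow> sub_pair T \<Theta> \<sigma> \<tau> \<Gamma>"
proof
  assume "mor \<Theta> \<sigma> \<Gamma> = mor \<Theta> \<tau> \<Gamma>"
  moreover have "(\<Theta>, map \<tau> [0..<length \<Gamma>], \<Gamma>) \<in> mor \<Theta> \<tau> \<Gamma>"
    using assms(2) by (rule mor_self)
  ultimately have "sub_pair T \<Theta> \<sigma> (inst (map \<tau> [0..<length \<Gamma>])) \<Gamma>"
    using mor_mem[OF assms(1)] by simp
  then show "sub_pair T \<Theta> \<sigma> \<tau> \<Gamma>"
    by (rule sub_pair_cong[rotated 3]) (use assms in \<open>simp_all add: arrow_def inst_map\<close>)
next
  assume "sub_pair T \<Theta> \<sigma> \<tau> \<Gamma>"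
  then show "mor \<Theta> \<sigma> \<Gamma> = mor \<Theta> \<tau> \<Gamma>"
    using assms by (intro mor_eqI) (auto simp: arrow_def ctx_eq_refl)
qed

lemma Mor_Cl: "Mor Cl = pre_mors T // mor_eq T"
  and Obj_Cl: "Obj Cl = {\<Gamma>. wf_ctx T \<Gamma>} // ctx_eq T"
  by (simp_all add: classifying_category_def)

lemma mor_Mor [simp]: "arrow \<Theta> \<sigma> \<Gamma> \<Longrightarrow> mor \<Theta> \<sigma> \<Gamma> \<in> Mor Cl"
  unfolding Mor_Cl mor_def by (intro quotientI arrow_pre_mors)

lemma ob_Obj [simp]: "wf_ctx T \<Gamma> \<Longrightarrow> ob \<Gamma> \<in> Obj Cl"
  unfolding Obj_Cl ob_def by (intro quotientI) simp

lemma Obj_cases: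
  assumes "X \<in> Obj Cl"
  obtains \<Gamma> where "wf_ctx T \<Gamma>" "X = ob \<Gamma>"
  using assms unfolding Obj_Cl ob_def by (auto elim: quotientE)

lemma sub_pair_map:
  assumes "arrow \<Theta> \<sigma> \<Gamma>"
  shows "sub_pair T \<Theta> \<sigma> (inst (map \<sigma> [0..<length \<Gamma>])) \<Gamma>"
proof -
  have "sub_pair T \<Theta> \<sigma> \<sigma> \<Gamma>" using assms by (simp add: arrow_def sub_pair_refl)
  then show ?thesis
    by (rule sub_pair_cong[rotated 3]) (use assms in \<open>simp_all add: arrow_def inst_map\<close>)
qed

lemma mor_Dom [simp]:
  assumes "arrow \<Theta> \<sigma> \<Gamma>"
  shows "Dom Cl (mor \<Theta> \<sigma> \<Gamma>) = ob \<Theta>"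
proof -
  have "(\<Delta>, map \<sigma> [0..<length \<Gamma>], \<Gamma>) \<in> mor \<Theta> \<sigma> \<Gamma>" if "(\<Theta>, \<Delta>) \<in> ctx_eq T" for \<Delta>
    using that assms sub_pair_map[OF assms] unfolding mor_mem[OF assms] by (auto simp: arrow_def ctx_eq_refl)
  then have "{\<Delta>. \<exists>ts \<Gamma>'. (\<Delta>, ts, \<Gamma>') \<in> mor \<Theta> \<sigma> \<Gamma>} = ob \<Theta>"
    unfolding ob_def using mor_mem[OF assms] by blast
  then show ?thesis by (simp add: classifying_category_def)
qed

lemma mor_Cod [simp]:
  assumes "arrow \<Theta> \<sigma> \<Gamma>"
  shows "Cod Cl (mor \<Theta> \<sigma> \<Gamma>) = ob \<Gamma>"
proof -
  have "(\<Theta>, map \<sigma> [0..<length \<Gamma>], \<Delta>) \<in> mor \<Theta> \<sigma> \<Gamma>" if "(\<Gamma>, \<Delta>) \<in> ctx_eq T" for \<Delta>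
    using that assms sub_pair_map[OF assms] unfolding mor_mem[OF assms] by (auto simp: arrow_def ctx_eq_refl)
  then have "{\<Delta>. \<exists>\<Theta>' ts. (\<Theta>', ts, \<Delta>) \<in> mor \<Theta> \<sigma> \<Gamma>} = ob \<Gamma>"
    unfolding ob_def using mor_mem[OF assms] by blast
  then show ?thesis by (simp add: classifying_category_def)
qed

lemma Mor_cases:
  assumes "f \<in> Mor Cl"
  obtains \<Theta> \<sigma> \<Gamma> where "arrow \<Theta> \<sigma> \<Gamma>" "f = mor \<Theta> \<sigma> \<Gamma>"
proof -
  obtain \<Theta> ts \<Gamma> where *: "(\<Theta>, ts, \<Gamma>) \<in> pre_mors T" "f = mor_eq T `` {(\<Theta>, ts, \<Gamma>)}"
    using assms unfolding Mor_Cl by (auto elim: quotientE)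
  then have "arrow \<Theta> (inst ts) \<Gamma>" "f = mor \<Theta> (inst ts) \<Gamma>"
    by (simp_all add: arrow_def pre_mors_iff mor_def map_inst)
  with that show thesis by blast
qed

lemma Mor_rep:
  assumes "f \<in> Mor Cl" "Dom Cl f = ob \<Theta>" "Cod Cl f = ob \<Gamma>" "wf_ctx T \<Theta>" "wf_ctx T \<Gamma>"
  obtains \<sigma> where "arrow \<Theta> \<sigma> \<Gamma>" "f = mor \<Theta> \<sigma> \<Gamma>"
proof -
  obtain \<Theta>' \<sigma> \<Gamma>' where *: "arrow \<Theta>' \<sigma> \<Gamma>'" "f = mor \<Theta>' \<sigma> \<Gamma>'"
    using assms(1) by (rule Mor_cases)
  then have eqs: "(\<Theta>', \<Theta>) \<in> ctx_eq T" "(\<Gamma>', \<Gamma>) \<in> ctx_eq T"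
    using assms ob_eq_iff by (auto simp: arrow_def)
  have pair: "sub_pair T \<Theta>' \<sigma> \<sigma> \<Gamma>'" using * by (simp add: arrow_def sub_pair_refl)
  then have "sub_pair T \<Theta> \<sigma> \<sigma> \<Gamma>"
    using sub_pair_conv_cod[OF assms(4) sub_pair_conv_dom[OF pair eqs(1)] eqs(2)] by simp
  then have "arrow \<Theta> \<sigma> \<Gamma>" using assms by (simp add: arrow_def sub_pair_refl)
  then show thesis using that * mor_eqI[OF *(1) eqs pair] by simp
qed

lemma arrow_comp: "arrow \<Theta> \<sigma> \<Delta> \<Longrightarrow> arrow \<Delta> \<tau> \<Gamma> \<Longrightarrow> arrow \<Theta> (\<lambda>i. subst \<sigma> (\<tau> i)) \<Gamma>"
  by (auto simp: arrow_def sub_ok_comp)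

lemma arrow_Var: "wf_ctx T \<Gamma> \<Longrightarrow> arrow \<Gamma> Var \<Gamma>"
  by (simp add: arrow_def sub_ok_Var)

text \<open>\<open>Comp\<close> collects the composites of all representatives; by
  \<open>sub_pair_comp\<close> these are all equivalent to \<open>?e\<close>, so their class is that
  of \<open>?e\<close>.\<close>

lemma mor_Comp:
  assumes "arrow \<Theta> \<sigma> \<Delta>" "arrow \<Delta> \<tau> \<Gamma>"
  shows "Comp Cl (mor \<Delta> \<tau> \<Gamma>) (mor \<Theta> \<sigma> \<Delta>) = mor \<Theta> (\<lambda>i. subst \<sigma> (\<tau> i)) \<Gamma>"
proof -
  let ?S = "{(\<Theta>', map (subst (inst ts)) us, \<Gamma>') | \<Theta>' ts \<Delta>' us \<Gamma>'. (\<Theta>', ts, \<Delta>') \<in> mor \<Theta> \<sigma> \<Delta> \<and> (\<Delta>', us, \<Gamma>') \<in> mor \<Delta> \<tau> \<Gamma>}"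
  let ?e = "(\<Theta>, map (\<lambda>i. subst \<sigma> (\<tau> i)) [0..<length \<Gamma>], \<Gamma>)"
  have rel: "(?e, x) \<in> mor_eq T" if S: "x \<in> ?S" for x
  proof -
    obtain \<Theta>' ts \<Delta>' us \<Gamma>' where x: "x = (\<Theta>', map (subst (inst ts)) us, \<Gamma>')"
      and 1: "(\<Theta>', ts, \<Delta>') \<in> mor \<Theta> \<sigma> \<Delta>" and 2: "(\<Delta>', us, \<Gamma>') \<in> mor \<Delta> \<tau> \<Gamma>"
      using S by blast
    note 1 = 1[unfolded mor_mem[OF assms(1)]] and 2 = 2[unfolded mor_mem[OF assms(2)]]
    have wf: "wf_ctx T \<Theta>" "wf_ctx T \<Gamma>" using assms by (simp_all add: arrow_def)
    have "sub_pair T \<Theta> (\<lambda>i. subst \<sigma> (\<tau> i)) (\<lambda>i. subst (inst ts) (inst us i)) \<Gamma>"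
      using 1 2 wf by (intro sub_pair_comp) auto
    then have "sub_pair T \<Theta> (\<lambda>i. subst \<sigma> (\<tau> i)) (inst (map (subst (inst ts)) us)) \<Gamma>"
      by (rule sub_pair_cong[rotated 3]) (use 2 wf in \<open>simp_all add: inst_def\<close>)
    then have "x \<in> mor \<Theta> (\<lambda>i. subst \<sigma> (\<tau> i)) \<Gamma>"
      using 1 2 unfolding x mor_mem[OF arrow_comp[OF assms]] by simp
    then show ?thesis by (simp add: mor_def)
  qed
  \<comment> \<open>At least one composable pair of representatives is required, as otherwise the
    image would be empty.\<close>
  have "(\<Theta>, map \<sigma> [0..<length \<Delta>], \<Delta>) \<in> mor \<Theta> \<sigma> \<Delta>" "(\<Delta>, map \<tau> [0..<length \<Gamma>], \<Gamma>) \<in> mor \<Delta> \<tau> \<Gamma>"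
    using assms by (simp_all add: mor_self)
  then obtain x0 where "x0 \<in> ?S" by blast
  then have "mor_eq T `` ?S = mor_eq T `` {?e}"
    using rel equiv_class_eq[OF equiv_mor_eq rel] by blast
  then show ?thesis by (simp add: classifying_category_def mor_def)
qed

text \<open>\<open>Ide\<close> takes a union over all contexts of the class, but the identities of
  equal contexts form one and the same morphism.\<close>

lemma mor_Ide:
  assumes "wf_ctx T \<Gamma>"
  shows "Ide Cl (ob \<Gamma>) = mor \<Gamma> Var \<Gamma>"
proof -
  have "mor \<Gamma>' Var \<Gamma>' = mor \<Gamma> Var \<Gamma>" if "(\<Gamma>, \<Gamma>') \<in> ctx_eq T" for \<Gamma>'
    using mor_eqI[OF arrow_Var[OF assms] that that, of Var] sub_ok_Var[OF assms] by (simp add: sub_pair_refl)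
  then have "(\<Union>\<Gamma>'\<in>ob \<Gamma>. mor \<Gamma>' Var \<Gamma>') = (\<Union>\<Gamma>'\<in>ob \<Gamma>. mor \<Gamma> Var \<Gamma>)"
    by (intro SUP_cong) (simp_all add: ob_def)
  moreover have "\<Gamma> \<in> ob \<Gamma>" using assms by (simp add: ob_def ctx_eq_refl)
  ultimately have "(\<Union>\<Gamma>'\<in>ob \<Gamma>. mor \<Gamma>' Var \<Gamma>') = mor \<Gamma> Var \<Gamma>" by auto
  then show ?thesis by (simp add: classifying_category_def mor_def)
qed

lemma hom_Cl:
  "f \<in> hom Cl X Y \<longleftrightarrow> f \<in> Mor Cl \<and> Dom Cl f = X \<and> Cod Cl f = Y"
  by (simp add: hom_def)

lemma hom_cases:
  assumes "f \<in> hom Cl X Y"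
  obtains \<Theta> \<sigma> \<Gamma> where "arrow \<Theta> \<sigma> \<Gamma>" "f = mor \<Theta> \<sigma> \<Gamma>" "X = ob \<Theta>" "Y = ob \<Gamma>"
  using assms by (auto simp: hom_Cl elim!: Mor_cases)

lemma hom_rep:
  assumes "f \<in> hom Cl (ob \<Theta>) (ob \<Gamma>)" "wf_ctx T \<Theta>" "wf_ctx T \<Gamma>"
  obtains \<sigma> where "arrow \<Theta> \<sigma> \<Gamma>" "f = mor \<Theta> \<sigma> \<Gamma>"
  using assms by (auto simp: hom_Cl elim: Mor_rep)

lemma hom_extend:
  assumes "g \<in> hom Cl (ob \<Gamma>) Z" "wf_ctx T \<Gamma>"
  obtains \<tau> \<Delta> where "arrow \<Gamma> \<tau> \<Delta>" "g = mor \<Gamma> \<tau> \<Delta>" "Z = ob \<Delta>"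
proof -
  obtain \<Theta> \<sigma> \<Delta> where "arrow \<Theta> \<sigma> \<Delta>" "Z = ob \<Delta>"
    using assms(1) by (rule hom_cases)
  moreover from this assms obtain \<tau> where "arrow \<Gamma> \<tau> \<Delta>" "g = mor \<Gamma> \<tau> \<Delta>"
    using hom_rep[of g \<Gamma> \<Delta>] by (auto simp: arrow_def)
  ultimately show thesis using that by blast
qed

lemma category_Cl: "category Cl"
proof
  show "Dom Cl f \<in> Obj Cl" "Cod Cl f \<in> Obj Cl" if "f \<in> Mor Cl" for f
    using that by (auto simp: arrow_def elim!: Mor_cases)
  show "Ide Cl X \<in> hom Cl X X" if "X \<in> Obj Cl" for X
    using that by (auto simp: hom_Cl mor_Ide arrow_Var elim!: Obj_cases)
  fix f X Y assume "f \<in> hom Cl X Y"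
  then obtain \<Theta> \<sigma> \<Gamma> where f: "arrow \<Theta> \<sigma> \<Gamma>" "f = mor \<Theta> \<sigma> \<Gamma>" "X = ob \<Theta>" "Y = ob \<Gamma>" by (rule hom_cases)
  then have wf: "wf_ctx T \<Theta>" "wf_ctx T \<Gamma>" by (simp_all add: arrow_def)
  show "Comp Cl f (Ide Cl X) = f" "Comp Cl (Ide Cl Y) f = f"
    using f wf by (simp_all add: mor_Ide mor_Comp[OF arrow_Var] mor_Comp[OF _ arrow_Var])
  fix g Z assume "g \<in> hom Cl Y Z"
  then obtain \<tau> \<Delta> where g: "arrow \<Gamma> \<tau> \<Delta>" "g = mor \<Gamma> \<tau> \<Delta>" "Z = ob \<Delta>"
    using hom_extend[of g \<Gamma> Z] f wf by auto
  show "Comp Cl g f \<in> hom Cl X Z"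
    using f g by (simp add: mor_Comp hom_Cl arrow_comp)
  fix h U assume "h \<in> hom Cl Z U"
  then have "h \<in> hom Cl (ob \<Delta>) U" "wf_ctx T \<Delta>" using g by (simp_all add: arrow_def)
  then obtain \<upsilon> \<Xi> where h: "arrow \<Delta> \<upsilon> \<Xi>" "h = mor \<Delta> \<upsilon> \<Xi>" "U = ob \<Xi>"
    by (rule hom_extend)
  show "Comp Cl (Comp Cl h g) f = Comp Cl h (Comp Cl g f)"
    unfolding f(2) g(2) h(2) mor_Comp[OF f(1) g(1)] mor_Comp[OF g(1) h(1)]
      mor_Comp[OF f(1) arrow_comp[OF g(1) h(1)]] mor_Comp[OF arrow_comp[OF f(1) g(1)] h(1)]
    by (simp add: subst_subst)
qed

sublocale category Cl
  by (rule category_Cl)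

lemma arrow_Cons:
  "arrow \<Theta> \<sigma> (A # \<Gamma>) \<longleftrightarrow> arrow \<Theta> (\<lambda>i. \<sigma> (Suc i)) \<Gamma> \<and> derivable T \<Gamma> (IsType A) \<and>
     derivable T \<Theta> (HasType (\<sigma> 0) (subst (\<lambda>i. \<sigma> (Suc i)) A))"
  by (auto simp: arrow_def wf_ctx_Cons)

lemma arrow_subst: "derivable T \<Gamma> J \<Longrightarrow> arrow \<Theta> \<sigma> \<Gamma> \<Longrightarrow> derivable T \<Theta> (judg_subst \<sigma> J)"
  by (simp add: arrow_def simultaneous_substitution)

lemma arrow_wk: "wf_ctx T (A # \<Gamma>) \<Longrightarrow> arrow (A # \<Gamma>) wk \<Gamma>"
  using sub_ok_Var[of T "A # \<Gamma>"] by (simp add: arrow_def wf_ctx_Cons wk_def[abs_def])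

lemma arrow_inst: "derivable T \<Gamma> (HasType a A) \<Longrightarrow> arrow \<Gamma> (inst [a]) (A # \<Gamma>)"
  using derivable_wf[of T \<Gamma>] derivable_presup[of T \<Gamma> "HasType a A"]
  by (simp add: arrow_Cons arrow_Var)

lemma arrow_lift:
  assumes "arrow \<Theta> \<sigma> \<Gamma>" "wf_ctx T (\<Delta> @ \<Gamma>)"
  shows "arrow (ctx_subst \<sigma> \<Delta> @ \<Theta>) (lift (length \<Delta>) \<sigma>) (\<Delta> @ \<Gamma>)"
proof -
  have "ctx_good T (\<Delta> @ \<Gamma>)"
  proof (cases "\<Delta> @ \<Gamma>")
    case (Cons A \<Xi>)
    then show ?thesis using assms(2) derivable_good[OF stable, of \<Xi> "IsType A"] by (simp add: wf_ctx_Cons)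
  qed simp
  then show ?thesis
    using sub_pair_lift[of T \<Delta> \<Gamma> \<Theta> \<sigma> \<sigma>] assms by (simp add: arrow_def sub_pair_refl)
qed

lemma type_inst:
  "derivable T (A # \<Gamma>) (IsType B) \<Longrightarrow> derivable T \<Gamma> (HasType a A) \<Longrightarrow> derivable T \<Gamma> (IsType (subst (inst [a]) B))"
  using arrow_subst[OF _ arrow_inst, of A \<Gamma> "IsType B" a] by simp

lemma mor_eqI':
  assumes "arrow \<Theta> \<sigma> \<Gamma>" "arrow \<Theta> \<tau> \<Gamma>" "sub_eq T \<Theta> \<sigma> \<tau> \<Gamma>"
  shows "mor \<Theta> \<sigma> \<Gamma> = mor \<Theta> \<tau> \<Gamma>"
  using assms by (simp add: mor_eq_arrow_iff sub_pair_def arrow_def)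

section \<open>Display maps and their pullbacks\<close>

definition disp :: "'k pre_mor set set" where
  "disp = {mor (A # \<Gamma>) wk \<Gamma> | A \<Gamma>. wf_ctx T (A # \<Gamma>)}"

lemma proj_Comp:
  "arrow \<Theta> \<sigma> (A # \<Gamma>) \<Longrightarrow> Comp Cl (mor (A # \<Gamma>) wk \<Gamma>) (mor \<Theta> \<sigma> (A # \<Gamma>)) = mor \<Theta> (\<lambda>i. \<sigma> (Suc i)) \<Gamma>"
  using mor_Comp[OF _ arrow_wk, of \<Theta> \<sigma> A \<Gamma>] arrowD by (simp add: wk_def)

text \<open>The tail of \<rho> equals \<sigma> only as a morphism, so \<open>\<rho> 0\<close> does
  not yet have the type \<open>subst \<sigma> A\<close>. Converting it gives a representative whose
  tail is \<sigma> itself; this is how terms are read off from morphisms below.\<close>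

lemma mor_over:
  assumes "arrow \<Theta> \<rho> (A # \<Gamma>)" "arrow \<Theta> \<sigma> \<Gamma>" "mor \<Theta> (\<lambda>i. \<rho> (Suc i)) \<Gamma> = mor \<Theta> \<sigma> \<Gamma>"
  shows "arrow \<Theta> (case_nat (\<rho> 0) \<sigma>) (A # \<Gamma>)" "mor \<Theta> \<rho> (A # \<Gamma>) = mor \<Theta> (case_nat (\<rho> 0) \<sigma>) (A # \<Gamma>)"
proof -
  have \<rho>: "arrow \<Theta> (\<lambda>i. \<rho> (Suc i)) \<Gamma>" "derivable T \<Gamma> (IsType A)"
    "derivable T \<Theta> (HasType (\<rho> 0) (subst (\<lambda>i. \<rho> (Suc i)) A))"
    using assms(1) by (simp_all add: arrow_Cons)
  have pair: "sub_pair T \<Theta> (\<lambda>i. \<rho> (Suc i)) \<sigma> \<Gamma>"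
    using assms(3) mor_eq_arrow_iff[OF \<rho>(1) assms(2)] by simp
  have "derivable T \<Theta> (EqType (subst (\<lambda>i. \<rho> (Suc i)) A) (subst \<sigma> A))"
    using EqType_subst[OF \<rho>(2) _ pair] assms(2) by (simp add: arrow_def)
  with \<rho>(3) have "derivable T \<Theta> (HasType (\<rho> 0) (subst \<sigma> A))" by (rule conversion)
  then show *: "arrow \<Theta> (case_nat (\<rho> 0) \<sigma>) (A # \<Gamma>)"
    using assms(2) \<rho>(2) by (simp add: arrow_Cons)
  show "mor \<Theta> \<rho> (A # \<Gamma>) = mor \<Theta> (case_nat (\<rho> 0) \<sigma>) (A # \<Gamma>)"
    using \<rho>(3) pair by (intro mor_eqI'[OF assms(1) *]) (simp add: term_refl sub_pair_def)
qed

lemma disp_Mor_Cl: "disp \<subseteq> Mor Cl"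
  by (auto simp: disp_def arrow_wk)

text \<open>The codomain determines a context only up to equality. The same type expression
  \<open>A\<close> is a type over every equal context, so the representative may be
  prescribed.\<close>

lemma disp_rep:
  assumes "d \<in> disp" "Cod Cl d = ob \<Gamma>" "wf_ctx T \<Gamma>"
  obtains A where "wf_ctx T (A # \<Gamma>)" "d = mor (A # \<Gamma>) wk \<Gamma>"
proof -
  obtain A \<Delta> where d: "wf_ctx T (A # \<Delta>)" "d = mor (A # \<Delta>) wk \<Delta>"
    using assms(1) by (auto simp: disp_def)
  then have eq: "(\<Delta>, \<Gamma>) \<in> ctx_eq T"
    using assms arrow_wk[OF d(1)] ob_eq_iff[of \<Delta> \<Gamma>] by (simp add: wf_ctx_Cons)
  have A: "derivable T \<Delta> (IsType A)" "derivable T \<Gamma> (IsType A)"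
    using d(1) ctx_conv[OF _ eq] by (simp_all add: wf_ctx_Cons)
  then have "(A # \<Delta>, A # \<Gamma>) \<in> ctx_eq T"
    using eq by (simp add: ctx_eq_Cons type_refl)
  moreover have "sub_pair T (A # \<Delta>) wk wk \<Delta>"
    using arrow_wk[OF d(1)] by (simp add: arrow_def sub_pair_refl)
  ultimately have "d = mor (A # \<Gamma>) wk \<Gamma>"
    unfolding d(2) using arrow_wk[OF d(1)] eq by (intro mor_eqI)
  with that A assms(3) show thesis by (simp add: wf_ctx_Cons)
qed

text \<open>Pulling back a projection is substitution into its type. The induced map joins the
  newest component of the map into \<open>A # \<Gamma>\<close>, after conversion by
  \<open>mor_over\<close>, to the map into \<open>\<Theta>\<close>.\<close>

lemma pullback_proj:
  assumes A: "wf_ctx T (A # \<Gamma>)" and \<sigma>: "arrow \<Theta> \<sigma> \<Gamma>"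
  shows "wf_ctx T (subst \<sigma> A # \<Theta>)" "arrow (subst \<sigma> A # \<Theta>) (lift (Suc 0) \<sigma>) (A # \<Gamma>)"
    "pullback Cl (mor (A # \<Gamma>) wk \<Gamma>) (mor \<Theta> \<sigma> \<Gamma>) (mor (subst \<sigma> A # \<Theta>) (lift (Suc 0) \<sigma>) (A # \<Gamma>)) (mor (subst \<sigma> A # \<Theta>) wk \<Theta>)"
proof -
  let ?P = "subst \<sigma> A # \<Theta>"
  show wf: "wf_ctx T ?P"
    using A \<sigma> arrow_subst[OF _ \<sigma>, of "IsType A"] by (simp add: wf_ctx_Cons arrow_def)
  show p: "arrow ?P (lift (Suc 0) \<sigma>) (A # \<Gamma>)"
    using arrow_lift[OF \<sigma>, of "[A]"] A by simp
  note q = arrow_wk[OF wf]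
  note f = arrow_wk[OF A]
  show "pullback Cl (mor (A # \<Gamma>) wk \<Gamma>) (mor \<Theta> \<sigma> \<Gamma>) (mor ?P (lift (Suc 0) \<sigma>) (A # \<Gamma>)) (mor ?P wk \<Theta>)"
  proof (rule pullbackI)
    show "Comp Cl (mor (A # \<Gamma>) wk \<Gamma>) (mor ?P (lift (Suc 0) \<sigma>) (A # \<Gamma>)) = Comp Cl (mor \<Theta> \<sigma> \<Gamma>) (mor ?P wk \<Theta>)"
      using p by (simp add: proj_Comp mor_Comp[OF q \<sigma>])
  next
    fix a b assume *: "a \<in> Mor Cl" "b \<in> Mor Cl" "Dom Cl a = Dom Cl b" "Cod Cl a = Dom Cl (mor (A # \<Gamma>) wk \<Gamma>)"
      "Cod Cl b = Dom Cl (mor \<Theta> \<sigma> \<Gamma>)" "Comp Cl (mor (A # \<Gamma>) wk \<Gamma>) a = Comp Cl (mor \<Theta> \<sigma> \<Gamma>) b"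
    obtain Z where Z: "wf_ctx T Z" "Dom Cl b = ob Z"
      using Obj_simps(1)[OF *(2)] by (rule Obj_cases)
    obtain \<rho> where \<rho>: "arrow Z \<rho> \<Theta>" "b = mor Z \<rho> \<Theta>"
      using Mor_rep[OF *(2) Z(2) _ Z(1)] *(5) \<sigma> by (auto simp: arrow_def)
    obtain \<alpha> where \<alpha>: "arrow Z \<alpha> (A # \<Gamma>)" "a = mor Z \<alpha> (A # \<Gamma>)"
      using Mor_rep[OF *(1) _ _ Z(1) A] *(3,4) f Z(2) by auto
    have eq: "mor Z (\<lambda>i. \<alpha> (Suc i)) \<Gamma> = mor Z (\<lambda>i. subst \<rho> (\<sigma> i)) \<Gamma>"
      using *(6) \<rho> \<alpha> \<sigma> by (simp add: proj_Comp mor_Comp)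
    note over = mor_over[OF \<alpha>(1) arrow_comp[OF \<rho>(1) \<sigma>] eq]
    let ?h = "case_nat (\<alpha> 0) \<rho>"
    have h: "arrow Z ?h ?P"
      using over(1) \<rho>(1) wf by (simp add: arrow_Cons subst_subst wf_ctx_Cons)
    have "(\<lambda>i. subst ?h (lift (Suc 0) \<sigma> i)) = case_nat (\<alpha> 0) (\<lambda>i. subst \<rho> (\<sigma> i))"
      by (auto simp: fun_eq_iff subst_subst wk_def split: nat.split)
    then have "Comp Cl (mor ?P (lift (Suc 0) \<sigma>) (A # \<Gamma>)) (mor Z ?h ?P) = a"
      using over(2) \<alpha>(2) by (simp add: mor_Comp[OF h p])
    moreover have "Comp Cl (mor ?P wk \<Theta>) (mor Z ?h ?P) = b"
      using h \<rho>(2) by (simp add: proj_Comp)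
    ultimately show "\<exists>h. h \<in> Mor Cl \<and> Dom Cl h = Dom Cl a \<and> Cod Cl h = Dom Cl (mor ?P (lift (Suc 0) \<sigma>) (A # \<Gamma>)) \<and>
        Comp Cl (mor ?P (lift (Suc 0) \<sigma>) (A # \<Gamma>)) h = a \<and> Comp Cl (mor ?P wk \<Theta>) h = b"
      using h p \<alpha> by (intro exI[of _ "mor Z ?h ?P"]) simp
  next
    fix h h' assume *: "h \<in> Mor Cl" "h' \<in> Mor Cl" "Cod Cl h = Dom Cl (mor ?P (lift (Suc 0) \<sigma>) (A # \<Gamma>))"
      "Cod Cl h' = Dom Cl (mor ?P (lift (Suc 0) \<sigma>) (A # \<Gamma>))"
      "Comp Cl (mor ?P (lift (Suc 0) \<sigma>) (A # \<Gamma>)) h = Comp Cl (mor ?P (lift (Suc 0) \<sigma>) (A # \<Gamma>)) h'"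
      "Comp Cl (mor ?P wk \<Theta>) h = Comp Cl (mor ?P wk \<Theta>) h'"
    have cod: "Cod Cl h = ob ?P" "Cod Cl h' = ob ?P" using * p by simp_all
    have "Dom Cl h' = Dom Cl h"
      using arg_cong[OF *(5), of "Dom Cl"] *(1,2) cod p by simp
    moreover obtain Z where Z: "wf_ctx T Z" "Dom Cl h = ob Z"
      using Obj_simps(1)[OF *(1)] by (rule Obj_cases)
    ultimately obtain \<eta> \<eta>' where \<eta>: "arrow Z \<eta> ?P" "h = mor Z \<eta> ?P" "arrow Z \<eta>' ?P" "h' = mor Z \<eta>' ?P"
      using Mor_rep[OF *(1) Z(2) cod(1) Z(1) wf] Mor_rep[OF *(2) _ cod(2) Z(1) wf] by metis
    have "sub_pair T Z (\<lambda>i. subst \<eta> (lift (Suc 0) \<sigma> i)) (\<lambda>i. subst \<eta>' (lift (Suc 0) \<sigma> i)) (A # \<Gamma>)"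
      using *(5) \<eta> p mor_eq_arrow_iff[OF arrow_comp[OF \<eta>(1) p] arrow_comp[OF \<eta>(3) p]] by (simp add: mor_Comp)
    then have "derivable T Z (EqTerm (\<eta> 0) (\<eta>' 0) (subst (\<lambda>i. \<eta> (Suc i)) (subst \<sigma> A)))"
      by (simp add: sub_pair_Cons subst_subst wk_def)
    moreover have "sub_pair T Z (\<lambda>i. \<eta> (Suc i)) (\<lambda>i. \<eta>' (Suc i)) \<Theta>"
      using *(6) \<eta> mor_eq_arrow_iff[of Z "\<lambda>i. \<eta> (Suc i)" \<Theta> "\<lambda>i. \<eta>' (Suc i)"]
      by (simp add: proj_Comp arrow_Cons)
    ultimately show "h = h'"
      unfolding \<eta>(2,4) using \<eta>(1,3) by (intro mor_eqI') (simp_all add: sub_pair_def)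
  qed (use p q f \<sigma> in simp_all)
qed

lemma disp_pullback_Cl:
  assumes "d \<in> disp" "g \<in> Mor Cl" "Cod Cl d = Cod Cl g"
  shows "\<exists>p. \<exists>q\<in>disp. pullback Cl d g p q"
proof -
  obtain \<Theta> \<sigma> \<Gamma> where g: "arrow \<Theta> \<sigma> \<Gamma>" "g = mor \<Theta> \<sigma> \<Gamma>"
    using assms(2) by (rule Mor_cases)
  obtain A where "wf_ctx T (A # \<Gamma>)" "d = mor (A # \<Gamma>) wk \<Gamma>"
    using disp_rep[OF assms(1), of \<Gamma>] assms(3) g by (auto simp: arrow_def)
  then show ?thesis
    using pullback_proj[of A \<Gamma> \<Theta> \<sigma>] g by (auto simp: disp_def)
qed

end

section \<open>Strong sums\<close>

lemma subst_app [simp]: "subst \<sigma> (app c es) = app c (map (subst \<sigma>) es)"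
  by (simp add: app_def)

lemma scoped_app [simp]: "scoped n (app c es) \<longleftrightarrow> (\<forall>e\<in>set es. scoped n e)"
  by (auto simp: app_def)

lemma subst_sum_type [simp]: "subst \<sigma> (sum_type \<Sigma> A B) = sum_type \<Sigma> (subst \<sigma> A) (subst (lift (Suc 0) \<sigma>) B)"
  by (simp add: sum_type_def)

lemma scoped_sum_type [simp]: "scoped n (sum_type \<Sigma> A B) \<longleftrightarrow> scoped n A \<and> scoped (Suc n) B"
  by (simp add: sum_type_def)

text \<open>Scoping of the conclusion is reduced to a purely syntactic condition, valid for every
  \<open>n\<close>, which the simplifier can check from the shape of the rule; premises and
  presuppositions are scoped because they are derivable.\<close>

lemma derivable_by_rule:
  assumes "R \<subseteq> T" "\<exists>\<rho>\<in>R. (ps, J) \<in> \<rho>" "\<forall>(\<Delta>, I)\<in>set ps. derivable T (\<Delta> @ \<Gamma>) I"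
    "wf_ctx T \<Gamma>" "\<forall>I\<in>set (judg_presup J). derivable T \<Gamma> I"
    and sc: "\<And>n. \<forall>(\<Delta>, I)\<in>set ps. judg_scoped (length \<Delta> + n) I \<Longrightarrow> \<forall>I\<in>set (judg_presup J). judg_scoped n I \<Longrightarrow>
      judg_scoped n J"
  shows "derivable T \<Gamma> J"
proof -
  obtain \<rho> where \<rho>: "\<rho> \<in> T" "(ps, J) \<in> \<rho>" using assms(1,2) by blast
  have J: "judg_scoped (length \<Gamma>) J"
    using assms(3,5) by (intro sc) (force dest: derivable_scoped)+
  show ?thesis
    by (rule derivable.rule[OF \<rho> _ J]) (use assms(3-5) presup_derivable in blast)+
qed

context theory_of_types
begin

lemma type_wf: "derivable T (A # \<Gamma>) J \<Longrightarrow> derivable T \<Gamma> (IsType A) \<and> wf_ctx T \<Gamma>"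
  using derivable_wf[of T "A # \<Gamma>" J] by (simp add: wf_ctx_Cons)

lemma mor_iso:
  assumes "arrow \<Theta> \<sigma> \<Gamma>" "arrow \<Gamma> \<tau> \<Theta>"
    and "sub_eq T \<Theta> Var (\<lambda>i. subst \<sigma> (\<tau> i)) \<Theta>" "sub_eq T \<Gamma> Var (\<lambda>i. subst \<tau> (\<sigma> i)) \<Gamma>"
  shows "inverse_pair (mor \<Theta> \<sigma> \<Gamma>) (mor \<Gamma> \<tau> \<Theta>)"
proof -
  have wf: "wf_ctx T \<Theta>" "wf_ctx T \<Gamma>" using assms(1) by (simp_all add: arrow_def)
  show ?thesis
    using assms wf mor_eqI'[OF arrow_Var arrow_comp[OF assms(1,2)]] mor_eqI'[OF arrow_Var arrow_comp[OF assms(2,1)]]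
    by (simp add: inverse_pair_def mor_Comp[OF assms(1,2)] mor_Comp[OF assms(2,1)] mor_Ide)
qed

end

locale strong_sum_theory = theory_of_types T for T :: "'k type_theory" +
  fixes unit star \<Sigma> pair fst' snd' :: 'k
  assumes units: "unit_rules unit star \<subseteq> T" and sums: "sum_rules \<Sigma> pair fst' snd' \<subseteq> T"
begin

lemma unit_form: "wf_ctx T \<Gamma> \<Longrightarrow> derivable T \<Gamma> (IsType (app unit []))"
  by (rule derivable_by_rule[OF units, of "[]"]) (auto simp: unit_rules_def)

lemma star_intro: "wf_ctx T \<Gamma> \<Longrightarrow> derivable T \<Gamma> (HasType (app star []) (app unit []))"
  by (rule derivable_by_rule[OF units, of "[]"]) (auto simp: unit_rules_def unit_form)

lemma unit_eta:
  assumes "derivable T \<Gamma> (HasType a (app unit []))"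
  shows "derivable T \<Gamma> (EqTerm a (app star []) (app unit []))"
  by (rule derivable_by_rule[OF units, of "[([], HasType a (app unit []))]"])
    (use assms derivable_wf[OF assms] in \<open>auto simp: unit_rules_def star_intro\<close>)

lemma sum_form:
  assumes "derivable T (A # \<Gamma>) (IsType B)"
  shows "derivable T \<Gamma> (IsType (sum_type \<Sigma> A B))"
  by (rule derivable_by_rule[OF sums, of "[([], IsType A), ([A], IsType B)]"])
    (use assms type_wf[OF assms] in \<open>auto simp: sum_rules_def\<close>)

lemma pair_intro:
  assumes "derivable T (A # \<Gamma>) (IsType B)" "derivable T \<Gamma> (HasType a A)" "derivable T \<Gamma> (HasType b (subst (inst [a]) B))"
  shows "derivable T \<Gamma> (HasType (app pair [a, b]) (sum_type \<Sigma> A B))"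
  by (rule derivable_by_rule[OF sums, of "[([], IsType A), ([A], IsType B), ([], HasType a A), ([], HasType b (subst (inst [a]) B))]"])
    (use assms type_wf[OF assms(1)] sum_form[OF assms(1)] in \<open>auto simp: sum_rules_def\<close>)

lemma fst_elim:
  assumes "derivable T (A # \<Gamma>) (IsType B)" "derivable T \<Gamma> (HasType c (sum_type \<Sigma> A B))"
  shows "derivable T \<Gamma> (HasType (app fst' [c]) A)"
  by (rule derivable_by_rule[OF sums, of "[([], IsType A), ([A], IsType B), ([], HasType c (sum_type \<Sigma> A B))]"])
    (use assms type_wf[OF assms(1)] in \<open>auto simp: sum_rules_def\<close>)

lemma snd_elim:
  assumes "derivable T (A # \<Gamma>) (IsType B)" "derivable T \<Gamma> (HasType c (sum_type \<Sigma> A B))"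
  shows "derivable T \<Gamma> (HasType (app snd' [c]) (subst (inst [app fst' [c]]) B))"
proof -
  have B: "derivable T \<Gamma> (IsType (subst (inst [app fst' [c]]) B))"
    using type_inst[OF assms(1) fst_elim[OF assms]] .
  show ?thesis
    by (rule derivable_by_rule[OF sums, of "[([], IsType A), ([A], IsType B), ([], HasType c (sum_type \<Sigma> A B))]"])
      (use assms type_wf[OF assms(1)] B in \<open>auto simp: sum_rules_def\<close>)
qed

lemma fst_pair:
  assumes "derivable T (A # \<Gamma>) (IsType B)" "derivable T \<Gamma> (HasType a A)" "derivable T \<Gamma> (HasType b (subst (inst [a]) B))"
  shows "derivable T \<Gamma> (EqTerm (app fst' [app pair [a, b]]) a A)"
  by (rule derivable_by_rule[OF sums, of "[([], IsType A), ([A], IsType B), ([], HasType a A), ([], HasType b (subst (inst [a]) B))]"])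
    (use assms type_wf[OF assms(1)] fst_elim[OF assms(1) pair_intro[OF assms]] in \<open>auto simp: sum_rules_def\<close>)

lemma snd_pair:
  assumes "derivable T (A # \<Gamma>) (IsType B)" "derivable T \<Gamma> (HasType a A)" "derivable T \<Gamma> (HasType b (subst (inst [a]) B))"
  shows "derivable T \<Gamma> (EqTerm (app snd' [app pair [a, b]]) b (subst (inst [a]) B))"
proof -
  have wf: "wf_ctx T \<Gamma>" using type_wf[OF assms(1)] by simp
  \<comment> \<open>\<open>snd_elim\<close> types the left side by \<open>B\<close> at the first
    projection of the pair. The rule presupposes the type \<open>B\<close> at \<open>a\<close>,
    which is equal by the first computation rule and congruence.\<close>
  have "sub_pair T \<Gamma> (inst [app fst' [app pair [a, b]]]) (inst [a]) (A # \<Gamma>)"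
    using fst_pair[OF assms] fst_elim[OF assms(1) pair_intro[OF assms]] assms(2) sub_ok_Var[OF wf]
    by (simp add: sub_pair_Cons sub_pair_refl)
  then have "derivable T \<Gamma> (EqType (subst (inst [app fst' [app pair [a, b]]]) B) (subst (inst [a]) B))"
    using EqType_subst[OF assms(1) wf] by blast
  with snd_elim[OF assms(1) pair_intro[OF assms]]
  have "derivable T \<Gamma> (HasType (app snd' [app pair [a, b]]) (subst (inst [a]) B))"
    by (rule conversion)
  then show ?thesis
    by (intro derivable_by_rule[OF sums, of "[([], IsType A), ([A], IsType B), ([], HasType a A), ([], HasType b (subst (inst [a]) B))]"])
      (use assms type_wf[OF assms(1)] in \<open>auto simp: sum_rules_def\<close>)
qed

lemma pair_eta:
  assumes "derivable T (A # \<Gamma>) (IsType B)" "derivable T \<Gamma> (HasType c (sum_type \<Sigma> A B))"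
  shows "derivable T \<Gamma> (EqTerm (app pair [app fst' [c], app snd' [c]]) c (sum_type \<Sigma> A B))"
  by (rule derivable_by_rule[OF sums, of "[([], IsType A), ([A], IsType B), ([], HasType c (sum_type \<Sigma> A B))]"])
    (use assms type_wf[OF assms(1)] pair_intro[OF assms(1) fst_elim[OF assms] snd_elim[OF assms]] in \<open>auto simp: sum_rules_def\<close>)

text \<open>Every element of the unit type equals \<open>star\<close>, so extending
  \<open>\<Gamma>\<close> by it gives an isomorphic context, and the projection composed with this
  isomorphism is the identity.\<close>

lemma disp_Ide_Cl:
  assumes "X \<in> Obj Cl"
  shows "\<exists>d\<in>disp. \<exists>\<alpha>. iso Cl \<alpha> \<and> Cod Cl \<alpha> = Dom Cl d \<and> Comp Cl d \<alpha> = Ide Cl X"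
proof -
  obtain \<Gamma> where \<Gamma>: "wf_ctx T \<Gamma>" "X = ob \<Gamma>" using assms by (rule Obj_cases)
  let ?U = "app unit [] # \<Gamma>"
  let ?\<alpha> = "case_nat (app star []) Var"
  have U: "wf_ctx T ?U" using \<Gamma> unit_form by (simp add: wf_ctx_Cons)
  have \<alpha>: "arrow \<Gamma> ?\<alpha> ?U"
    using \<Gamma> unit_form star_intro by (simp add: arrow_Cons arrow_Var)
  have "derivable T ?U (EqTerm (Var 0) (app star []) (app unit []))"
    using sub_ok_Var[OF U] by (intro unit_eta) simp
  then have "inverse_pair (mor \<Gamma> ?\<alpha> ?U) (mor ?U wk \<Gamma>)"
    using U \<Gamma> sub_ok_Var[OF \<Gamma>(1)] arrow_wk[OF U]
    by (intro mor_iso[OF \<alpha> arrow_wk[OF U]]) (simp_all add: wk_def[abs_def] sub_eq_refl arrow_def)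
  moreover have "Comp Cl (mor ?U wk \<Gamma>) (mor \<Gamma> ?\<alpha> ?U) = Ide Cl X"
    using \<alpha> \<Gamma> by (simp add: proj_Comp mor_Ide)
  moreover have "mor ?U wk \<Gamma> \<in> disp" using U by (auto simp: disp_def)
  ultimately show ?thesis
    using \<alpha> arrow_wk[OF U] by (intro bexI[of _ "mor ?U wk \<Gamma>"] exI[of _ "mor \<Gamma> ?\<alpha> ?U"]) (auto simp: iso_iff)
qed

text \<open>\<alpha> pairs the two newest variables and \<beta> splits a pair; the computation rules
  give one composite and the uniqueness rule for pairs the other.\<close>

lemma sum_iso:
  assumes "wf_ctx T (B # A # \<Gamma>)"
  defines "\<alpha> \<equiv> case_nat (app pair [Var (Suc 0), Var 0]) (\<lambda>i. Var (Suc (Suc i)))"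
  defines "\<beta> \<equiv> case_nat (app snd' [Var 0]) (case_nat (app fst' [Var 0]) wk)"
  shows "arrow (B # A # \<Gamma>) \<alpha> (sum_type \<Sigma> A B # \<Gamma>)"
    "inverse_pair (mor (B # A # \<Gamma>) \<alpha> (sum_type \<Sigma> A B # \<Gamma>)) (mor (sum_type \<Sigma> A B # \<Gamma>) \<beta> (B # A # \<Gamma>))"
proof -
  let ?P = "B # A # \<Gamma>" and ?S = "sum_type \<Sigma> A B # \<Gamma>"
  have A: "derivable T \<Gamma> (IsType A)" and B: "derivable T (A # \<Gamma>) (IsType B)" and wf: "wf_ctx T \<Gamma>" "wf_ctx T (A # \<Gamma>)"
    using assms(1) by (simp_all add: wf_ctx_Cons)
  have vP: "sub_ok T ?P Var ?P" using assms(1) by (rule sub_ok_Var)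
  have up2: "arrow ?P (\<lambda>i. Var (Suc (Suc i))) \<Gamma>"
    using arrow_comp[OF arrow_wk[OF assms(1)] arrow_wk[OF wf(2)]] by (simp add: wk_def[abs_def])
  have S: "wf_ctx T ?S" using sum_form[OF B] wf by (simp add: wf_ctx_Cons)
  note up = arrow_wk[OF S]
  have lift2: "arrow (subst (\<lambda>i. Var (Suc (Suc i))) A # ?P) (lift (Suc 0) (\<lambda>i. Var (Suc (Suc i)))) (A # \<Gamma>)"
    using arrow_lift[OF up2, of "[A]"] wf(2) by simp
  have lift1: "arrow (subst wk A # ?S) (lift (Suc 0) wk) (A # \<Gamma>)"
    using arrow_lift[OF up, of "[A]"] wf(2) by simp
  \<comment> \<open>The sum rules are applied to variables of \<open>?P\<close> and
    \<open>?S\<close>, so \<open>B\<close> must first be weakened as a family over the weakened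
    \<open>A\<close>; \<open>e2\<close> and \<open>e1\<close> say what its instances are.\<close>
  note B2 = arrow_subst[OF B lift2, simplified] and B1 = arrow_subst[OF B lift1, simplified]
  have e2: "(\<lambda>i. subst (inst [Var (Suc 0)]) (lift (Suc 0) (\<lambda>i. Var (Suc (Suc i))) i)) = (\<lambda>i. Var (Suc i) :: 'k expr)"
    by (auto simp: fun_eq_iff lift_def inst_def)
  have v0: "derivable T ?P (HasType (Var 0) (subst (inst [Var (Suc 0)]) (subst (lift (Suc 0) (\<lambda>i. Var (Suc (Suc i)))) B)))"
    using vP unfolding subst_subst e2 by simp
  have v1: "derivable T ?P (HasType (Var (Suc 0)) (subst (\<lambda>i. Var (Suc (Suc i))) A))"
    using vP by simp
  show \<alpha>: "arrow ?P \<alpha> ?S"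
    using up2 sum_form[OF B] pair_intro[OF B2 v1 v0] by (simp add: arrow_Cons \<alpha>_def)
  have c: "derivable T ?S (HasType (Var 0) (sum_type \<Sigma> (subst wk A) (subst (lift (Suc 0) wk) B)))"
    using sub_ok_Var[OF S] by (simp add: wk_def[abs_def])
  have e1: "(\<lambda>i. subst (inst [app fst' [Var 0]]) (lift (Suc 0) wk i)) = case_nat (app fst' [Var 0]) wk"
    by (auto simp: fun_eq_iff lift_def wk_def[abs_def] inst_def split: nat.split)
  have \<beta>: "arrow ?S \<beta> ?P"
    using up A B fst_elim[OF B1 c] snd_elim[OF B1 c] by (simp add: arrow_Cons \<beta>_def subst_subst e1)
  show "inverse_pair (mor ?P \<alpha> ?S) (mor ?S \<beta> ?P)"
  proof (rule mor_iso[OF \<alpha> \<beta>])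
    have "sub_eq T ?P (\<lambda>i. Var (Suc (Suc i))) (\<lambda>i. Var (Suc (Suc i))) \<Gamma>"
      using up2 by (simp add: arrow_def sub_eq_refl)
    moreover have "derivable T ?P (EqTerm (Var 0) (app snd' [app pair [Var (Suc 0), Var 0]]) (subst (\<lambda>i. Var (Suc i)) B))"
      using snd_pair[OF B2 v1 v0] unfolding subst_subst e2 by (rule term_sym)
    moreover have "derivable T ?P (EqTerm (Var (Suc 0)) (app fst' [app pair [Var (Suc 0), Var 0]]) (subst (\<lambda>i. Var (Suc (Suc i))) A))"
      using fst_pair[OF B2 v1 v0] by (rule term_sym)
    ultimately show "sub_eq T ?P Var (\<lambda>i. subst \<alpha> (\<beta> i)) ?P"
      by (simp add: \<alpha>_def \<beta>_def wk_def[abs_def])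
    have "sub_eq T ?S (\<lambda>i. Var (Suc i)) (\<lambda>i. Var (Suc i)) \<Gamma>"
      using up by (simp add: arrow_def sub_eq_refl wk_def[abs_def])
    moreover have "derivable T ?S (EqTerm (Var 0) (app pair [app fst' [Var 0], app snd' [Var 0]]) (subst wk (sum_type \<Sigma> A B)))"
      using pair_eta[OF B1 c] by (simp add: term_sym)
    ultimately show "sub_eq T ?S Var (\<lambda>i. subst \<beta> (\<alpha> i)) ?S"
      by (simp add: \<alpha>_def \<beta>_def wk_def[abs_def])
  qed
qed

lemma disp_comp_Cl:
  assumes "d \<in> disp" "e \<in> disp" "Cod Cl e = Dom Cl d"
  shows "\<exists>d'\<in>disp. \<exists>\<alpha>. iso Cl \<alpha> \<and> Cod Cl \<alpha> = Dom Cl d' \<and> Comp Cl d e = Comp Cl d' \<alpha>"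
proof -
  obtain A \<Gamma> where d: "wf_ctx T (A # \<Gamma>)" "d = mor (A # \<Gamma>) wk \<Gamma>"
    using assms(1) by (auto simp: disp_def)
  obtain B where e: "wf_ctx T (B # A # \<Gamma>)" "e = mor (B # A # \<Gamma>) wk (A # \<Gamma>)"
    using disp_rep[OF assms(2), of "A # \<Gamma>"] assms(3) d arrow_wk[OF d(1)] by auto
  let ?\<alpha> = "case_nat (app pair [Var (Suc 0), Var 0]) (\<lambda>i. Var (Suc (Suc i)))"
  let ?S = "sum_type \<Sigma> A B # \<Gamma>"
  note \<alpha> = sum_iso[OF e(1)]
  have S: "wf_ctx T ?S" using \<alpha>(1) by (simp add: arrow_def)
  have "Comp Cl d e = mor (B # A # \<Gamma>) (\<lambda>i. Var (Suc (Suc i))) \<Gamma>"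
    using arrow_wk[OF e(1)] by (simp add: d(2) e(2) proj_Comp wk_def)
  also have "\<dots> = Comp Cl (mor ?S wk \<Gamma>) (mor (B # A # \<Gamma>) ?\<alpha> ?S)"
    using \<alpha>(1) by (simp add: proj_Comp)
  finally show ?thesis
    using \<alpha> S arrow_wk[OF S] by (intro bexI[of _ "mor ?S wk \<Gamma>"] exI[of _ "mor (B # A # \<Gamma>) ?\<alpha> ?S"]) (auto simp: iso_iff disp_def)
qed

sublocale display_category Cl disp
  by unfold_locales (use disp_Mor_Cl disp_pullback_Cl disp_Ide_Cl disp_comp_Cl in auto)

lemma terminal_Nil: "terminal Cl (ob [])"
proof -
  have "\<exists>!f. f \<in> hom Cl X (ob [])" if "X \<in> Obj Cl" for X
  proof -
    obtain \<Gamma> where \<Gamma>: "wf_ctx T \<Gamma>" "X = ob \<Gamma>" using \<open>X \<in> Obj Cl\<close> by (rule Obj_cases)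
    have ar: "arrow \<Gamma> \<sigma> []" for \<sigma> using \<Gamma> by (simp add: arrow_def)
    show ?thesis
    proof (rule ex1I)
      show "mor \<Gamma> Var [] \<in> hom Cl X (ob [])" using ar \<Gamma> by (simp add: hom_Cl)
      fix f assume "f \<in> hom Cl X (ob [])"
      then have "f \<in> hom Cl (ob \<Gamma>) (ob [])" using \<Gamma> by simp
      then obtain \<sigma> where "f = mor \<Gamma> \<sigma> []" using \<Gamma>(1) wf_ctx_Nil by (rule hom_rep)
      moreover have "mor \<Gamma> \<sigma> [] = mor \<Gamma> Var []" by (rule mor_eqI'[OF ar ar]) simp
      ultimately show "f = mor \<Gamma> Var []" by simp
    qed
  qed
  then show ?thesis by (simp add: terminal_def)
qed

lemma append_proj:
  "wf_ctx T (\<Delta> @ \<Gamma>) \<Longrightarrow> arrow (\<Delta> @ \<Gamma>) (\<lambda>i. Var (length \<Delta> + i)) \<Gamma> \<and> mor (\<Delta> @ \<Gamma>) (\<lambda>i. Var (length \<Delta> + i)) \<Gamma> \<in> fib"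
proof (induction \<Delta>)
  case Nil
  then show ?case
    using arrow_Var iso_in_fib[OF inverse_pair_Ide[OF ob_Obj]] by (simp add: mor_Ide)
next
  case (Cons A \<Delta>)
  then have wf: "wf_ctx T (\<Delta> @ \<Gamma>)" "wf_ctx T (A # \<Delta> @ \<Gamma>)" by (simp_all add: wf_ctx_Cons)
  note IH = Cons.IH[OF wf(1)]
  let ?\<pi> = "mor (\<Delta> @ \<Gamma>) (\<lambda>i. Var (length \<Delta> + i)) \<Gamma>"
  have "mor (A # \<Delta> @ \<Gamma>) wk (\<Delta> @ \<Gamma>) \<in> fib" using wf(2) by (intro disp_fib) (auto simp: disp_def)
  then have "Comp Cl ?\<pi> (mor (A # \<Delta> @ \<Gamma>) wk (\<Delta> @ \<Gamma>)) \<in> fib"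
    using IH arrow_wk[OF wf(2)] by (intro fib_comp) simp_all
  then show ?case
    using arrow_comp[OF arrow_wk[OF wf(2)] IH[THEN conjunct1]] IH
    by (simp add: mor_Comp[OF arrow_wk[OF wf(2)]] wk_def)
qed

lemma terminal_fib_Cl: "\<exists>Z. terminal Cl Z \<and> (\<forall>f\<in>Mor Cl. Cod Cl f = Z \<longrightarrow> f \<in> fib)"
proof -
  have "f \<in> fib" if f: "f \<in> Mor Cl" "Cod Cl f = ob []" for f
  proof -
    obtain \<Gamma> where \<Gamma>: "wf_ctx T \<Gamma>" "Dom Cl f = ob \<Gamma>"
      using Obj_simps(1)[OF f(1)] by (rule Obj_cases)
    obtain \<sigma> where \<sigma>: "arrow \<Gamma> \<sigma> []" "f = mor \<Gamma> \<sigma> []"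
      using f(1) \<Gamma>(2) f(2) \<Gamma>(1) wf_ctx_Nil by (rule Mor_rep)
    have "mor \<Gamma> (\<lambda>i. Var (length \<Gamma> + i)) [] \<in> fib" "arrow \<Gamma> (\<lambda>i. Var (length \<Gamma> + i)) []"
      using append_proj[of \<Gamma> "[]"] \<Gamma> by simp_all
    then show ?thesis using \<sigma> mor_eqI'[of \<Gamma> \<sigma> "[]" "\<lambda>i. Var (length \<Gamma> + i)"] by simp
  qed
  then show ?thesis using terminal_Nil by blast
qed

lemma dependent_projection_fib:
  "\<pi> \<in> dependent_projections T \<Longrightarrow> \<pi> \<in> fib"
proof -
  assume "\<pi> \<in> dependent_projections T"
  then obtain \<Delta> \<Gamma> where *: "wf_ctx T (\<Delta> @ \<Gamma>)" "\<pi> = mor_eq T `` {(\<Delta> @ \<Gamma>, map Var [length \<Delta>..<length \<Delta> + length \<Gamma>], \<Gamma>)}"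
    by (auto simp: dependent_projections_def)
  have "map Var [length \<Delta>..<length \<Delta> + length \<Gamma>] = map (\<lambda>i. Var (length \<Delta> + i) :: 'k expr) [0..<length \<Gamma>]"
    by (rule nth_equalityI) simp_all
  then show "\<pi> \<in> fib" using append_proj[OF *(1)] * by (simp add: mor_def)
qed

lemma disp_dependent_projection: "disp \<subseteq> dependent_projections T"
proof
  fix d assume "d \<in> disp"
  then obtain A \<Gamma> where d: "wf_ctx T (A # \<Gamma>)" "d = mor (A # \<Gamma>) wk \<Gamma>"
    by (auto simp: disp_def)
  have "map wk [0..<length \<Gamma>] = map (Var :: _ \<Rightarrow> 'k expr) [length [A]..<length [A] + length \<Gamma>]"
    by (rule nth_equalityI) (simp_all add: wk_def del: upt_Suc)
  then show "d \<in> dependent_projections T"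
    unfolding dependent_projections_def mem_Collect_eq using d
    by (intro exI[of _ "[A]"] exI[of _ \<Gamma>]) (simp add: mor_def)
qed

text \<open>An isomorphism of arrows gives
  \<open>f = \<beta>' \<cdot> \<pi> \<cdot> \<alpha>\<close>, a composite of fibrations. Conversely,
  a display map after an isomorphism is isomorphic to that display map, with the identity on the
  target.\<close>

lemma fibrations_eq_fib: "fibrations T = fib"
proof (intro equalityI subsetI)
  fix f assume "f \<in> fibrations T"
  then obtain \<pi> \<alpha> \<beta> where f [simp]: "f \<in> Mor Cl" and \<pi>: "\<pi> \<in> dependent_projections T"
    and \<alpha>: "\<alpha> \<in> hom Cl (Dom Cl f) (Dom Cl \<pi>)" "iso Cl \<alpha>" and \<beta>: "\<beta> \<in> hom Cl (Cod Cl f) (Cod Cl \<pi>)" "iso Cl \<beta>"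
    and eq: "Comp Cl \<beta> f = Comp Cl \<pi> \<alpha>"
    by (auto simp: fibrations_def Let_def)
  obtain \<alpha>' \<beta>' where inv: "inverse_pair \<alpha> \<alpha>'" "inverse_pair \<beta> \<beta>'" using \<alpha>(2) \<beta>(2) by (auto simp: iso_iff)
  note [simp] = inverse_pairD[OF inv(1)] inverse_pairD[OF inv(2)]
  have [simp]: "\<pi> \<in> fib" using \<pi> by (rule dependent_projection_fib)
  have [simp]: "Dom Cl \<alpha> = Dom Cl f" "Cod Cl \<alpha> = Dom Cl \<pi>" "Dom Cl \<beta> = Cod Cl f" "Cod Cl \<beta> = Cod Cl \<pi>"
    using \<alpha> \<beta> by (simp_all add: hom_iff)
  have "\<alpha> \<in> fib" "\<beta>' \<in> fib" using inv inverse_pair_sym iso_in_fib by blast+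
  then have "Comp Cl \<beta>' (Comp Cl \<pi> \<alpha>) \<in> fib" by (intro fib_comp) simp_all
  then show "f \<in> fib" by (simp flip: eq)
next
  fix f assume "f \<in> fib"
  then obtain d \<alpha> \<beta> where d: "d \<in> disp" "inverse_pair \<alpha> \<beta>" "f = Comp Cl d \<alpha>" "d \<in> Mor Cl" "Cod Cl \<alpha> = Dom Cl d"
    "Dom Cl \<alpha> = Dom Cl f" "Cod Cl d = Cod Cl f"
    by (rule fib_set_iso_factor)
  have f: "f \<in> Mor Cl" using \<open>f \<in> fib\<close> by simp
  then have "iso Cl (Ide Cl (Cod Cl f))" using inverse_pair_Ide[OF Obj_simps(2)] iso_iff by blast
  moreover have "d \<in> dependent_projections T" "iso Cl \<alpha>"
    using d disp_dependent_projection by (auto simp: iso_iff)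
  moreover have "\<alpha> \<in> hom Cl (Dom Cl f) (Dom Cl d)"
    using inverse_pairD(1)[OF d(2)] d(5,6) by (simp add: hom_iff)
  moreover have "Ide Cl (Cod Cl f) \<in> hom Cl (Cod Cl f) (Cod Cl d)"
    using f d(7) by (simp add: hom_iff)
  moreover have "Comp Cl (Ide Cl (Cod Cl f)) f = Comp Cl d \<alpha>"
    using f by (simp flip: d(3))
  ultimately show "f \<in> fibrations T"
    using f unfolding fibrations_def Let_def by blast
qed

end

section \<open>Identity types\<close>

lemma scoped_J_term [simp]:
  "scoped n (J_term J a b p d ts) \<longleftrightarrow>
    scoped n a \<and> scoped n b \<and> scoped n p \<and> scoped (n + Suc (length ts)) d \<and> (\<forall>t\<in>set ts. scoped n t)"
  by (auto simp: J_term_def)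

locale identity_theory = strong_sum_theory T unit star \<Sigma> pair fst' snd'
  for T :: "'k type_theory" and unit star \<Sigma> pair fst' snd' :: 'k +
  fixes Idt refl' J H :: 'k
  assumes ids: "id_rules Idt refl' J H \<subseteq> T"
begin

abbreviation "IdT A a b \<equiv> app Idt [A, a, b]"
abbreviation "Rf a \<equiv> app refl' [a]"

lemma id_form:
  assumes "derivable T \<Gamma> (HasType a A)" "derivable T \<Gamma> (HasType b A)"
  shows "derivable T \<Gamma> (IsType (IdT A a b))"
  by (rule derivable_by_rule[OF ids, of "[([], IsType A), ([], HasType a A), ([], HasType b A)]"])
    (use assms derivable_presup[OF assms(1)] derivable_wf[OF assms(1)] in \<open>auto simp: id_rules_def\<close>)

lemma refl_intro:
  assumes "derivable T \<Gamma> (HasType a A)"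
  shows "derivable T \<Gamma> (HasType (Rf a) (IdT A a a))"
  by (rule derivable_by_rule[OF ids, of "[([], IsType A), ([], HasType a A)]"])
    (use assms derivable_presup[OF assms(1)] derivable_wf[OF assms(1)] id_form[OF assms assms] in \<open>auto simp: id_rules_def\<close>)

text \<open>Elimination is a family of rules indexed by the length of the parameter, here the length
  of \<open>ts\<close>. That the terms \<open>ts\<close> are scoped is read off from their typing
  premises.\<close>

lemma J_elim:
  fixes A :: "'k expr"
  assumes ps: "\<forall>(\<Delta>', I)\<in>set (elim_premises Idt refl' A \<Delta> C d
         @ [([], HasType a A), ([], HasType b A), ([], HasType p (IdT A a b))]
         @ sequence_premises [p, b, a] \<Delta> ts). derivable T (\<Delta>' @ \<Gamma>) I"
      (is "\<forall>(_, _)\<in>set ?ps. _")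
    and len: "length ts = length \<Delta>"
    and C: "derivable T \<Gamma> (IsType (subst (inst (ts @ [p, b, a])) C))"
  shows "derivable T \<Gamma> (HasType (J_term J a b p d ts) (subst (inst (ts @ [p, b, a])) C))"
proof (rule derivable_by_rule[OF ids _ ps])
  show "\<exists>\<rho>\<in>id_rules Idt refl' J H. (?ps, HasType (J_term J a b p d ts) (subst (inst (ts @ [p, b, a])) C)) \<in> \<rho>"
  proof
    show "(?ps, HasType (J_term J a b p d ts) (subst (inst (ts @ [p, b, a])) C)) \<in>
      {(elim_premises Idt refl' A \<Delta> C d
         @ [([], HasType a A), ([], HasType b A), ([], HasType p (app Idt [A, a, b]))]
         @ sequence_premises [p, b, a] \<Delta> ts',
        HasType (J_term J a b p d ts') (subst (inst (ts' @ [p, b, a])) C))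
        | A \<Delta> C d a b p ts'. length \<Delta> = length ts \<and> length ts' = length ts}"
      unfolding mem_Collect_eq using len
      by (intro exI[of _ A] exI[of _ \<Delta>] exI[of _ C] exI[of _ d] exI[of _ a] exI[of _ b] exI[of _ p] exI[of _ ts]) simp
    show "{(elim_premises Idt refl' A \<Delta> C d
         @ [([], HasType a A), ([], HasType b A), ([], HasType p (app Idt [A, a, b]))]
         @ sequence_premises [p, b, a] \<Delta> ts',
        HasType (J_term J a b p d ts') (subst (inst (ts' @ [p, b, a])) C))
        | A \<Delta> C d a b p ts'. length \<Delta> = length ts \<and> length ts' = length ts} \<in> id_rules Idt refl' J H"
      unfolding id_rules_def by blast
  qed
next
  fix n
  assume sc: "\<forall>(\<Delta>', I)\<in>set ?ps. judg_scoped (length \<Delta>' + n) I"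
    and "\<forall>I\<in>set (judg_presup (HasType (J_term J a b p d ts) (subst (inst (ts @ [p, b, a])) C))). judg_scoped n I"
  moreover have "scoped n t" if t: "t \<in> set ts" for t
  proof -
    obtain i where i: "i < length ts" "t = ts ! i" using t by (auto simp: in_set_conv_nth)
    let ?p = "([], HasType (ts ! i) (subst (inst (drop (Suc i) ts @ [p, b, a])) (\<Delta> ! i)))"
    have "?p \<in> set (sequence_premises [p, b, a] \<Delta> ts)"
      using i len by (simp add: sequence_premises_def)
    then show ?thesis using bspec[OF sc, of ?p] i(2) by simp
  qed
  ultimately show "judg_scoped n (HasType (J_term J a b p d ts) (subst (inst (ts @ [p, b, a])) C))"
    using len by (auto simp: elim_premises_def add.commute)
qed (use C derivable_wf[OF C] in auto)

lemma id_ctx_wf: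
  assumes "derivable T \<Gamma> (IsType A)"
  shows "wf_ctx T (id_ctx Idt A @ \<Gamma>)"
proof -
  have A: "derivable T (A # \<Gamma>) (IsType (subst wk A))"
    using weaken1[OF assms assms] by simp
  then have AA: "derivable T (subst wk A # A # \<Gamma>) (IsType (subst wk (subst wk A)))"
    using weaken1[OF A A] by simp
  have "wf_ctx T (subst wk A # A # \<Gamma>)"
    using A assms derivable_wf[OF assms] by (simp add: wf_ctx_Cons)
  from sub_ok_Var[OF this] have "derivable T (subst wk A # A # \<Gamma>) (HasType (Var 1) (subst wk (subst wk A)))"
    "derivable T (subst wk A # A # \<Gamma>) (HasType (Var 0) (subst wk (subst wk A)))"
    by (simp_all add: subst_subst wk_def[abs_def])
  from id_form[OF this] show ?thesis
    using A assms derivable_wf[OF assms] by (simp add: wf_ctx_Cons id_ctx_def)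
qed

lemma arrow_id_ctx:
  assumes "arrow \<Theta> \<sigma> \<Gamma>" "derivable T \<Gamma> (IsType A)"
    and "derivable T \<Theta> (HasType a (subst \<sigma> A))" "derivable T \<Theta> (HasType b (subst \<sigma> A))"
    and "derivable T \<Theta> (HasType p (IdT (subst \<sigma> A) a b))"
  shows "arrow \<Theta> (case_nat p (case_nat b (case_nat a \<sigma>))) (id_ctx Idt A @ \<Gamma>)"
  using id_ctx_wf[OF assms(2)] assms by (simp add: id_ctx_def arrow_Cons wf_ctx_Cons subst_subst wk_def)

lemma diag_eq: "diag refl' = case_nat (Rf (Var 0)) (case_nat (Var 0) (case_nat (Var 0) wk))"
  by (auto simp: fun_eq_iff diag_def wk_def split: nat.split)

lemma arrow_diag:
  assumes "derivable T \<Gamma> (IsType A)"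
  shows "arrow (A # \<Gamma>) (diag refl') (id_ctx Idt A @ \<Gamma>)"
proof -
  have wf: "wf_ctx T (A # \<Gamma>)" using assms derivable_wf[OF assms] by (simp add: wf_ctx_Cons)
  then have v: "derivable T (A # \<Gamma>) (HasType (Var 0) (subst wk A))"
    using variable[OF assms] by simp
  show ?thesis
    unfolding diag_eq by (rule arrow_id_ctx[OF arrow_wk[OF wf] assms v v refl_intro[OF v]])
qed

text \<open>\<open>J\<close> is applied with empty parameter over the ambient context
  \<open>?P\<close>, to its own three newest variables. So \<open>A\<close>, \<open>C\<close> and
  \<open>d\<close> are first weakened along \<open>?\<sigma>\<close>; instantiating the weakened
  \<open>C\<close> at these variables returns \<open>C\<close>.\<close>

lemma id_elim:
  assumes A: "derivable T \<Gamma> (IsType A)" and C: "derivable T (id_ctx Idt A @ \<Gamma>) (IsType C)"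
    and d: "derivable T (A # \<Gamma>) (HasType d (subst (diag refl') C))"
  shows "\<exists>j. derivable T (id_ctx Idt A @ \<Gamma>) (HasType j C)"
proof -
  let ?P = "id_ctx Idt A @ \<Gamma>" and ?\<sigma> = "\<lambda>i. Var (Suc (Suc (Suc i))) :: 'k expr"
  note wf = id_ctx_wf[OF A]
  have ok: "sub_ok T ?P Var ?P" using wf by (rule sub_ok_Var)
  then have \<sigma>: "arrow ?P ?\<sigma> \<Gamma>"
    using ok wf derivable_wf[OF A] by (simp add: arrow_def id_ctx_def add.commute)
  let ?A = "subst ?\<sigma> A"
  have ctx: "ctx_subst ?\<sigma> (id_ctx Idt A) = id_ctx Idt ?A"
    by (simp add: id_ctx_def subst_subst wk_def lift_def)
  let ?C = "subst (lift 3 ?\<sigma>) C" and ?d = "subst (lift (Suc 0) ?\<sigma>) d"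
  have A': "derivable T ?P (IsType ?A)" using arrow_subst[OF A \<sigma>] by simp
  have C': "derivable T (id_ctx Idt ?A @ ?P) (IsType ?C)"
    using arrow_subst[OF C arrow_lift[OF \<sigma> wf]] unfolding ctx by (simp add: id_ctx_def numeral_3_eq_3)
  have wfA: "wf_ctx T ([A] @ \<Gamma>)" using derivable_wf[OF d] by simp
  have "(\<lambda>i. subst (lift (Suc 0) ?\<sigma>) (diag refl' i)) = (\<lambda>i. subst (diag refl') (lift 3 ?\<sigma> i))"
    by (auto simp: fun_eq_iff diag_def lift_def subst_rename rename_subst)
  then have d': "derivable T (?A # ?P) (HasType ?d (subst (diag refl') ?C))"
    using arrow_subst[OF _ arrow_lift[OF \<sigma> wfA], of "HasType d (subst (diag refl') C)"] d by (simp add: subst_subst)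
  have v: "derivable T ?P (HasType (Var 2) ?A)" "derivable T ?P (HasType (Var 1) ?A)"
    "derivable T ?P (HasType (Var 0) (IdT ?A (Var 2) (Var 1)))"
    using ok by (simp_all add: id_ctx_def subst_subst wk_def numeral_3_eq_3 numeral_2_eq_2)
  have e: "(\<lambda>i. subst (inst [Var 0, Var 1, Var 2]) (lift 3 ?\<sigma> i)) = Var"
    by (auto simp: fun_eq_iff lift_def inst_def nth_Cons split: nat.split)
  then have CC: "subst (inst [Var 0, Var 1, Var 2]) ?C = C" by (simp add: subst_subst)
  have "derivable T ?P (HasType (J_term J (Var 2) (Var 1) (Var 0) ?d []) (subst (inst ([] @ [Var 0, Var 1, Var 2])) ?C))"
  proof (rule J_elim[where A = ?A and \<Delta> = "[]"])
    show "derivable T ?P (IsType (subst (inst ([] @ [Var 0, Var 1, Var 2])) ?C))"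
      using C CC by simp
  qed (use A' C' d' v in \<open>simp_all add: elim_premises_def sequence_premises_def\<close>)
  then show ?thesis using CC by auto
qed

text \<open>The contextual parameter is one variable of the type \<open>Q\<close> at
  \<open>x\<close>, and the motive is \<open>Q\<close> at \<open>y\<close>. On the diagonal both
  become \<open>Q\<close>, and the parameter itself, \<open>Var 0\<close>, is the required
  term.\<close>

lemma id_transport:
  assumes a: "derivable T \<Gamma> (HasType a A)" and b: "derivable T \<Gamma> (HasType b A)"
    and p: "derivable T \<Gamma> (HasType p (IdT A a b))"
    and Q: "derivable T (A # \<Gamma>) (IsType Q)" and c: "derivable T \<Gamma> (HasType c (subst (inst [a]) Q))"
  shows "\<exists>c'. derivable T \<Gamma> (HasType c' (subst (inst [b]) Q))"
proof -
  have A: "derivable T \<Gamma> (IsType A)" and wf: "wf_ctx T \<Gamma>" using type_wf[OF Q] by auto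
  let ?P = "id_ctx Idt A @ \<Gamma>"
  note wfP = id_ctx_wf[OF A]
  \<comment> \<open>In \<open>id_ctx\<close> the path has index 0, \<open>y\<close> index 1 and
    \<open>x\<close> index 2. The extra \<open>wk\<close> in \<open>?C\<close> below skips the
    parameter.\<close>
  let ?x = "case_nat (Var 2) (\<lambda>i. Var (Suc (Suc (Suc i)))) :: nat \<Rightarrow> 'k expr"
  let ?y = "case_nat (Var 1) (\<lambda>i. Var (Suc (Suc (Suc i)))) :: nat \<Rightarrow> 'k expr"
  let ?Q = "subst ?x Q" and ?C = "subst (\<lambda>i. subst wk (?y i)) Q"
  have ok: "sub_ok T ?P Var ?P" using wfP by (rule sub_ok_Var)
  then have up: "arrow ?P (\<lambda>i. Var (Suc (Suc (Suc i)))) \<Gamma>"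
    using ok wfP wf by (simp add: arrow_def id_ctx_def add.commute)
  have x: "arrow ?P ?x (A # \<Gamma>)" and y: "arrow ?P ?y (A # \<Gamma>)"
    using up A ok by (simp_all add: arrow_Cons id_ctx_def subst_subst wk_def numeral_3_eq_3 numeral_2_eq_2)
  have Q': "derivable T ?P (IsType ?Q)" using arrow_subst[OF Q x] by simp
  then have wfQ: "wf_ctx T (?Q # ?P)" using wfP by (simp add: wf_ctx_Cons)
  have C: "derivable T (?Q # ?P) (IsType ?C)"
    using arrow_subst[OF Q arrow_comp[OF arrow_wk[OF wfQ] y]] by simp
  have "(\<lambda>i. subst (diag refl') (?x i)) = Var"
    by (auto simp: fun_eq_iff diag_def split: nat.split)
  then have QQ: "subst (diag refl') ?Q = Q" by (simp add: subst_subst)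
  have "(\<lambda>i. subst (lift (Suc 0) (diag refl')) (subst wk (?y i))) = wk"
    by (auto simp: fun_eq_iff diag_def lift_def wk_def split: nat.split)
  then have CC: "subst (lift (Suc 0) (diag refl')) ?C = subst wk Q" by (simp add: subst_subst)
  have d: "derivable T (Q # A # \<Gamma>) (HasType (Var 0) (subst wk Q))"
    using Q by (rule variable)
  have "(\<lambda>i. subst (inst [p, b, a]) (?x i)) = inst [a]"
    by (auto simp: fun_eq_iff inst_def numeral_3_eq_3 numeral_2_eq_2 split: nat.split)
  then have Qa: "subst (inst [p, b, a]) ?Q = subst (inst [a]) Q" by (simp add: subst_subst)
  have "(\<lambda>i. subst (inst [c, p, b, a]) (subst wk (?y i))) = inst [b]"
    by (auto simp: fun_eq_iff inst_def wk_def numeral_3_eq_3 numeral_2_eq_2 split: nat.split)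
  then have Cb: "subst (inst [c, p, b, a]) ?C = subst (inst [b]) Q" by (simp add: subst_subst)
  have "derivable T \<Gamma> (HasType (J_term J a b p (Var 0) [c]) (subst (inst ([c] @ [p, b, a])) ?C))"
  proof (rule J_elim[where A = A and \<Delta> = "[?Q]"])
    show "derivable T \<Gamma> (IsType (subst (inst ([c] @ [p, b, a])) ?C))"
      using type_inst[OF Q b] Cb by simp
  qed (use A C d a b p c QQ CC Qa in \<open>simp_all add: elim_premises_def sequence_premises_def\<close>)
  then show ?thesis using Cb by auto
qed

lemma disp_path_structure_Cl:
  assumes "d \<in> disp"
  shows "\<exists>s t r. path_structure disp d s t r"
proof -
  obtain A \<Gamma> where wf: "wf_ctx T (A # \<Gamma>)" and d: "d = mor (A # \<Gamma>) wk \<Gamma>"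
    using assms by (auto simp: disp_def)
  then have A: "derivable T \<Gamma> (IsType A)" by (simp add: wf_ctx_Cons)
  let ?K = "subst wk A # A # \<Gamma>" and ?P = "id_ctx Idt A @ \<Gamma>"
  let ?y = "case_nat (Var (Suc 0)) (\<lambda>i. Var (Suc (Suc (Suc i)))) :: nat \<Rightarrow> 'k expr"
  let ?k = "mor ?P wk ?K"
  let ?s = "mor ?P (\<lambda>i. Var (Suc (Suc i))) (A # \<Gamma>)" and ?t = "mor ?P ?y (A # \<Gamma>)"
  let ?r = "mor (A # \<Gamma>) (diag refl') ?P"
  let ?p = "mor ?K (lift (Suc 0) wk) (A # \<Gamma>)" and ?q = "mor ?K wk (A # \<Gamma>)"
  note f = arrow_wk[OF wf] and r = arrow_diag[OF A]
  note pb = pullback_proj[OF wf f]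
  note q = arrow_wk[OF pb(1)]
  obtain I where P: "?P = I # ?K" by (simp add: id_ctx_def)
  have wfP: "wf_ctx T ?P" using id_ctx_wf[OF A] .
  have k: "arrow ?P wk ?K" using arrow_wk[of I ?K] wfP unfolding P by simp
  have s: "arrow ?P (\<lambda>i. Var (Suc (Suc i))) (A # \<Gamma>)"
    using arrow_comp[OF k q] by (simp add: wk_def)
  have y: "(\<lambda>i. subst wk (lift (Suc 0) wk i)) = ?y"
    by (auto simp: fun_eq_iff wk_def split: nat.split)
  have t: "arrow ?P ?y (A # \<Gamma>)"
    using arrow_comp[OF k pb(2)] unfolding y .
  \<comment> \<open>\<open>pullback_proj\<close> lists the projection to the newer endpoint
    \<open>y\<close> first; it is reversed so that \<open>?s\<close> becomes the older endpoint
    \<open>x\<close>.\<close>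
  have "pullback Cl d d ?q ?p"
    unfolding d using pullback_sym[OF pb(3)] f by simp
  moreover have "?k \<in> disp" using wfP unfolding P disp_def by blast
  moreover have "Comp Cl ?q ?k = ?s" "Comp Cl ?p ?k = ?t"
    using mor_Comp[OF k q] mor_Comp[OF k pb(2)] y by (simp_all add: wk_def)
  ultimately have "\<exists>p q. \<exists>k\<in>disp. pullback Cl d d p q \<and> Dom Cl k = Dom Cl ?s \<and> Cod Cl k = Dom Cl p \<and> Comp Cl p k = ?s \<and> Comp Cl q k = ?t"
    using k s q by (intro exI[of _ ?q] exI[of _ ?p] bexI[of _ ?k]) simp_all
  moreover have "Comp Cl d ?s = Comp Cl d ?t"
    using s t by (simp add: d proj_Comp)
  moreover have "Comp Cl ?s ?r = Ide Cl (ob (A # \<Gamma>))" "Comp Cl ?t ?r = Ide Cl (ob (A # \<Gamma>))"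
  proof -
    have "(\<lambda>i. diag refl' (Suc (Suc i))) = Var" "(\<lambda>i. subst (diag refl') (?y i)) = Var"
      by (auto simp: fun_eq_iff diag_def split: nat.split)
    then show "Comp Cl ?s ?r = Ide Cl (ob (A # \<Gamma>))" "Comp Cl ?t ?r = Ide Cl (ob (A # \<Gamma>))"
      using wf by (simp_all add: mor_Comp[OF r s] mor_Comp[OF r t] mor_Ide)
  qed
  moreover have "\<exists>a e. pullback Cl d (Comp Cl d (Comp Cl ?s u)) a e \<and>
      section_transport disp a e (Dom Cl u) (Comp Cl ?s u) (Comp Cl ?t u)"
    if u_Mor: "u \<in> Mor Cl" and u_Cod: "Cod Cl u = Dom Cl ?s" for u
  proof -
    obtain \<Theta> where \<Theta>: "wf_ctx T \<Theta>" "Dom Cl u = ob \<Theta>"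
      using Obj_simps(1)[OF u_Mor] by (rule Obj_cases)
    obtain \<upsilon> where \<upsilon>: "arrow \<Theta> \<upsilon> ?P" and u: "u = mor \<Theta> \<upsilon> ?P"
      using Mor_rep[OF u_Mor \<Theta>(2) _ \<Theta>(1) wfP] u_Cod s by auto
    \<comment> \<open>A map into the path space consists of the base point \<sigma>, the endpoints
      \<open>?a\<close> and \<open>?b\<close>, and the path \<open>\<upsilon> 0\<close>, all as
      terms over \<open>\<Theta>\<close>. The fibre in question is then the type
      \<open>subst \<sigma> A\<close>.\<close>
    define \<sigma> where "\<sigma> = (\<lambda>i. \<upsilon> (Suc (Suc (Suc i))))"
    let ?a = "\<upsilon> (Suc (Suc 0))" and ?b = "\<upsilon> (Suc 0)"
    have \<sigma>: "arrow \<Theta> \<sigma> \<Gamma>" and a: "derivable T \<Theta> (HasType ?a (subst \<sigma> A))" and b: "derivable T \<Theta> (HasType ?b (subst \<sigma> A))"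
      and path: "derivable T \<Theta> (HasType (\<upsilon> 0) (IdT (subst \<sigma> A) ?a ?b))"
      using \<upsilon> by (simp_all add: id_ctx_def arrow_Cons subst_subst wk_def \<sigma>_def)
    let ?A = "subst \<sigma> A # \<Theta>"
    let ?pa = "mor ?A (lift (Suc 0) \<sigma>) (A # \<Gamma>)" and ?pe = "mor ?A wk \<Theta>"
    note pb2 = pullback_proj[OF wf \<sigma>]
    have su: "Comp Cl ?s u = mor \<Theta> (case_nat ?a \<sigma>) (A # \<Gamma>)"
    proof -
      have "(\<lambda>i. \<upsilon> (Suc (Suc i))) = case_nat ?a \<sigma>" by (auto simp: fun_eq_iff \<sigma>_def split: nat.split)
      then show ?thesis by (simp add: u mor_Comp[OF \<upsilon> s])
    qed
    have tu: "Comp Cl ?t u = mor \<Theta> (case_nat ?b \<sigma>) (A # \<Gamma>)"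
    proof -
      have "(\<lambda>i. subst \<upsilon> (?y i)) = case_nat ?b \<sigma>" by (auto simp: fun_eq_iff \<sigma>_def split: nat.split)
      then show ?thesis by (simp add: u mor_Comp[OF \<upsilon> t])
    qed
    have ar: "arrow \<Theta> (inst [z]) ?A" and over: "Comp Cl ?pa (mor \<Theta> (inst [z]) ?A) = mor \<Theta> (case_nat z \<sigma>) (A # \<Gamma>)"
        "Comp Cl ?pe (mor \<Theta> (inst [z]) ?A) = Ide Cl (ob \<Theta>)"
      if "derivable T \<Theta> (HasType z (subst \<sigma> A))" for z
    proof -
      show ar: "arrow \<Theta> (inst [z]) ?A" using that by (rule arrow_inst)
      have "(\<lambda>i. subst (inst [z]) (lift (Suc 0) \<sigma> i)) = case_nat z \<sigma>"
        by (auto simp: fun_eq_iff subst_subst wk_def split: nat.split)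
      then show "Comp Cl ?pa (mor \<Theta> (inst [z]) ?A) = mor \<Theta> (case_nat z \<sigma>) (A # \<Gamma>)"
        by (simp add: mor_Comp[OF ar pb2(2)])
      show "Comp Cl ?pe (mor \<Theta> (inst [z]) ?A) = Ide Cl (ob \<Theta>)"
        using \<Theta>(1) by (simp add: proj_Comp[OF ar] mor_Ide)
    qed
    have "arrow \<Theta> (case_nat ?a \<sigma>) (A # \<Gamma>)"
      using \<sigma> A a by (simp add: arrow_Cons)
    then have dsu: "Comp Cl d (Comp Cl ?s u) = mor \<Theta> \<sigma> \<Gamma>"
      by (simp add: su d proj_Comp)
    have "\<exists>c'\<in>Mor Cl. Dom Cl c' = Dom Cl u \<and> Cod Cl c' = Dom Cl q \<and>
          Comp Cl ?pa (Comp Cl q c') = Comp Cl ?t u \<and> Comp Cl ?pe (Comp Cl q c') = Ide Cl (Dom Cl u)"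
      if q: "q \<in> disp" and c: "c \<in> Mor Cl" "Cod Cl q = Dom Cl ?pa" "Dom Cl c = Dom Cl u" "Cod Cl c = Dom Cl q"
        "Comp Cl ?pa (Comp Cl q c) = Comp Cl ?s u" "Comp Cl ?pe (Comp Cl q c) = Ide Cl (Dom Cl u)" for q c
    proof -
      have "Cod Cl q = ob ?A" using c(2) pb2(2) by simp
      then obtain Q where wfQ: "wf_ctx T (Q # ?A)" and q': "q = mor (Q # ?A) wk ?A"
        using disp_rep[OF q _ pb2(1)] by auto
      note arQ = arrow_wk[OF wfQ]
      have Q: "derivable T ?A (IsType Q)" using wfQ by (simp add: wf_ctx_Cons)
      obtain \<gamma> where \<gamma>: "arrow \<Theta> \<gamma> (Q # ?A)" and c': "c = mor \<Theta> \<gamma> (Q # ?A)"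
        using Mor_rep[OF c(1) _ _ \<Theta>(1) wfQ] c(3,4) \<Theta>(2) q' arQ by auto
      have qc: "Comp Cl q c = mor \<Theta> (\<lambda>i. \<gamma> (Suc i)) ?A"
        using \<gamma> by (simp add: q' c' proj_Comp)
      have ar\<gamma>: "arrow \<Theta> (\<lambda>i. \<gamma> (Suc i)) ?A" using \<gamma> by (simp add: arrow_Cons)
      \<comment> \<open>Both maps have the same projections from the pullback, so they agree; hence
        the newest component of \<open>c\<close> converts to a term of \<open>Q\<close> at
        \<open>?a\<close>, to which \<open>id_transport\<close> applies.\<close>
      have "mor \<Theta> (\<lambda>i. \<gamma> (Suc i)) ?A = mor \<Theta> (inst [?a]) ?A"
        by (rule pullback_eqI[OF pb2(3)])
          (use f \<sigma> ar\<gamma> ar[OF a] pb2(2) over[OF a] c(5,6) su \<Theta>(2) in \<open>simp_all add: qc\<close>)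
      from mor_over[OF \<gamma> ar[OF a] this] have "derivable T \<Theta> (HasType (\<gamma> 0) (subst (inst [?a]) Q))"
        by (simp add: arrow_Cons)
      from id_transport[OF a b path Q this] obtain z where z: "derivable T \<Theta> (HasType z (subst (inst [?b]) Q))" ..
      then have arz: "arrow \<Theta> (case_nat z (inst [?b])) (Q # ?A)"
        using ar[OF b] Q by (simp add: arrow_Cons[of _ _ Q])
      then have "Comp Cl q (mor \<Theta> (case_nat z (inst [?b])) (Q # ?A)) = mor \<Theta> (inst [?b]) ?A"
        by (simp add: q' proj_Comp)
      then show ?thesis
        using over[OF b] arz arQ tu \<Theta>(2) q' by (intro bexI[of _ "mor \<Theta> (case_nat z (inst [?b])) (Q # ?A)"]) simp_all
    qed
    then have "section_transport disp ?pa ?pe (Dom Cl u) (Comp Cl ?s u) (Comp Cl ?t u)"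
      by (rule section_transportI)
    then show ?thesis using pb2(3) unfolding dsu d[symmetric] by blast
  qed
  moreover have "\<exists>j\<in>Mor Cl. Dom Cl j = Dom Cl ?s \<and> Cod Cl j = Dom Cl c \<and> Comp Cl c j = Ide Cl (Dom Cl ?s)"
    if c: "c \<in> disp" and e: "e \<in> Mor Cl" "Cod Cl c = Dom Cl ?s" "Dom Cl e = Dom Cl ?r" "Cod Cl e = Dom Cl c" "Comp Cl c e = ?r" for c e
  proof -
    have "Cod Cl c = ob ?P" using e(2) s by simp
    then obtain B where wfB: "wf_ctx T (B # ?P)" and c': "c = mor (B # ?P) wk ?P"
      using disp_rep[OF c _ wfP] by auto
    note arB = arrow_wk[OF wfB]
    have B: "derivable T ?P (IsType B)" using wfB by (simp add: wf_ctx_Cons)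
    obtain \<delta> where \<delta>: "arrow (A # \<Gamma>) \<delta> (B # ?P)" and e': "e = mor (A # \<Gamma>) \<delta> (B # ?P)"
      using Mor_rep[OF e(1) _ _ wf wfB] e(3,4) c' arB r by auto
    \<comment> \<open>A lift of reflexivity along the projection of \<open>B\<close> is, up to
      conversion of its newest component, a term of \<open>B\<close> on the diagonal, as
      \<open>id_elim\<close> requires.\<close>
    have "mor (A # \<Gamma>) (\<lambda>i. \<delta> (Suc i)) ?P = ?r"
      using e(5) \<delta> by (simp add: c' e' proj_Comp)
    from mor_over[OF \<delta> r this] have "derivable T (A # \<Gamma>) (HasType (\<delta> 0) (subst (diag refl') B))"
      by (simp add: arrow_Cons[of _ _ B])
    from id_elim[OF A B this] obtain j where j: "derivable T ?P (HasType j B)" ..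
    note arj = arrow_inst[OF j]
    show ?thesis
      using arj arB s c' wfP by (intro bexI[of _ "mor ?P (inst [j]) (B # ?P)"]) (simp_all add: proj_Comp mor_Ide)
  qed
  ultimately have "path_structure disp d ?s ?t ?r"
    unfolding path_structure_def using s t r f d by simp
  then show ?thesis by blast
qed

lemma identity_category_Cl: "identity_category Cl disp"
  by unfold_locales (use terminal_fib_Cl disp_path_structure_Cl in blast)+

end

theorem corollary5p10:
  fixes T :: "'k type_theory"
  assumes "dependent_type_theory T"
    and "strong_sums T"
    and "propositional_identity_types T"
  shows "\<exists>weq. path_category (classifying_category T) weq (fibrations T)"
proof -
  obtain unit star \<Sigma> pair fst' snd' where sums: "unit_rules unit star \<subseteq> T" "sum_rules \<Sigma> pair fst' snd' \<subseteq> T"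
    using assms(2) unfolding strong_sums_def by blast
  obtain Idt refl' J H where ids: "id_rules Idt refl' J H \<subseteq> T"
    using assms(3) unfolding propositional_identity_types_def by blast
  interpret identity_theory T unit star \<Sigma> pair fst' snd' Idt refl' J H
    by unfold_locales (fact assms(1) sums ids)+
  show ?thesis
    using identity_category.path_category_weq_fib[OF identity_category_Cl] fibrations_eq_fib by auto
qed

end
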